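(* Let $\Theta$ be either $\Theta_{\mathcal T}$ (with data from the tournament model) or $\Theta_{\mathcal G}$ (with data from the graph model), and let $\Theta(\alpha,L,L')\subset\Theta$ be the corresponding class of upper and lower Hölder matrices. There exists a universal constant $C<\infty$ such that for all $\alpha,L,L'>0$, every integer $n\ge2$ and every $p\in[0,1]$ with $p\ge\frac{2\log n}{n}$, $$\sup_{\theta^*\in\Theta(\alpha,L,L')}\frac1{n^2}\,\mathbb E\|\hat\theta-\theta^*\|^2\le C\Big[\Big(\frac L{L'}\Big)^2\frac{\log n}{np}+\frac{(\log n)^2}{np}\Big].$$
   Context: Notation: $[n]=\{1,\dots,n\}$; $S_n$ is the set of permutations of $[n]$; for an $n\times n$ matrix $\theta$ and $\pi\in S_n$, $(\theta\circ\pi)_{ij}=\theta_{\pi(i),\pi(j)}$; $\|\cdot\|$ is the Frobenius norm; $\log$ is the natural logarithm. Parameter spaces: $\mathcal T$ is the set of $\theta\in[0,1]^{n\times n}$ such that $\theta_{ij}\le\theta_{ik}$ whenever $i\ne k$, $i\ne j$, $k<j$; $\theta_{ji}=1-\theta_{ij}$ for all $i\neq j$; $\theta_{ii}=0$ for all $i$; and $\theta_{ij}\le\frac12$ for all $i<j$. $\mathcal G$ is the set of $\theta\in[0,1]^{n\times n}$ such that $\theta_{ij}\le\theta_{ik}$ whenever $i\ne k$, $i\ne j$, $j<k$; $\theta_{ji}=\theta_{ij}$ for all $i\ne j$; and $\theta_{ii}=0$ for all $i$. Set $\Theta_{\mathcal T}=\{\theta\circ\pi:\theta\in\mathcal T,\pi\in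 S_n\}$ and $\Theta_{\mathcal G}=\{\theta\circ\pi:\theta\in\mathcal G,\pi\in S_n\}$. Upper and lower Hölder class: for $\alpha,L,L'>0$, $\Theta(\alpha,L,L')$ is the set of $\theta\in\Theta$ for which there is $\pi\in S_n$ such that $\vartheta=\theta\circ\pi$ satisfies $L'\frac{|j-k|^\alpha}{n^\alpha}\le|\vartheta_{ij}-\vartheta_{ik}|\le L\frac{|j-k|^\alpha}{n^\alpha}$ for all $i,j,k\in[n]$ with $i\ne j$, $i\ne k$. If the class is empty the statement is vacuous. Data with true parameter $\theta^*$ and observation probability $p$: for $i<j$ there are independent outcomes with law $\mathrm{Bern}(\theta^*_{ij})$; each above-diagonal entry is observed with probability $p$, independently over entries and independently of the outcomes. For $i<j$ set $y_{ij}$ equal to the outcome if it is observed and $y_{ij}=\frac12$ if it is missing. The lower triangle is $y_{ji}=1-y_{ij}$ in the tournament model and $y_{ji}=y_{ij}$ in the graph model ($i<j$), and $y_{ii}=0$. Let $\hat p$ be the number of observed above-diagonal entries divided by $\binom n2$. Estimator: let $r_i=\sum_{j=1}^n y_{ij}$ and let $\hat\sigma$ be a permutation with $r_{\hat\sigma(1)}\le\dots\le r_{\hat\sigma(n)}$, ties being broken uniformly at random. Let $J$ be the $n\times n$ matrix with $J_{ij}=1$ for $i\ne j$ and $J_{ii}=0$. Let $\mathrm{Proj}$ be the Euclidean (Frobenius) projection onto the closed convex set $\mathcal T$ in the tournament model, and onto $\mathcal G$ in the graph model. Then $$\hat\theta=\mathrm{Proj}\Big(\big(\tfrac{y-J/2}{\hat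 p}+\tfrac J2\big)\circ\hat\sigma\Big)\circ\hat\sigma^{-1}\ \text{ if }\hat p\ge\tfrac1n,\qquad \hat\theta=\tfrac J2\ \text{ otherwise}.$$ *)

theory Defs
  imports "HOL-Probability.Probability" "HOL-Combinatorics.Permutations" "HOL-Library.Monad_Syntax"
begin

text \<open>
  An n-by-n real matrix is a function on pairs of naturals with indices in {1..n} that
  vanishes outside that range, so that equality of functions is equality of matrices.
\<close>

type_synonym matrix = "nat \<Rightarrow> nat \<Rightarrow> real"

definition matrices :: "nat \<Rightarrow> matrix set" where
  "matrices n = {\<theta>. \<forall>i j. i \<notin> {1..n} \<or> j \<notin> {1..n} \<longrightarrow> \<theta> i j = 0}"

definition frob_norm :: "nat \<Rightarrow> matrix \<Rightarrow> real" where
  "frob_norm n A = sqrt (\<Sum>i\<in>{1..n}. \<Sum>j\<in>{1..n}. (A i j)\<^sup>2)"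

definition permute :: "matrix \<Rightarrow> (nat \<Rightarrow> nat) \<Rightarrow> matrix" where
  "permute \<theta> \<pi> = (\<lambda>i j. \<theta> (\<pi> i) (\<pi> j))"

datatype model = Tournament | Graph

definition tournament_matrices :: "nat \<Rightarrow> matrix set" where
  "tournament_matrices n = {\<theta> \<in> matrices n.
     (\<forall>i\<in>{1..n}. \<forall>j\<in>{1..n}. \<theta> i j \<in> {0..1}) \<and>
     (\<forall>i\<in>{1..n}. \<forall>j\<in>{1..n}. \<forall>k\<in>{1..n}. i \<noteq> k \<and> i \<noteq> j \<and> k < j \<longrightarrow> \<theta> i j \<le> \<theta> i k) \<and>
     (\<forall>i\<in>{1..n}. \<forall>j\<in>{1..n}. i \<noteq> j \<longrightarrow> \<theta> j i = 1 - \<theta> i j) \<and>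
     (\<forall>i\<in>{1..n}. \<theta> i i = 0) \<and>
     (\<forall>i\<in>{1..n}. \<forall>j\<in>{1..n}. i < j \<longrightarrow> \<theta> i j \<le> 1 / 2)}"

definition graph_matrices :: "nat \<Rightarrow> matrix set" where
  "graph_matrices n = {\<theta> \<in> matrices n.
     (\<forall>i\<in>{1..n}. \<forall>j\<in>{1..n}. \<theta> i j \<in> {0..1}) \<and>
     (\<forall>i\<in>{1..n}. \<forall>j\<in>{1..n}. \<forall>k\<in>{1..n}. i \<noteq> k \<and> i \<noteq> j \<and> j < k \<longrightarrow> \<theta> i j \<le> \<theta> i k) \<and>
     (\<forall>i\<in>{1..n}. \<forall>j\<in>{1..n}. i \<noteq> j \<longrightarrow> \<theta> j i = \<theta> i j) \<and>
     (\<forall>i\<in>{1..n}. \<theta> i i = 0)}"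

fun ordered_matrices :: "model \<Rightarrow> nat \<Rightarrow> matrix set" where
  "ordered_matrices Tournament n = tournament_matrices n"
| "ordered_matrices Graph n = graph_matrices n"

definition param_space :: "model \<Rightarrow> nat \<Rightarrow> matrix set" where
  "param_space m n = {permute \<theta> \<pi> | \<theta> \<pi>. \<theta> \<in> ordered_matrices m n \<and> \<pi> permutes {1..n}}"

definition holder_class :: "model \<Rightarrow> nat \<Rightarrow> real \<Rightarrow> real \<Rightarrow> real \<Rightarrow> matrix set" where
  "holder_class m n \<alpha> L L' = {\<theta> \<in> param_space m n. \<exists>\<pi>. \<pi> permutes {1..n} \<and>
     (\<forall>i\<in>{1..n}. \<forall>j\<in>{1..n}. \<forall>k\<in>{1..n}. i \<noteq> j \<and> i \<noteq> k \<longrightarrow>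
        L' * (\<bar>real j - real k\<bar> powr \<alpha> / real n powr \<alpha>)
          \<le> \<bar>permute \<theta> \<pi> i j - permute \<theta> \<pi> i k\<bar> \<and>
        \<bar>permute \<theta> \<pi> i j - permute \<theta> \<pi> i k\<bar>
          \<le> L * (\<bar>real j - real k\<bar> powr \<alpha> / real n powr \<alpha>))}"

definition upper_pairs :: "nat \<Rightarrow> (nat \<times> nat) set" where
  "upper_pairs n = {(i, j). 1 \<le> i \<and> i < j \<and> j \<le> n}"

definition outcomes_pmf :: "nat \<Rightarrow> matrix \<Rightarrow> (nat \<times> nat \<Rightarrow> bool) pmf" where
  "outcomes_pmf n \<theta> = Pi_pmf (upper_pairs n) False (\<lambda>(i, j). bernoulli_pmf (\<theta> i j))"

definition observed_pmf :: "nat \<Rightarrow> real \<Rightarrow> (nat \<times> nat \<Rightarrow> bool) pmf" where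
  "observed_pmf n p = Pi_pmf (upper_pairs n) False (\<lambda>_. bernoulli_pmf p)"

definition upper_data :: "(nat \<times> nat \<Rightarrow> bool) \<Rightarrow> (nat \<times> nat \<Rightarrow> bool) \<Rightarrow> matrix" where
  "upper_data X B i j = (if B (i, j) then of_bool (X (i, j)) else 1 / 2)"

definition data_matrix ::
    "model \<Rightarrow> nat \<Rightarrow> (nat \<times> nat \<Rightarrow> bool) \<Rightarrow> (nat \<times> nat \<Rightarrow> bool) \<Rightarrow> matrix" where
  "data_matrix m n X B i j =
     (if (i, j) \<in> upper_pairs n then upper_data X B i j
      else if (j, i) \<in> upper_pairs n then
        (case m of Tournament \<Rightarrow> 1 - upper_data X B j i | Graph \<Rightarrow> upper_data X B j i)
      else 0)"

definition p_hat :: "nat \<Rightarrow> (nat \<times> nat \<Rightarrow> bool) \<Rightarrow> real" where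
  "p_hat n B = real (card {e \<in> upper_pairs n. B e}) / real (n choose 2)"

definition row_sum :: "nat \<Rightarrow> matrix \<Rightarrow> nat \<Rightarrow> real" where
  "row_sum n y i = (\<Sum>j\<in>{1..n}. y i j)"

definition sorting_perms :: "nat \<Rightarrow> matrix \<Rightarrow> (nat \<Rightarrow> nat) set" where
  "sorting_perms n y = {\<sigma>. \<sigma> permutes {1..n} \<and>
     (\<forall>i\<in>{1..n}. \<forall>j\<in>{1..n}. i \<le> j \<longrightarrow> row_sum n y (\<sigma> i) \<le> row_sum n y (\<sigma> j))}"

definition J_matrix :: "nat \<Rightarrow> matrix" where
  "J_matrix n i j = (if i \<in> {1..n} \<and> j \<in> {1..n} \<and> i \<noteq> j then 1 else 0)"

text \<open>
  The Euclidean projection; the minimiser is unique because the target sets are nonempty,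
  closed and convex sets of matrices vanishing outside the index range.
\<close>

definition Proj :: "model \<Rightarrow> nat \<Rightarrow> matrix \<Rightarrow> matrix" where
  "Proj m n A = arg_min_on (\<lambda>\<theta>. frob_norm n (\<lambda>i j. A i j - \<theta> i j)) (ordered_matrices m n)"

definition estimator :: "model \<Rightarrow> nat \<Rightarrow> matrix \<Rightarrow> real \<Rightarrow> (nat \<Rightarrow> nat) \<Rightarrow> matrix" where
  "estimator m n y ph \<sigma> =
     (if ph \<ge> 1 / real n
      then permute
             (Proj m n
               (permute (\<lambda>i j. (y i j - J_matrix n i j / 2) / ph + J_matrix n i j / 2) \<sigma>))
             (inv \<sigma>)
      else (\<lambda>i j. J_matrix n i j / 2))"

text \<open>
  The law of the estimator. Uniform tie-breaking means that, given the data, the sorting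
  permutation is uniform on the set of all permutations sorting the row sums.
\<close>

definition estimator_pmf :: "model \<Rightarrow> nat \<Rightarrow> matrix \<Rightarrow> real \<Rightarrow> matrix pmf" where
  "estimator_pmf m n \<theta> p = do {
     X \<leftarrow> outcomes_pmf n \<theta>;
     B \<leftarrow> observed_pmf n p;
     let y = data_matrix m n X B;
     \<sigma> \<leftarrow> pmf_of_set (sorting_perms n y);
     return_pmf (estimator m n y (p_hat n B) \<sigma>)
   }"

end

theory Submission
  imports Defs
begin

text \<open>
  Write the data as \<open>y - J/2 = p (\<theta> - J/2) + z\<close> with centred noise \<open>z\<close>. Comparing row sums,
  which concentrate at scale \<open>sqrt (n p ln n)\<close>, shows that the empirical ordering moves each row
  sum of \<open>\<theta>\<close> by \<open>O (sqrt (n ln n / p))\<close>; the two-sided Hoelder condition bounds the Euclidean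
  distance of two rows by \<open>L / L'\<close> times the difference of their sums divided by \<open>sqrt n\<close>.

  For the projection error, the inner product of the noise with a difference of two bi-isotone
  matrices is expanded in the martingale of averages over dyadic blocks. At side length \<open>s\<close> the
  increments of an isotone matrix have total size \<open>O (n / s)\<close>, by telescoping along rows and
  columns of blocks, so blocks with noise at most \<open>O (s ln n)\<close> are harmless; the remaining blocks
  carry little energy, uniformly over all labellings of rows and columns, because the union bound
  over labellings costs only \<open>n ln n\<close>. This uniformity takes care of the data-dependent
  permutation, and summing over \<open>O (ln n)\<close> levels gives \<open>n (ln n)\<^sup>2 / p\<close>.
\<close>

subsection \<open>Exponential tail bounds\<close>

text \<open>The sorting permutation and the projection both depend on the noise, so no tail bound
  applies directly to the inner product of the noise with the projection error. All randomness is
  therefore spent on one event, \<open>good_data\<close>; on it the argument is deterministic. Its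
  main clause, \<open>block_bounded\<close>, is a description-length bound: a weight on blocks pays
  for the labellings and 8 \<open>ln n\<close> for each nonzero value. Weights fitted to the large
  blocks of the actual noise earn at least four times that price per block, so their total gain has
  order n \<open>ln n\<close>. Dyadic increments are orthogonal, so conceding p/16 of the energy at
  every level costs p/16 of the squared norm only once. In the basic inequality of the projection
  the noise carries the factor 2 / \<open>p_hat\<close> \<le> 4/p, which turns this into a quarter
  of the squared error, and that can be absorbed. The zero diagonal breaks isotonicity. The noise
  vanishes there, so the diagonal may be refilled at a price of n in the squared norm.\<close>

lemma exp_le_quadratic:
  fixes x :: real
  assumes "\<bar>x\<bar> \<le> 1"
  shows "exp x \<le> 1 + x + x\<^sup>2"
proof (cases "x \<ge> 0")
  case True
  then show ?thesis using assms exp_bound by auto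
next
  case False
  have "exp x = 1 / exp (-x)" by (simp add: exp_minus field_simps)
  also have "\<dots> \<le> 1 / (1 - x)"
    using exp_ge_add_one_self[of "-x"] False by (intro divide_left_mono) auto
  also have "\<dots> \<le> 1 + x + x\<^sup>2"
  proof -
    have "(1 + x + x\<^sup>2) * (1 - x) = 1 + x\<^sup>2 * (- x)"
      by (simp add: power2_eq_square algebra_simps)
    moreover have "x\<^sup>2 * (- x) \<ge> 0" using False by (intro mult_nonneg_nonneg) auto
    ultimately show ?thesis using False by (simp add: field_simps)
  qed
  finally show ?thesis .
qed

lemma expectation_pair_pmf_finite:
  fixes h :: "'a \<times> 'b \<Rightarrow> real"
  assumes "finite (set_pmf M)" "finite (set_pmf N)"
  shows "measure_pmf.expectation (pair_pmf M N) h =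
    measure_pmf.expectation M (\<lambda>x. measure_pmf.expectation N (\<lambda>y. h (x, y)))"
proof -
  have "measure_pmf.expectation (pair_pmf M N) h =
     (\<Sum>z\<in>set_pmf M \<times> set_pmf N. pmf (pair_pmf M N) z *\<^sub>R h z)"
    by (rule integral_measure_pmf) (use assms in auto)
  also have "\<dots> = (\<Sum>x\<in>set_pmf M. pmf M x *\<^sub>R (\<Sum>y\<in>set_pmf N. pmf N y *\<^sub>R h (x, y)))"
    unfolding sum.cartesian_product[symmetric] scaleR_sum_right
    by (auto simp: sum.cartesian_product pmf_pair intro!: sum.cong)
  also have "\<dots> = measure_pmf.expectation M (\<lambda>x. measure_pmf.expectation N (\<lambda>y. h (x, y)))"
    by (simp add: integral_measure_pmf[OF assms(1)] integral_measure_pmf[OF assms(2)])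
  finally show ?thesis .
qed

lemma prob_le_expectation:
  fixes h :: "'a \<Rightarrow> real"
  assumes fin: "finite (set_pmf M)" and nn: "\<And>x. h x \<ge> 0" and "\<And>x. x \<in> A \<Longrightarrow> h x \<ge> 1"
  shows "measure_pmf.prob M A \<le> measure_pmf.expectation M h"
proof -
  have "measure_pmf.prob M A = measure_pmf.expectation M (indicat_real A)" by simp
  also have "\<dots> \<le> measure_pmf.expectation M h"
    by (intro integral_mono integrable_measure_pmf_finite fin)
       (use assms in \<open>auto simp: indicator_def\<close>)
  finally show ?thesis .
qed

lemma finite_set_Pi_pmf:
  fixes P :: "'a \<Rightarrow> bool pmf"
  assumes "finite U"
  shows "finite (set_pmf (Pi_pmf U d P))"
  by (rule finite_subset[OF set_Pi_pmf_subset'[OF assms]]) (use assms in auto)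

text \<open>Chernoff's bound with the exponential parameter fixed at 1: the parameter is carried by
  the scale of \<open>\<psi>\<close>. Independence factors the exponential moment, and by the
  quadratic bound each centred factor has moment at most 1 + \<open>q e\<close> \<le> exp
  (\<open>q e\<close>).\<close>

lemma pair_Pi_pmf_exp_tail:
  fixes P Q :: "'a \<Rightarrow> bool pmf" and \<psi> :: "'a \<Rightarrow> bool \<Rightarrow> bool \<Rightarrow> real"
  assumes fin: "finite U"
    and bnd: "\<And>e x b. e \<in> U \<Longrightarrow> \<bar>\<psi> e x b\<bar> \<le> 1"
    and mean: "\<And>e. e \<in> U \<Longrightarrow>
      measure_pmf.expectation (P e) (\<lambda>x. measure_pmf.expectation (Q e) (\<psi> e x)) = 0"
    and var: "\<And>e. e \<in> U \<Longrightarrow>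
      measure_pmf.expectation (P e) (\<lambda>x. measure_pmf.expectation (Q e) (\<lambda>b. (\<psi> e x b)\<^sup>2)) \<le> q e"
  shows "measure_pmf.prob (pair_pmf (Pi_pmf U d P) (Pi_pmf U d Q))
      {(X, B). (\<Sum>e\<in>U. \<psi> e (X e) (B e)) \<ge> (\<Sum>e\<in>U. q e) + K} \<le> exp (- K)"
proof -
  let ?D = "pair_pmf (Pi_pmf U d P) (Pi_pmf U d Q)"
  note fins = finite_set_Pi_pmf[OF fin, of d P] finite_set_Pi_pmf[OF fin, of d Q]
  have [simp]: "integrable (measure_pmf (R :: bool pmf)) (f :: bool \<Rightarrow> real)" for R f
    by (rule integrable_measure_pmf_finite) simp
  have "measure_pmf.expectation ?D (\<lambda>(X, B). \<Prod>e\<in>U. exp (\<psi> e (X e) (B e))) =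
    measure_pmf.expectation (Pi_pmf U d P) (\<lambda>X.
      \<Prod>e\<in>U. measure_pmf.expectation (Q e) (\<lambda>b. exp (\<psi> e (X e) b)))"
    by (subst expectation_pair_pmf_finite[OF fins], simp,
        subst expectation_prod_Pi_pmf[OF fin]) auto
  also have "\<dots> = (\<Prod>e\<in>U. measure_pmf.expectation (P e) (\<lambda>x.
      measure_pmf.expectation (Q e) (\<lambda>b. exp (\<psi> e x b))))"
    by (subst expectation_prod_Pi_pmf[OF fin]) (auto intro!: Bochner_Integration.integral_nonneg)
  also have "\<dots> \<le> (\<Prod>e\<in>U. exp (q e))"
  proof (intro prod_mono conjI Bochner_Integration.integral_nonneg)
    fix e assume e: "e \<in> U"
    have "measure_pmf.expectation (P e) (\<lambda>x. measure_pmf.expectation (Q e) (\<lambda>b. exp (\<psi> e x b)))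
      \<le> measure_pmf.expectation (P e) (\<lambda>x. measure_pmf.expectation (Q e)
          (\<lambda>b. 1 + \<psi> e x b + (\<psi> e x b)\<^sup>2))"
      by (intro integral_mono exp_le_quadratic bnd e) auto
    also have "\<dots> \<le> 1 + q e" using mean[OF e] var[OF e] by simp
    also have "\<dots> \<le> exp (q e)" by simp
    finally show "measure_pmf.expectation (P e) (\<lambda>x. measure_pmf.expectation (Q e) (\<lambda>b. exp (\<psi> e x b)))
      \<le> exp (q e)" .
  qed auto
  finally have E: "measure_pmf.expectation ?D (\<lambda>(X, B). \<Prod>e\<in>U. exp (\<psi> e (X e) (B e)))
     \<le> exp (\<Sum>e\<in>U. q e)" using fin by (simp add: exp_sum)
  have "measure_pmf.prob ?D {(X, B). (\<Sum>e\<in>U. \<psi> e (X e) (B e)) \<ge> (\<Sum>e\<in>U. q e) + K}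
    \<le> measure_pmf.expectation ?D (\<lambda>z. exp (- (\<Sum>e\<in>U. q e) - K) *
         (case z of (X, B) \<Rightarrow> \<Prod>e\<in>U. exp (\<psi> e (X e) (B e))))"
    using fin fins
    by (intro prob_le_expectation)
       (auto simp: exp_sum[symmetric] exp_add[symmetric] intro!: prod_nonneg)
  also have "\<dots> \<le> exp (- (\<Sum>e\<in>U. q e) - K) * exp (\<Sum>e\<in>U. q e)"
    using E by simp
  also have "\<dots> = exp (- K)" by (simp add: exp_add[symmetric])
  finally show ?thesis .
qed

section \<open>The upper triangle and the symmetry of the two models\<close>

lemma finite_upper_pairs [simp]: "finite (upper_pairs n)"
  by (rule finite_subset[of _ "{1..n} \<times> {1..n}"]) (auto simp: upper_pairs_def)

lemma card_upper_pairs: "card (upper_pairs n) = n choose 2"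
proof -
  have "bij_betw (\<lambda>(i, j). {i, j}) (upper_pairs n) {A. A \<subseteq> {1..n} \<and> card A = 2}"
    unfolding bij_betw_def
  proof (intro conjI equalityI subsetI)
    show "inj_on (\<lambda>(i, j). {i, j}) (upper_pairs n)"
      by (auto simp: inj_on_def upper_pairs_def doubleton_eq_iff)
  next
    fix A assume "A \<in> {A. A \<subseteq> {1..n} \<and> card A = 2}"
    then obtain x y where "A = {x, y}" "x \<noteq> y" "{x, y} \<subseteq> {1..n}"
      by (auto simp: card_2_iff)
    then have "A = (case (min x y, max x y) of (i, j) \<Rightarrow> {i, j})"
      "(min x y, max x y) \<in> upper_pairs n"
      by (auto simp: upper_pairs_def min_def max_def)
    then show "A \<in> (\<lambda>(i, j). {i, j}) ` upper_pairs n" by blast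
  qed (auto simp: upper_pairs_def)
  then have "card (upper_pairs n) = card {A. A \<subseteq> {1..n} \<and> card A = 2}"
    by (rule bij_betw_same_card)
  then show ?thesis by (simp add: n_subsets)
qed

lemma sum_matrix_split:
  fixes f :: "nat \<Rightarrow> nat \<Rightarrow> 'a :: comm_monoid_add"
  shows "(\<Sum>i\<in>{1..n}. \<Sum>j\<in>{1..n}. f i j) =
    (\<Sum>(i, j)\<in>upper_pairs n. f i j + f j i) + (\<Sum>i\<in>{1..n}. f i i)"
proof -
  let ?U = "upper_pairs n" and ?L = "prod.swap ` upper_pairs n" and ?D = "(\<lambda>i. (i, i)) ` {1..n}"
  have dec: "{1..n} \<times> {1..n} = (?U \<union> ?L) \<union> ?D"
    by (auto simp: upper_pairs_def image_iff)
  have "(\<Sum>i\<in>{1..n}. \<Sum>j\<in>{1..n}. f i j) = (\<Sum>(i, j)\<in>(?U \<union> ?L) \<union> ?D. f i j)"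
    by (simp only: sum.cartesian_product dec[symmetric])
  also have "\<dots> = (\<Sum>(i, j)\<in>?U. f i j) + (\<Sum>(i, j)\<in>?L. f i j) + (\<Sum>(i, j)\<in>?D. f i j)"
  proof -
    have "?U \<inter> ?L = {}" "(?U \<union> ?L) \<inter> ?D = {}" by (auto simp: upper_pairs_def)
    then show ?thesis by (simp add: sum.union_disjoint)
  qed
  also have "(\<Sum>(i, j)\<in>?L. f i j) = (\<Sum>(i, j)\<in>?U. f j i)"
    by (simp add: sum.reindex case_prod_unfold)
  also have "(\<Sum>(i, j)\<in>?D. f i j) = (\<Sum>i\<in>{1..n}. f i i)"
    by (simp add: sum.reindex inj_on_def)
  finally show ?thesis by (simp add: sum.distrib case_prod_unfold)
qed

text \<open>Off the diagonal, subtracting 1/2 makes tournament matrices antisymmetric and graph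
  matrices symmetric. One transposition rule with this sign serves both models.\<close>

definition model_sign :: "model \<Rightarrow> real" where
  "model_sign m = (case m of Tournament \<Rightarrow> - 1 | Graph \<Rightarrow> 1)"

lemma model_sign_square [simp]: "(model_sign m)\<^sup>2 = 1" "\<bar>model_sign m\<bar> = 1"
  by (cases m; simp add: model_sign_def)+

lemma ordered_matricesD:
  assumes "\<theta> \<in> ordered_matrices m n" "i \<in> {1..n}" "j \<in> {1..n}"
  shows "\<theta> i j \<in> {0..1}" "\<theta> i i = 0"
    "i \<noteq> j \<Longrightarrow> \<theta> j i - 1 / 2 = model_sign m * (\<theta> i j - 1 / 2)"
proof -
  note i = assms(2) and j = assms(3)
  show "\<theta> i j \<in> {0..1}"
    using assms(1) i j by (cases m) (simp_all add: tournament_matrices_def graph_matrices_def)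
  show "\<theta> i i = 0"
    using assms(1) i by (cases m) (simp_all add: tournament_matrices_def graph_matrices_def)
  show "\<theta> j i - 1 / 2 = model_sign m * (\<theta> i j - 1 / 2)" if "i \<noteq> j"
  proof (cases m)
    case Tournament
    then have "\<forall>i\<in>{1..n}. \<forall>j\<in>{1..n}. i \<noteq> j \<longrightarrow> \<theta> j i = 1 - \<theta> i j"
      using assms(1) unfolding Tournament ordered_matrices.simps tournament_matrices_def mem_Collect_eq by blast
    then have "\<theta> j i = 1 - \<theta> i j" using i j that by blast
    then show ?thesis by (simp add: Tournament model_sign_def)
  next
    case Graph
    then have "\<forall>i\<in>{1..n}. \<forall>j\<in>{1..n}. i \<noteq> j \<longrightarrow> \<theta> j i = \<theta> i j"
      using assms(1) unfolding Graph ordered_matrices.simps graph_matrices_def mem_Collect_eq by blast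
    then have "\<theta> j i = \<theta> i j" using i j that by blast
    then show ?thesis by (simp add: Graph model_sign_def)
  qed
qed

lemma ordered_matrices_outside:
  assumes "\<theta> \<in> ordered_matrices m n" "i \<notin> {1..n} \<or> j \<notin> {1..n}"
  shows "\<theta> i j = 0"
proof -
  have "\<theta> \<in> matrices n"
    using assms(1) by (cases m) (simp_all only: ordered_matrices.simps tournament_matrices_def
      graph_matrices_def mem_Collect_eq)
  then show ?thesis using assms(2) unfolding matrices_def by blast
qed

lemma param_spaceD:
  assumes "\<theta> \<in> param_space m n" "i \<in> {1..n}" "j \<in> {1..n}"
  shows "\<theta> i j \<in> {0..1}" "\<theta> i i = 0"
    "i \<noteq> j \<Longrightarrow> \<theta> j i - 1 / 2 = model_sign m * (\<theta> i j - 1 / 2)"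
proof -
  obtain \<theta>0 \<pi> where \<theta>: "\<theta> = permute \<theta>0 \<pi>" "\<theta>0 \<in> ordered_matrices m n" "\<pi> permutes {1..n}"
    using assms(1) by (auto simp: param_space_def)
  have "\<pi> i \<in> {1..n}" "\<pi> j \<in> {1..n}" using \<theta>(3) assms(2,3) by (simp_all only: permutes_in_image)
  note * = ordered_matricesD[OF \<theta>(2) this]
  show "\<theta> i j \<in> {0..1}" "\<theta> i i = 0" using * by (simp_all add: \<theta>(1) permute_def)
  show "\<theta> j i - 1 / 2 = model_sign m * (\<theta> i j - 1 / 2)" if "i \<noteq> j"
    using *(3) that permutes_inj[OF \<theta>(3)] by (auto simp: \<theta>(1) permute_def inj_eq)
qed

section \<open>The centred noise and its tails\<close>

definition data_pmf :: "nat \<Rightarrow> matrix \<Rightarrow> real \<Rightarrow> ((nat \<times> nat \<Rightarrow> bool) \<times> (nat \<times> nat \<Rightarrow> bool)) pmf" where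
  "data_pmf n \<theta> p = pair_pmf (outcomes_pmf n \<theta>) (observed_pmf n p)"

definition noise :: "model \<Rightarrow> nat \<Rightarrow> matrix \<Rightarrow> real \<Rightarrow> (nat \<times> nat \<Rightarrow> bool) \<Rightarrow> (nat \<times> nat \<Rightarrow> bool) \<Rightarrow> matrix"
  where "noise m n \<theta> p X B i j =
    data_matrix m n X B i j - J_matrix n i j / 2 - p * (\<theta> i j - J_matrix n i j / 2)"

text \<open>A missing entry has the value 1/2, so centring at 1/2 turns it into 0; this is the
  factor \<open>of_bool b\<close>.\<close>

definition entry_noise :: "matrix \<Rightarrow> real \<Rightarrow> nat \<times> nat \<Rightarrow> bool \<Rightarrow> bool \<Rightarrow> real" where
  "entry_noise \<theta> p e x b = of_bool b * (of_bool x - 1 / 2) - p * (\<theta> (fst e) (snd e) - 1 / 2)"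

lemma finite_set_data_pmf: "finite (set_pmf (data_pmf n \<theta> p))"
  by (simp add: data_pmf_def outcomes_pmf_def observed_pmf_def finite_set_Pi_pmf)

context
  fixes m :: model and n :: nat and \<theta> :: matrix and p :: real
  assumes \<theta>: "\<theta> \<in> param_space m n" and p: "p \<in> {0..1}"
begin

lemma noise_upper:
  "(i, j) \<in> upper_pairs n \<Longrightarrow> noise m n \<theta> p X B i j = entry_noise \<theta> p (i, j) (X (i, j)) (B (i, j))"
  by (auto simp: noise_def entry_noise_def data_matrix_def upper_data_def J_matrix_def upper_pairs_def)

lemma noise_diag: "i \<in> {1..n} \<Longrightarrow> noise m n \<theta> p X B i i = 0"
  using param_spaceD(2)[OF \<theta>] by (auto simp: noise_def data_matrix_def J_matrix_def upper_pairs_def)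

lemma noise_lower:
  assumes "(i, j) \<in> upper_pairs n"
  shows "noise m n \<theta> p X B j i = model_sign m * noise m n \<theta> p X B i j"
proof -
  have ij: "i \<in> {1..n}" "j \<in> {1..n}" "i < j" using assms by (auto simp: upper_pairs_def)
  then have "(j, i) \<notin> upper_pairs n" by (auto simp: upper_pairs_def)
  moreover have "\<theta> j i - 1 / 2 = model_sign m * (\<theta> i j - 1 / 2)"
    using param_spaceD(3)[OF \<theta> ij(1,2)] ij by simp
  moreover have "data_matrix m n X B j i - 1 / 2 = model_sign m * (data_matrix m n X B i j - 1 / 2)"
    using calculation(1) assms by (cases m) (simp_all add: data_matrix_def model_sign_def)
  moreover have "J_matrix n j i = 1" "J_matrix n i j = 1"
    using ij by (auto simp: J_matrix_def)
  ultimately show ?thesis by (simp add: noise_def right_diff_distrib)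
qed

text \<open>Only entries above the diagonal are independent; the lower triangle repeats them up to
  the model sign. Folding the weight onto the upper triangle leaves a sum of independent
  terms.\<close>

lemma noise_inner_product:
  "(\<Sum>i\<in>{1..n}. \<Sum>j\<in>{1..n}. w i j * noise m n \<theta> p X B i j) =
   (\<Sum>e\<in>upper_pairs n. (w (fst e) (snd e) + model_sign m * w (snd e) (fst e)) *
       entry_noise \<theta> p e (X e) (B e))"
  by (subst sum_matrix_split)
     (auto simp: noise_diag noise_lower noise_upper algebra_simps intro!: sum.cong)

lemma entry_noise_moments:
  assumes "e \<in> upper_pairs n"
  defines "P \<equiv> (\<lambda>(i, j). bernoulli_pmf (\<theta> i j)) e"
  shows "measure_pmf.expectation P (\<lambda>x. measure_pmf.expectation (bernoulli_pmf p) (entry_noise \<theta> p e x)) = 0"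
    and "measure_pmf.expectation P (\<lambda>x. measure_pmf.expectation (bernoulli_pmf p)
      (\<lambda>b. (entry_noise \<theta> p e x b)\<^sup>2)) \<le> p / 4"
    and "\<bar>entry_noise \<theta> p e x b\<bar> \<le> 1"
proof -
  define t where "t = \<theta> (fst e) (snd e)"
  have t: "0 \<le> t" "t \<le> 1"
    using assms(1) param_spaceD(1)[OF \<theta>, of "fst e" "snd e"] by (auto simp: t_def upper_pairs_def)
  have P: "P = bernoulli_pmf t" by (simp add: P_def t_def case_prod_unfold)
  show "measure_pmf.expectation P (\<lambda>x. measure_pmf.expectation (bernoulli_pmf p) (entry_noise \<theta> p e x)) = 0"
    using p t by (simp add: P entry_noise_def t_def[symmetric] field_simps)
  \<comment> \<open>The square of \<open>of_bool x - 1 / 2\<close> is 1/4 for either outcome, so the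
    second moment before centring is exactly p/4.\<close>
  have "measure_pmf.expectation P (\<lambda>x. measure_pmf.expectation (bernoulli_pmf p)
      (\<lambda>b. (entry_noise \<theta> p e x b)\<^sup>2)) = p / 4 - p\<^sup>2 * (t - 1 / 2)\<^sup>2"
    using p t by (simp add: P entry_noise_def t_def[symmetric] field_simps power2_eq_square)
  then show "measure_pmf.expectation P (\<lambda>x. measure_pmf.expectation (bernoulli_pmf p)
      (\<lambda>b. (entry_noise \<theta> p e x b)\<^sup>2)) \<le> p / 4" by simp
  have "\<bar>t - 1 / 2\<bar> \<le> 1 / 2" using t by linarith
  then have "\<bar>p * (t - 1 / 2)\<bar> \<le> 1 * (1 / 2)"
    unfolding abs_mult using p by (intro mult_mono) auto
  then show "\<bar>entry_noise \<theta> p e x b\<bar> \<le> 1"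
    unfolding entry_noise_def t_def[symmetric] by (cases x; cases b) auto
qed

text \<open>The cap 1/2 on the weights comes from folding: two of them are added, and the sum must
  stay within 1 for the quadratic bound on exp. Likewise p/2 is the variance p/4 times the 2 in (a +
  b)^2 \<le> 2 (a^2 + b^2).\<close>

lemma noise_tail:
  assumes w: "\<And>i j. i \<in> {1..n} \<Longrightarrow> j \<in> {1..n} \<Longrightarrow> \<bar>w i j\<bar> \<le> 1 / 2"
  shows "measure_pmf.prob (data_pmf n \<theta> p) {(X, B).
      (\<Sum>i\<in>{1..n}. \<Sum>j\<in>{1..n}. w i j * noise m n \<theta> p X B i j)
        \<ge> p / 2 * (\<Sum>i\<in>{1..n}. \<Sum>j\<in>{1..n}. (w i j)\<^sup>2) + K} \<le> exp (- K)"
proof -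
  define u where "u e = w (fst e) (snd e) + model_sign m * w (snd e) (fst e)" for e
  have u1: "\<bar>u e\<bar> \<le> 1" if "e \<in> upper_pairs n" for e
    using that abs_triangle_ineq[of "w (fst e) (snd e)" "model_sign m * w (snd e) (fst e)"]
      w[of "fst e" "snd e"] w[of "snd e" "fst e"] by (auto simp: u_def abs_mult upper_pairs_def)
  have bnd: "\<bar>u e * entry_noise \<theta> p e x b\<bar> \<le> 1" if "e \<in> upper_pairs n" for e x b
    using mult_mono[of "\<bar>u e\<bar>" 1 "\<bar>entry_noise \<theta> p e x b\<bar>" 1] entry_noise_moments(3)[OF that]
      u1[OF that] by (simp add: abs_mult)
  have u2: "(u e)\<^sup>2 \<le> 2 * ((w (fst e) (snd e))\<^sup>2 + (w (snd e) (fst e))\<^sup>2)" for e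
  proof -
    have "(model_sign m * w (snd e) (fst e))\<^sup>2 = (w (snd e) (fst e))\<^sup>2"
      by (simp add: power_mult_distrib)
    moreover have "(a + b)\<^sup>2 \<le> 2 * (a\<^sup>2 + b\<^sup>2)" for a b :: real
      using sum_squares_bound[of a b] by (simp add: power2_sum)
    ultimately show ?thesis unfolding u_def by metis
  qed
  have "(\<Sum>e\<in>upper_pairs n. p / 4 * (u e)\<^sup>2)
     \<le> (\<Sum>e\<in>upper_pairs n. p / 2 * ((w (fst e) (snd e))\<^sup>2 + (w (snd e) (fst e))\<^sup>2))"
    using p mult_left_mono[OF u2, of "p / 4"] by (intro sum_mono) (simp add: algebra_simps)
  also have "\<dots> \<le> p / 2 * (\<Sum>i\<in>{1..n}. \<Sum>j\<in>{1..n}. (w i j)\<^sup>2)"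
    unfolding sum_distrib_left[symmetric]
    by (subst sum_matrix_split, rule mult_left_mono)
      (use p in \<open>auto simp: case_prod_unfold intro!: sum_nonneg\<close>)
  finally have q: "(\<Sum>e\<in>upper_pairs n. p / 4 * (u e)\<^sup>2) \<le> p / 2 * (\<Sum>i\<in>{1..n}. \<Sum>j\<in>{1..n}. (w i j)\<^sup>2)" .
  have "measure_pmf.prob (data_pmf n \<theta> p) {(X, B).
      (\<Sum>i\<in>{1..n}. \<Sum>j\<in>{1..n}. w i j * noise m n \<theta> p X B i j)
        \<ge> p / 2 * (\<Sum>i\<in>{1..n}. \<Sum>j\<in>{1..n}. (w i j)\<^sup>2) + K}
    \<le> measure_pmf.prob (data_pmf n \<theta> p) {(X, B).
      (\<Sum>e\<in>upper_pairs n. u e * entry_noise \<theta> p e (X e) (B e)) \<ge> (\<Sum>e\<in>upper_pairs n. p / 4 * (u e)\<^sup>2) + K}"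
    unfolding noise_inner_product u_def[symmetric] using q
    by (intro measure_pmf.finite_measure_mono) auto
  also have "\<dots> \<le> exp (- K)"
    unfolding data_pmf_def outcomes_pmf_def observed_pmf_def
  proof (rule pair_Pi_pmf_exp_tail)
    fix e assume e: "e \<in> upper_pairs n"
    show "measure_pmf.expectation ((\<lambda>(i, j). bernoulli_pmf (\<theta> i j)) e)
       (\<lambda>x. measure_pmf.expectation (bernoulli_pmf p) (\<lambda>b. u e * entry_noise \<theta> p e x b)) = 0"
      using entry_noise_moments(1)[OF e] by simp
    show "measure_pmf.expectation ((\<lambda>(i, j). bernoulli_pmf (\<theta> i j)) e)
       (\<lambda>x. measure_pmf.expectation (bernoulli_pmf p) (\<lambda>b. (u e * entry_noise \<theta> p e x b)\<^sup>2))
         \<le> p / 4 * (u e)\<^sup>2"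
      using mult_left_mono[OF entry_noise_moments(2)[OF e], of "(u e)\<^sup>2"]
      by (simp add: power_mult_distrib mult_ac)
  qed (use bnd in auto)
  finally show ?thesis .
qed

lemma observed_count_tail:
  assumes u: "\<bar>u\<bar> \<le> 1"
  shows "measure_pmf.prob (data_pmf n \<theta> p) {(X, B).
      u * (real (card {e \<in> upper_pairs n. B e}) - p * real (n choose 2))
        \<ge> p * u\<^sup>2 * real (n choose 2) + K} \<le> exp (- K)"
proof -
  have card: "real (card {e \<in> upper_pairs n. B e}) = (\<Sum>e\<in>upper_pairs n. of_bool (B e))" for B
    by (simp add: of_bool_def sum.If_cases Int_def)
  have "measure_pmf.prob (data_pmf n \<theta> p) {(X, B).
      (\<Sum>e\<in>upper_pairs n. u * (of_bool (B e) - p)) \<ge> (\<Sum>e\<in>upper_pairs n. p * u\<^sup>2) + K} \<le> exp (- K)"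
    unfolding data_pmf_def outcomes_pmf_def observed_pmf_def
  proof (rule pair_Pi_pmf_exp_tail)
    fix e :: "nat \<times> nat" and x b
    have "\<bar>of_bool b - p\<bar> \<le> 1" using p by (cases b) auto
    then show "\<bar>u * (of_bool b - p)\<bar> \<le> 1"
      using u mult_mono[of "\<bar>u\<bar>" 1 "\<bar>of_bool b - p\<bar>" 1] by (simp add: abs_mult)
    show "measure_pmf.expectation ((\<lambda>(i, j). bernoulli_pmf (\<theta> i j)) e)
       (\<lambda>x. measure_pmf.expectation (bernoulli_pmf p) (\<lambda>b. u * (of_bool b - p))) = 0"
      using p by (simp add: algebra_simps)
    have "measure_pmf.expectation (bernoulli_pmf p) (\<lambda>b. (u * (of_bool b - p))\<^sup>2) = p * u\<^sup>2 - p\<^sup>2 * u\<^sup>2"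
      using p by (simp add: algebra_simps power2_eq_square)
    also have "\<dots> \<le> p * u\<^sup>2" by simp
    finally show "measure_pmf.expectation ((\<lambda>(i, j). bernoulli_pmf (\<theta> i j)) e)
       (\<lambda>x. measure_pmf.expectation (bernoulli_pmf p) (\<lambda>b. (u * (of_bool b - p))\<^sup>2)) \<le> p * u\<^sup>2"
      by simp
  qed simp
  then show ?thesis
    by (simp add: card card_upper_pairs sum_distrib_left[symmetric] sum_subtractf mult_ac)
qed

end

subsection \<open>Uniform control of block sums of the noise\<close>

text \<open>The spacing 1/(2n) is a compromise: fine enough that rounding the weights needed later
  loses at most a factor 2, coarse enough that each cell has at most 2n nonzero values to
  encode.\<close>

definition grid :: "nat \<Rightarrow> real set" where
  "grid n = (\<lambda>k. real_of_int k / (2 * real n)) ` {- int n..int n}"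

lemma finite_grid [simp]: "finite (grid n)" by (simp add: grid_def)

lemma zero_in_grid [simp]: "0 \<in> grid n" by (auto simp: grid_def image_iff intro!: bexI[of _ 0])

lemma card_grid_le: "card (grid n - {0}) \<le> 2 * n"
proof -
  have "card (grid n) \<le> card {- int n..int n}" unfolding grid_def by (rule card_image_le) simp
  then show ?thesis by (simp add: card_Diff_singleton)
qed

lemma grid_bound: "a \<in> grid n \<Longrightarrow> \<bar>a\<bar> \<le> 1 / 2"
  by (cases "n = 0") (auto simp: grid_def field_simps)

lemma grid_uminus: "a \<in> grid n \<Longrightarrow> - a \<in> grid n"
  by (auto simp: grid_def image_iff intro!: bexI[of _ "- _"])

definition support_size :: "nat \<Rightarrow> (nat \<times> nat \<Rightarrow> real) \<Rightarrow> nat" where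
  "support_size n a = card {c \<in> {..n} \<times> {..n}. a c \<noteq> 0}"

text \<open>The price of a weight in a union bound. The first term pays for two labellings of n
  indices by n + 1 labels, \<open>ln n\<close> buys a probability of order 1/n, and each nonzero
  cell costs 8 \<open>ln n\<close> for its position and value.\<close>

definition code_length :: "nat \<Rightarrow> (nat \<times> nat \<Rightarrow> real) \<Rightarrow> real" where
  "code_length n a = 2 * real n * ln (real n + 1) + ln n + 8 * support_size n a * ln n"

text \<open>Quantifying over all labellings \<open>g\<close> and \<open>h\<close> frees the event
  from any ordering of rows and columns, so it can be used with a permutation chosen after seeing
  the data.\<close>

definition block_bounded :: "nat \<Rightarrow> real \<Rightarrow> matrix \<Rightarrow> bool" where
  "block_bounded n p x \<longleftrightarrow> (\<forall>g\<in>{1..n} \<rightarrow> {..n}. \<forall>h\<in>{1..n} \<rightarrow> {..n}. \<forall>a\<in>({..n} \<times> {..n}) \<rightarrow> grid n.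
     (\<Sum>i\<in>{1..n}. \<Sum>j\<in>{1..n}. a (g i, h j) * x i j)
       \<le> p / 2 * (\<Sum>i\<in>{1..n}. \<Sum>j\<in>{1..n}. (a (g i, h j))\<^sup>2) + code_length n a)"

text \<open>A Kraft-type inequality. The support term is additive over cells, so the sum factorises
  into (n + 1)^2 factors of at most 1 + 2n / n^8, whose product stays below e \<le> 3.\<close>

lemma sum_code_length:
  assumes n: "n \<ge> 2"
  shows "(\<Sum>a\<in>({..n} \<times> {..n}) \<rightarrow>\<^sub>E grid n. exp (- code_length n a))
    \<le> 3 / n * exp (- (2 * real n * ln (real n + 1)))"
proof -
  let ?C = "{..n} \<times> {..n}"
  define w :: "real \<Rightarrow> real" where "w y = (if y = 0 then 1 else 1 / real n ^ 8)" for y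
  have exp_code: "exp (- code_length n a) = exp (- (2 * real n * ln (real n + 1))) / n * (\<Prod>c\<in>?C. w (a c))"
    for a
  proof -
    have "(\<Prod>c\<in>?C. w (a c)) = (1 / real n ^ 8) ^ card (?C \<inter> {c. a c \<noteq> 0})"
      unfolding w_def by (subst prod.If_cases) (auto simp: Compl_eq)
    also have "?C \<inter> {c. a c \<noteq> 0} = {c \<in> ?C. a c \<noteq> 0}" by auto
    also have "(1 / real n ^ 8) ^ card {c \<in> ?C. a c \<noteq> 0} = exp (- (8 * support_size n a * ln n))"
    proof -
      have "1 / real n ^ 8 = exp (- (8 * ln n))"
        using n exp_of_nat_mult[of 8 "ln (real n)"] by (simp add: exp_minus field_simps)
      then show ?thesis
        by (simp add: support_size_def exp_of_nat_mult[symmetric] mult_ac)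
    qed
    finally have "(\<Prod>c\<in>?C. w (a c)) = exp (- (8 * support_size n a * ln n))" .
    moreover have "exp (- code_length n a) =
      exp (- (2 * real n * ln (real n + 1))) * exp (- ln n) * exp (- (8 * support_size n a * ln n))"
      by (simp add: code_length_def mult_exp_exp)
    moreover have "exp (- ln (real n)) = 1 / n" using n by (simp add: exp_minus field_simps)
    ultimately show ?thesis by simp
  qed
  have sum_w: "(\<Sum>y\<in>grid n. w y) \<le> 1 + 2 / real n ^ 7"
  proof -
    have "(\<Sum>y\<in>grid n. w y) = 1 + (\<Sum>y\<in>grid n - {0}. w y)"
      by (subst sum.remove[of _ 0]) (auto simp: w_def)
    also have "(\<Sum>y\<in>grid n - {0}. w y) = real (card (grid n - {0})) * (1 / real n ^ 8)"
      by (simp add: w_def)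
    also have "\<dots> \<le> real (2 * n) * (1 / real n ^ 8)"
      using card_grid_le[of n] by (intro mult_right_mono) auto
    also have "\<dots> = 2 / real n ^ 7" using n by (simp add: field_simps eval_nat_numeral)
    finally show ?thesis by simp
  qed
  have w0: "w y \<ge> 0" for y by (simp add: w_def)
  have "(\<Sum>a\<in>?C \<rightarrow>\<^sub>E grid n. \<Prod>c\<in>?C. w (a c)) = (\<Prod>c\<in>?C. \<Sum>y\<in>grid n. w y)"
    by (rule prod_sum_PiE[symmetric]) auto
  also have "\<dots> = (\<Sum>y\<in>grid n. w y) ^ ((n + 1) * (n + 1))" by (simp add: card_cartesian_product)
  also have "\<dots> \<le> (1 + 2 / real n ^ 7) ^ ((n + 1) * (n + 1))"
    using w0 by (intro power_mono sum_w sum_nonneg) auto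
  also have "\<dots> \<le> exp (2 / real n ^ 7) ^ ((n + 1) * (n + 1))"
    by (intro power_mono) auto
  also have "\<dots> = exp (real ((n + 1) * (n + 1)) * (2 / real n ^ 7))"
    by (simp only: exp_of_nat_mult)
  also have "\<dots> \<le> exp 1"
  proof -
    have "real ((n + 1) * (n + 1)) \<le> real (4 * n\<^sup>2)"
      using n mult_mono[of "n + 1" "2 * n" "n + 1" "2 * n"] by (intro of_nat_mono) (simp add: power2_eq_square)
    then have "real ((n + 1) * (n + 1)) * (2 / real n ^ 7) \<le> real (4 * n\<^sup>2) * (2 / real n ^ 7)"
      by (intro mult_right_mono) auto
    also have "\<dots> = 8 / real n ^ 5" using n by (simp add: field_simps eval_nat_numeral)
    also have "\<dots> \<le> 8 / 2 ^ 5" using n by (intro divide_left_mono power_mono mult_pos_pos) auto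
    also have "\<dots> \<le> (1 :: real)" by simp
    finally show ?thesis by (simp only: exp_le_cancel_iff)
  qed
  also have "\<dots> \<le> 3" by (rule exp_le)
  finally have "(\<Sum>a\<in>?C \<rightarrow>\<^sub>E grid n. \<Prod>c\<in>?C. w (a c)) \<le> 3" .
  then have "exp (- (2 * real n * ln (real n + 1))) / n * (\<Sum>a\<in>?C \<rightarrow>\<^sub>E grid n. \<Prod>c\<in>?C. w (a c))
     \<le> exp (- (2 * real n * ln (real n + 1))) / n * 3" by (intro mult_left_mono) auto
  moreover have "E / n * 3 = 3 / n * E" for E :: real by simp
  ultimately show ?thesis unfolding exp_code sum_distrib_left[symmetric] by (simp only:)
qed

context
  fixes m :: model and n :: nat and \<theta> :: matrix and p :: real
  assumes \<theta>: "\<theta> \<in> param_space m n" and p: "p \<in> {0..1}" and n: "n \<ge> 2"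
    and np: "p \<ge> 2 * ln n / n"
begin

lemma prob_not_block_bounded:
  "measure_pmf.prob (data_pmf n \<theta> p) {(X, B). \<not> block_bounded n p (noise m n \<theta> p X B)} \<le> 3 / n"
proof -
  define F where "F = {1..n} \<rightarrow>\<^sub>E {..n}"
  define A where "A = ({..n} \<times> {..n}) \<rightarrow>\<^sub>E grid n"
  have fin: "finite F" "finite A" by (auto simp: F_def A_def intro!: finite_PiE)
  define bad where "bad = (\<lambda>(g, h, a). {(X, B).
      (\<Sum>i\<in>{1..n}. \<Sum>j\<in>{1..n}. a (g i, h j) * noise m n \<theta> p X B i j)
       \<ge> p / 2 * (\<Sum>i\<in>{1..n}. \<Sum>j\<in>{1..n}. (a (g i, h j))\<^sup>2) + code_length n a})"
  have sub: "{(X, B). \<not> block_bounded n p (noise m n \<theta> p X B)} \<subseteq> (\<Union>t\<in>F \<times> F \<times> A. bad t)"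
  proof clarify
    fix X B assume "\<not> block_bounded n p (noise m n \<theta> p X B)"
    then obtain g h a where g: "g \<in> {1..n} \<rightarrow> {..n}" and h: "h \<in> {1..n} \<rightarrow> {..n}"
      and a: "a \<in> ({..n} \<times> {..n}) \<rightarrow> grid n"
      and gt: "(\<Sum>i\<in>{1..n}. \<Sum>j\<in>{1..n}. a (g i, h j) * noise m n \<theta> p X B i j)
       > p / 2 * (\<Sum>i\<in>{1..n}. \<Sum>j\<in>{1..n}. (a (g i, h j))\<^sup>2) + code_length n a"
      unfolding block_bounded_def by (auto simp: not_le)
    \<comment> \<open>The union bound needs a finite index set. Restricting the three functions to
      their domains changes neither the sums nor the code length.\<close>
    define g' h' a' where "g' = restrict g {1..n}" and "h' = restrict h {1..n}"
      and "a' = restrict a ({..n} \<times> {..n})"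
    have eq: "a' (g' i, h' j) = a (g i, h j)" if "i \<in> {1..n}" "j \<in> {1..n}" for i j
    proof -
      have "g i \<in> {..n}" "h j \<in> {..n}" using g h that by blast+
      then show ?thesis using that by (simp add: g'_def h'_def a'_def)
    qed
    have "code_length n a' = code_length n a"
      by (auto simp: code_length_def support_size_def a'_def intro!: arg_cong[where f = card])
    moreover have "(\<Sum>i\<in>{1..n}. \<Sum>j\<in>{1..n}. a' (g' i, h' j) * noise m n \<theta> p X B i j) =
      (\<Sum>i\<in>{1..n}. \<Sum>j\<in>{1..n}. a (g i, h j) * noise m n \<theta> p X B i j)"
      "(\<Sum>i\<in>{1..n}. \<Sum>j\<in>{1..n}. (a' (g' i, h' j))\<^sup>2) = (\<Sum>i\<in>{1..n}. \<Sum>j\<in>{1..n}. (a (g i, h j))\<^sup>2)"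
      by (intro sum.cong refl; simp only: eq)+
    ultimately have "(X, B) \<in> bad (g', h', a')" using gt by (simp add: bad_def)
    moreover have "(g', h', a') \<in> F \<times> F \<times> A"
      using g h a by (auto simp: F_def A_def g'_def h'_def a'_def)
    ultimately show "(X, B) \<in> (\<Union>t\<in>F \<times> F \<times> A. bad t)" by blast
  qed
  have each: "measure_pmf.prob (data_pmf n \<theta> p) (bad t) \<le> exp (- code_length n (snd (snd t)))"
    if "t \<in> F \<times> F \<times> A" for t
  proof -
    obtain g h a where t: "t = (g, h, a)" by (cases t)
    have "\<bar>a (g i, h j)\<bar> \<le> 1 / 2" if "i \<in> {1..n}" "j \<in> {1..n}" for i j
      using \<open>t \<in> _\<close> that unfolding t F_def A_def
      by (intro grid_bound[of _ n]) (blast dest: PiE_mem)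
    from noise_tail[OF \<theta> p this] show ?thesis by (simp add: t bad_def)
  qed
  have "measure_pmf.prob (data_pmf n \<theta> p) {(X, B). \<not> block_bounded n p (noise m n \<theta> p X B)}
     \<le> measure_pmf.prob (data_pmf n \<theta> p) (\<Union>t\<in>F \<times> F \<times> A. bad t)"
    by (intro measure_pmf.finite_measure_mono sub) auto
  also have "\<dots> \<le> (\<Sum>t\<in>F \<times> F \<times> A. measure_pmf.prob (data_pmf n \<theta> p) (bad t))"
    by (rule measure_pmf.finite_measure_subadditive_finite) (use fin in auto)
  also have "\<dots> \<le> (\<Sum>t\<in>F \<times> F \<times> A. exp (- code_length n (snd (snd t))))"
    by (intro sum_mono each)
  also have "\<dots> = real (card F) * real (card F) * (\<Sum>a\<in>A. exp (- code_length n a))"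
    by (simp add: sum.cartesian_product' mult_ac)
  also have "\<dots> \<le> real (card F) * real (card F) * (3 / n * exp (- (2 * real n * ln (real n + 1))))"
    unfolding A_def by (intro mult_left_mono sum_code_length n mult_nonneg_nonneg of_nat_0_le_iff)
  \<comment> \<open>The (n + 1)^n choices of each of \<open>g\<close> and \<open>h\<close> are
    cancelled exactly by the first term of the code length.\<close>
  also have "real (card F) = exp (n * ln (n + 1))"
    by (simp add: F_def card_PiE exp_of_nat_mult)
  also have "exp (n * ln (n + 1)) * exp (n * ln (n + 1)) * (3 / n * exp (- (2 * real n * ln (real n + 1)))) = 3 / n"
    by (simp add: mult_exp_exp algebra_simps)
  finally show ?thesis .
qed

lemma prob_row_noise:
  "measure_pmf.prob (data_pmf n \<theta> p) {(X, B). \<not> (\<forall>i\<in>{1..n}.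
     \<bar>\<Sum>j\<in>{1..n}. noise m n \<theta> p X B i j\<bar> \<le> 4 * sqrt (n * p * ln n))} \<le> 2 / n"
proof -
  let ?S = "\<lambda>X B i. \<Sum>j\<in>{1..n}. noise m n \<theta> p X B i j"
  have l: "ln (real n) > 0" using n by simp
  have npl: "n * p \<ge> 2 * ln n" using np n by (simp add: field_simps)
  then have np0: "n * p > 0" using l by linarith
  \<comment> \<open>With this scale the variance term is \<open>ln n\<close> / 4. The assumption n p
    \<ge> 2 \<open>ln n\<close> is exactly what gives t \<le> 1/2, the cap on weights in
    \<open>noise_tail\<close>.\<close>
  define t where "t = sqrt (ln n / (2 * (n * p)))"
  have t2: "t\<^sup>2 = ln n / (2 * (n * p))" using l np0 by (simp add: t_def)
  have t0: "t > 0" using l np0 by (simp add: t_def)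
  have "t \<le> sqrt ((1 / 2)\<^sup>2)"
    unfolding t_def using npl np0 by (intro real_sqrt_le_mono) (simp add: field_simps power2_eq_square)
  then have t1: "t \<le> 1 / 2" by simp
  have tl: "t * (4 * sqrt (n * p * ln n)) \<ge> p / 2 * (n * t\<^sup>2) + 2 * ln n"
  proof -
    have "t * (4 * sqrt (n * p * ln n)) = 4 * sqrt (ln n / (2 * (n * p)) * (n * p * ln n))"
      by (simp add: t_def real_sqrt_mult[symmetric])
    also have "ln n / (2 * (n * p)) * (n * p * ln n) = (ln n)\<^sup>2 / 2"
    proof -
      have "p \<noteq> 0" using np0 by auto
      then show ?thesis using n by (simp add: power2_eq_square)
    qed
    also have "4 * sqrt ((ln n)\<^sup>2 / 2) = 4 * (ln n / sqrt 2)"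
      using l by (simp add: real_sqrt_divide)
    finally have e1: "t * (4 * sqrt (n * p * ln n)) = 4 * (ln n / sqrt 2)" .
    define x where "x = ln n / sqrt 2"
    \<comment> \<open>From sqrt 2 \<le> 8/5 one gets 4 / sqrt 2 \<ge> 5/2, which covers the variance
      share 1/4 plus the exponent 2. That exponent makes each tail n^-2, small enough for a union
      over n rows and two signs.\<close>
    have "ln n / (8 / 5) \<le> x"
      unfolding x_def using l by (intro divide_left_mono real_le_lsqrt) (auto simp: power2_eq_square)
    then have "5 / 8 * ln n \<le> x" by simp
    moreover have "p \<noteq> 0" using np0 by auto
    then have e2: "p / 2 * (n * t\<^sup>2) = ln n / 4" using n by (simp add: t2)
    ultimately show ?thesis using l unfolding e1 e2 x_def[symmetric] by linarith
  qed
  have one: "measure_pmf.prob (data_pmf n \<theta> p) {(X, B). s * ?S X B a > 4 * sqrt (n * p * ln n)}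
      \<le> 1 / (real n)\<^sup>2" if s: "s = 1 \<or> s = -1" and a: "a \<in> {1..n}" for s :: real and a
  proof -
    define w where "w i j = (if i = a then s * t else 0)" for i j :: nat
    have w: "\<bar>w i j\<bar> \<le> 1 / 2" for i j using t0 t1 s by (auto simp: w_def)
    have s1: "(\<Sum>i\<in>{1..n}. \<Sum>j\<in>{1..n}. w i j * noise m n \<theta> p X B i j) = t * (s * ?S X B a)" for X B
    proof -
      have "(\<Sum>i\<in>{1..n}. \<Sum>j\<in>{1..n}. w i j * noise m n \<theta> p X B i j) =
         (\<Sum>i\<in>{1..n}. if i = a then s * t * ?S X B i else 0)"
        by (intro sum.cong refl) (auto simp: w_def sum_distrib_left)
      then show ?thesis using a by simp
    qed
    have s2: "(\<Sum>i\<in>{1..n}. \<Sum>j\<in>{1..n}. (w i j)\<^sup>2) = n * t\<^sup>2"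
    proof -
      have "(\<Sum>i\<in>{1..n}. \<Sum>j\<in>{1..n}. (w i j)\<^sup>2) = (\<Sum>i\<in>{1..n}. if i = a then n * t\<^sup>2 else 0)"
        using s by (intro sum.cong refl) (auto simp: w_def power_mult_distrib)
      then show ?thesis using a by simp
    qed
    have "measure_pmf.prob (data_pmf n \<theta> p) {(X, B). s * ?S X B a > 4 * sqrt (n * p * ln n)}
      \<le> measure_pmf.prob (data_pmf n \<theta> p) {(X, B). t * (s * ?S X B a) \<ge> p / 2 * (n * t\<^sup>2) + 2 * ln n}"
    proof (intro measure_pmf.finite_measure_mono)
      have "t * (s * ?S X B a) \<ge> p / 2 * (n * t\<^sup>2) + 2 * ln n" if "s * ?S X B a > 4 * sqrt (n * p * ln n)" for X B
        using mult_left_mono[OF less_imp_le[OF that], of t] t0 tl by linarith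
      then show "{(X, B). s * ?S X B a > 4 * sqrt (n * p * ln n)}
        \<subseteq> {(X, B). t * (s * ?S X B a) \<ge> p / 2 * (n * t\<^sup>2) + 2 * ln n}" by blast
    qed simp
    also have "\<dots> \<le> exp (- (2 * ln n))"
      using noise_tail[OF \<theta> p, of w "2 * ln n"] w unfolding s1 s2 by blast
    also have "\<dots> = 1 / (real n)\<^sup>2"
      using n by (simp add: exp_minus exp_double power2_eq_square field_simps)
    finally show ?thesis .
  qed
  let ?A = "\<lambda>(s, a). {(X, B). s * ?S X B a > 4 * sqrt (n * p * ln n)}"
  have "measure_pmf.prob (data_pmf n \<theta> p) {(X, B). \<not> (\<forall>i\<in>{1..n}. \<bar>?S X B i\<bar> \<le> 4 * sqrt (n * p * ln n))}
    \<le> measure_pmf.prob (data_pmf n \<theta> p) (\<Union>c\<in>{1, -1} \<times> {1..n}. ?A c)"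
  proof (intro measure_pmf.finite_measure_mono)
    show "{(X, B). \<not> (\<forall>i\<in>{1..n}. \<bar>?S X B i\<bar> \<le> 4 * sqrt (n * p * ln n))} \<subseteq> (\<Union>c\<in>{1, -1} \<times> {1..n}. ?A c)"
    proof
      fix z assume "z \<in> {(X, B). \<not> (\<forall>i\<in>{1..n}. \<bar>?S X B i\<bar> \<le> 4 * sqrt (n * p * ln n))}"
      then obtain X B i where "z = (X, B)" "i \<in> {1..n}" "\<not> \<bar>?S X B i\<bar> \<le> 4 * sqrt (n * p * ln n)"
        by blast
      then have "z \<in> ?A (1, i) \<or> z \<in> ?A (-1, i)" by (auto simp: abs_if split: if_splits)
      with \<open>i \<in> {1..n}\<close> show "z \<in> (\<Union>c\<in>{1, -1} \<times> {1..n}. ?A c)" by blast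
    qed
  qed simp
  also have "\<dots> \<le> (\<Sum>c\<in>{1, -1} \<times> {1..n}. measure_pmf.prob (data_pmf n \<theta> p) (?A c))"
    by (rule measure_pmf.finite_measure_subadditive_finite) auto
  also have "\<dots> \<le> (\<Sum>c\<in>{1, -1 :: real} \<times> {1..n}. 1 / (real n)\<^sup>2)"
  proof (intro sum_mono)
    fix c assume "c \<in> {1, -1 :: real} \<times> {1..n}"
    then have "fst c = 1 \<or> fst c = -1" "snd c \<in> {1..n}" by auto
    from one[OF this] show "measure_pmf.prob (data_pmf n \<theta> p) (?A c) \<le> 1 / (real n)\<^sup>2"
      by (simp add: case_prod_unfold)
  qed
  also have "\<dots> = 2 / n" using n by (simp add: card_cartesian_product power2_eq_square)
  finally show ?thesis .
qed

lemma expected_count_lower: "p * real (n choose 2) \<ge> (n - 1) * ln n"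
proof -
  have "real (n choose 2) = n * (real n - 1) / 2"
    using n by (simp add: choose_two real_of_nat_div of_nat_diff)
  moreover have "n * p \<ge> 2 * ln n" using np n by (simp add: field_simps)
  then have "(n * p) * (real n - 1) \<ge> 2 * ln n * (real n - 1)" using n by (intro mult_right_mono) auto
  then have "(n * p) * (real n - 1) / 2 \<ge> ln n * (real n - 1)" by (simp add: mult_ac)
  moreover have "real (n - 1) = real n - 1" using n by (simp add: of_nat_diff)
  moreover have "p * (n * (real n - 1) / 2) = (n * p) * (real n - 1) / 2" by simp
  ultimately show ?thesis by (metis mult.commute)
qed

lemma prob_observed_count:
  "measure_pmf.prob (data_pmf n \<theta> p) {(X, B). \<not>
     \<bar>real (card {e \<in> upper_pairs n. B e}) - p * real (n choose 2)\<bar>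
       \<le> 2 * sqrt (p * real (n choose 2) * ln n)} \<le> 2 / n"
proof -
  let ?N = "real (n choose 2)"
  let ?D = "\<lambda>B. real (card {e \<in> upper_pairs n. B e}) - p * ?N"
  have l: "ln (real n) > 0" using n by simp
  have "1 * ln n \<le> (n - 1) * ln n" using n l by (intro mult_right_mono) auto
  then have pN: "p * ?N \<ge> ln n" using expected_count_lower by linarith
  then have pN0: "p * ?N > 0" using l by linarith
  \<comment> \<open>This scale makes the variance term equal to \<open>ln n\<close>, half of the
    threshold 2 \<open>ln n\<close> reached below. It is at most 1 because at least
    \<open>ln n\<close> observations are expected.\<close>
  define u where "u = sqrt (ln n / (p * ?N))"
  have u0: "u > 0" using l pN0 by (simp add: u_def)
  have u1: "u \<le> 1" using pN pN0 by (simp add: u_def)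
  have u2: "p * u\<^sup>2 * ?N = ln n"
  proof -
    have "u\<^sup>2 = ln n / (p * ?N)" using l pN0 by (simp add: u_def)
    moreover have "p \<noteq> 0" using pN0 by auto
    ultimately show ?thesis using n by (simp add: field_simps)
  qed
  have ul: "u * (2 * sqrt (p * ?N * ln n)) = 2 * ln n"
  proof -
    have "u * (2 * sqrt (p * ?N * ln n)) = 2 * sqrt (ln n / (p * ?N) * (p * ?N * ln n))"
      by (simp add: u_def real_sqrt_mult[symmetric])
    also have "ln n / (p * ?N) * (p * ?N * ln n) = (ln n)\<^sup>2"
    proof -
      have "p \<noteq> 0" using pN0 by auto
      then show ?thesis using n by (simp add: power2_eq_square)
    qed
    finally show ?thesis using l by simp
  qed
  have one: "measure_pmf.prob (data_pmf n \<theta> p) {(X, B). s * ?D B > 2 * sqrt (p * ?N * ln n)} \<le> 1 / n"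
    if s: "s = 1 \<or> s = -1" for s :: real
  proof -
    have "measure_pmf.prob (data_pmf n \<theta> p) {(X, B). s * ?D B > 2 * sqrt (p * ?N * ln n)}
      \<le> measure_pmf.prob (data_pmf n \<theta> p) {(X, B). (s * u) * ?D B \<ge> p * (s * u)\<^sup>2 * ?N + ln n}"
    proof (intro measure_pmf.finite_measure_mono)
      have "(s * u) * ?D B \<ge> p * (s * u)\<^sup>2 * ?N + ln n" if "s * ?D B > 2 * sqrt (p * ?N * ln n)" for B
      proof -
        have "p * (s * u)\<^sup>2 * ?N + ln n = 2 * ln n"
          using u2 s by (auto simp: power_mult_distrib)
        also have "\<dots> \<le> u * (s * ?D B)"
          using mult_left_mono[OF less_imp_le[OF that], of u] u0 ul by linarith
        finally show ?thesis by (simp add: mult_ac)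
      qed
      then show "{(X, B). s * ?D B > 2 * sqrt (p * ?N * ln n)}
        \<subseteq> {(X, B). (s * u) * ?D B \<ge> p * (s * u)\<^sup>2 * ?N + ln n}" by blast
    qed simp
    also have "\<dots> \<le> exp (- ln n)"
      using observed_count_tail[OF \<theta> p, of "s * u" "ln n"] u0 u1 s by (auto simp: abs_mult)
    also have "\<dots> = 1 / n" using n by (simp add: exp_minus field_simps)
    finally show ?thesis .
  qed
  let ?A = "\<lambda>s. {(X, B). s * ?D B > 2 * sqrt (p * ?N * ln n)}"
  have "measure_pmf.prob (data_pmf n \<theta> p) {(X, B). \<not> \<bar>?D B\<bar> \<le> 2 * sqrt (p * ?N * ln n)}
    \<le> measure_pmf.prob (data_pmf n \<theta> p) (?A 1 \<union> ?A (-1))"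
    by (intro measure_pmf.finite_measure_mono) (auto simp: abs_if split: if_splits)
  also have "\<dots> \<le> measure_pmf.prob (data_pmf n \<theta> p) (?A 1) + measure_pmf.prob (data_pmf n \<theta> p) (?A (-1))"
    by (rule measure_Un_le) auto
  also have "\<dots> \<le> 2 / n" using one[of 1] one[of "-1"] by simp
  finally show ?thesis .
qed

end

subsection \<open>The dyadic block martingale\<close>

lemma sum_group_label:
  fixes w :: "'c \<Rightarrow> real"
  assumes "finite U"
  shows "(\<Sum>u\<in>U. w (l u) * f u) = (\<Sum>c\<in>l ` U. w c * (\<Sum>u\<in>{u \<in> U. l u = c}. f u))"
  by (subst sum.image_gen[OF assms, of _ l]) (auto simp: sum_distrib_left intro!: sum.cong)

text \<open>The conditional expectation of \<open>f\<close> given the label, for the uniform measure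
  on \<open>U\<close>; a label that does not occur gets 0 / 0 = 0.\<close>

definition label_avg :: "'a set \<Rightarrow> ('a \<Rightarrow> 'c) \<Rightarrow> ('a \<Rightarrow> real) \<Rightarrow> 'c \<Rightarrow> real" where
  "label_avg U l f c = (\<Sum>u\<in>{u \<in> U. l u = c}. f u) / card {u \<in> U. l u = c}"

text \<open>Averaging over cells is the orthogonal projection onto functions of the label, so a
  function of the label cannot distinguish \<open>f\<close> from its average.\<close>

lemma sum_mult_label_avg:
  assumes "finite U"
  shows "(\<Sum>u\<in>U. w (l u) * label_avg U l f (l u)) = (\<Sum>u\<in>U. w (l u) * f u)"
proof -
  have "(\<Sum>u\<in>U. w (l u) * label_avg U l f (l u)) =
    (\<Sum>c\<in>l ` U. w c * (\<Sum>u\<in>{u \<in> U. l u = c}. label_avg U l f (l u)))"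
    by (rule sum_group_label[OF assms])
  also have "\<dots> = (\<Sum>c\<in>l ` U. w c * (\<Sum>u\<in>{u \<in> U. l u = c}. f u))"
  proof (rule sum.cong[OF refl])
    fix c assume "c \<in> l ` U"
    then have "{u \<in> U. l u = c} \<noteq> {}" by auto
    then have "card {u \<in> U. l u = c} \<noteq> 0" using assms by simp
    then show "w c * (\<Sum>u\<in>{u \<in> U. l u = c}. label_avg U l f (l u)) = w c * (\<Sum>u\<in>{u \<in> U. l u = c}. f u)"
      by (simp add: label_avg_def)
  qed
  finally show ?thesis by (simp add: sum_group_label[OF assms])
qed

text \<open>Pythagoras for nested partitions: as \<open>l'\<close> factors through \<open>l\<close>,
  the coarse average is constant on fine cells and hence orthogonal to the difference of the two
  averages.\<close>

lemma label_avg_orthogonal: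
  assumes fin: "finite U" and l': "\<And>u. u \<in> U \<Longrightarrow> l' u = \<phi> (l u)"
  shows "(\<Sum>u\<in>U. (label_avg U l f (l u) - label_avg U l' f (l' u))\<^sup>2) =
    (\<Sum>u\<in>U. (label_avg U l f (l u))\<^sup>2) - (\<Sum>u\<in>U. (label_avg U l' f (l' u))\<^sup>2)"
proof -
  let ?p = "\<lambda>u. label_avg U l f (l u)" and ?q = "\<lambda>u. label_avg U l' f (l' u)"
  have "(\<Sum>u\<in>U. ?q u * ?p u) = (\<Sum>u\<in>U. label_avg U l' f (\<phi> (l u)) * label_avg U l f (l u))"
    by (intro sum.cong) (auto simp: l')
  also have "\<dots> = (\<Sum>u\<in>U. label_avg U l' f (\<phi> (l u)) * f u)"
    by (rule sum_mult_label_avg[OF fin])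
  also have "\<dots> = (\<Sum>u\<in>U. label_avg U l' f (l' u) * f u)"
    by (intro sum.cong) (auto simp: l')
  also have "\<dots> = (\<Sum>u\<in>U. ?q u * ?q u)"
    by (rule sum_mult_label_avg[OF fin, symmetric])
  finally have e: "(\<Sum>u\<in>U. ?q u * ?p u) = (\<Sum>u\<in>U. (?q u)\<^sup>2)" by (simp add: power2_eq_square)
  have "(\<Sum>u\<in>U. (?p u - ?q u)\<^sup>2) = (\<Sum>u\<in>U. (?p u)\<^sup>2 - 2 * (?q u * ?p u) + (?q u)\<^sup>2)"
    by (intro sum.cong) (auto simp: power2_eq_square algebra_simps)
  also have "\<dots> = (\<Sum>u\<in>U. (?p u)\<^sup>2) - 2 * (\<Sum>u\<in>U. ?q u * ?p u) + (\<Sum>u\<in>U. (?q u)\<^sup>2)"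
    by (simp only: sum.distrib sum_subtractf sum_distrib_left)
  finally show ?thesis by (simp add: e)
qed

lemma label_avg_mem:
  assumes "finite U" "u0 \<in> U" and "\<And>u. u \<in> U \<Longrightarrow> l u = l u0 \<Longrightarrow> f u \<in> {lo..hi}"
  shows "label_avg U l f (l u0) \<in> {lo..hi}"
proof -
  let ?A = "{u \<in> U. l u = l u0}"
  have A: "card ?A > 0" using assms(1,2) by (auto simp: card_gt_0_iff)
  have "(\<Sum>u\<in>?A. f u) \<le> real (card ?A) * hi" "(\<Sum>u\<in>?A. f u) \<ge> real (card ?A) * lo"
    using assms(3) by (auto intro!: sum_bounded_above sum_bounded_below)
  then show ?thesis using A by (simp add: label_avg_def field_simps)
qed

lemma label_avg_diff: "label_avg U l (\<lambda>u. f u - f' u) c = label_avg U l f c - label_avg U l f' c"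
  by (simp add: label_avg_def sum_subtractf diff_divide_distrib)

lemma label_avg_inj:
  assumes "inj_on l U" "u \<in> U"
  shows "label_avg U l f (l u) = f u"
proof -
  have "{u' \<in> U. l u' = l u} = {u}" using assms by (auto simp: inj_on_def)
  then show ?thesis by (simp add: label_avg_def)
qed

text \<open>
  The codes \<open>a\<close> below round \<open>Z c / (p N c)\<close>, which is the weight maximising
  \<open>a c * Z c - p / 2 * N c * (a c)\<^sup>2\<close> up to the cap 1/2; cells whose noise is below the
  threshold \<open>T * s\<close> get weight 0 and so do not contribute to the code length.
\<close>

lemma block_sum_bound:
  fixes x :: matrix and v :: "nat \<times> nat \<Rightarrow> real" and s :: real
  assumes n: "n \<ge> 2" and p: "0 < p" "p \<le> 1" and bb: "block_bounded n p x"
    and g: "g \<in> {1..n} \<rightarrow> {..n}" and h: "h \<in> {1..n} \<rightarrow> {..n}"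
    and s: "1 \<le> s" "s \<le> 2 * n" and v: "\<And>c. c \<in> (\<lambda>(i, j). (g i, h j)) ` ({1..n} \<times> {1..n}) \<Longrightarrow> \<bar>v c\<bar> \<le> 2"
    and cells: "\<And>c. real (card {u \<in> {1..n} \<times> {1..n}. (\<lambda>(i, j). (g i, h j)) u = c}) \<le> s\<^sup>2"
  shows "(\<Sum>(i, j)\<in>{1..n} \<times> {1..n}. v (g i, h j) * x i j)
    \<le> 128 * ln n * (s * (\<Sum>c\<in>(\<lambda>(i, j). (g i, h j)) ` ({1..n} \<times> {1..n}). \<bar>v c\<bar>))
      + p / 16 * (\<Sum>(i, j)\<in>{1..n} \<times> {1..n}. (v (g i, h j))\<^sup>2)
      + 64 * (2 * real n * ln (real n + 1) + ln n)"
proof -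
  define U where "U = {1..n} \<times> {1..n}"
  define l where "l = (\<lambda>(i, j). (g i, h j))"
  define N where "N c = real (card {u \<in> U. l u = c})" for c
  define Z where "Z c = (\<Sum>u\<in>{u \<in> U. l u = c}. x (fst u) (snd u))" for c
  define T where "T = 128 * ln n"
  define big where "big c \<longleftrightarrow> \<bar>Z c\<bar> > T * s" for c
  define r where "r c = min (1 / 2) (\<bar>Z c\<bar> / (p * N c))" for c
  define a where "a c = (if big c then sgn (Z c) * (\<lfloor>2 * n * r c\<rfloor> / (2 * n)) else 0)" for c
  define K0 where "K0 = 2 * real n * ln (real n + 1) + ln n"
  define Y where "Y = (\<Sum>c\<in>l ` U. a c * Z c)"
  have fU: "finite U" by (simp add: U_def)
  have ln2: "ln (real n) \<ge> 2 / 3"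
    using n ln2_ge_two_thirds ln_mono[of 2 "real n"] by linarith
  have T: "T > 0" using ln2 by (simp add: T_def)
  have Ncell: "N c \<le> s\<^sup>2" for c using cells[of c] by (simp add: N_def U_def l_def)
  have N0: "N c \<ge> 0" for c by (simp add: N_def)
  have big_U: "c \<in> l ` U" if "big c" for c
  proof (rule ccontr)
    assume "c \<notin> l ` U"
    then have e: "{u \<in> U. l u = c} = {}" by auto
    have "Z c = 0" unfolding Z_def e by simp
    then show False using that T s by (simp add: big_def mult_less_0_iff)
  qed
  have big_N: "N c > 0" if "big c" for c
    using big_U[OF that] fU by (auto simp: N_def card_gt_0_iff)
  \<comment> \<open>The optimal weight of a big cell spans at least two grid steps, so rounding it
    down keeps at least half of it. The lower bound combines p N \<le> s^2 \<le> 2 n s with the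
    threshold T s on the noise.\<close>
  have r_low: "2 * n * r c \<ge> 2" if "big c" for c
  proof -
    have N: "N c > 0" using big_N[OF that] .
    have "1 \<le> T" using ln2 by (simp add: T_def)
    have "p * N c \<le> 1 * s\<^sup>2" using p N0 Ncell by (intro mult_mono) auto
    also have "1 * s\<^sup>2 \<le> s * (2 * n)" using s by (simp add: power2_eq_square mult_left_mono)
    also have "\<dots> \<le> (T * s) * n" using s ln2 n by (simp add: T_def)
    also have "\<dots> \<le> \<bar>Z c\<bar> * n" using that by (intro mult_right_mono) (auto simp: big_def)
    finally have "1 \<le> n * (\<bar>Z c\<bar> / (p * N c))" using N p by (simp add: field_simps)
    then show ?thesis using n by (simp add: r_def min_def)
  qed
  have a_abs: "r c / 2 \<le> \<bar>a c\<bar>" "\<bar>a c\<bar> \<le> r c" "a c * Z c = \<bar>a c\<bar> * \<bar>Z c\<bar>" if b: "big c" for c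
  proof -
    have Z: "Z c \<noteq> 0" using b T s by (auto simp: big_def mult_less_0_iff)
    have fl: "of_int \<lfloor>2 * n * r c\<rfloor> \<ge> 2 * n * r c / 2" "of_int \<lfloor>2 * n * r c\<rfloor> \<le> 2 * n * r c"
      "of_int \<lfloor>2 * n * r c\<rfloor> \<ge> (0::real)"
      using r_low[OF b] by linarith+
    have ab: "\<bar>a c\<bar> = \<lfloor>2 * n * r c\<rfloor> / (2 * n)"
      using b fl Z by (simp add: a_def abs_mult abs_sgn_eq)
    show "r c / 2 \<le> \<bar>a c\<bar>" "\<bar>a c\<bar> \<le> r c" using fl n by (auto simp: ab field_simps)
    show "a c * Z c = \<bar>a c\<bar> * \<bar>Z c\<bar>"
      unfolding ab using b by (simp add: a_def sgn_if)
  qed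
  have a_grid: "a \<in> ({..n} \<times> {..n}) \<rightarrow> grid n"
  proof
    fix c
    show "a c \<in> grid n"
    proof (cases "big c")
      case True
      have "r c \<le> 1 / 2" unfolding r_def by (rule min.cobounded1)
      then have "2 * n * r c \<le> n" using n by (simp add: field_simps)
      then have "\<lfloor>2 * n * r c\<rfloor> \<le> int n" by linarith
      moreover have "\<lfloor>2 * n * r c\<rfloor> \<ge> 0" using r_low[OF True] by linarith
      ultimately have "\<lfloor>2 * n * r c\<rfloor> \<in> {- int n..int n}" unfolding atLeastAtMost_iff by linarith
      then have "\<lfloor>2 * n * r c\<rfloor> / (2 * n) \<in> grid n" unfolding grid_def of_nat_mult of_nat_numeral
        by (rule imageI)
      then show ?thesis using grid_uminus[of "\<lfloor>2 * n * r c\<rfloor> / (2 * n)" n]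
        by (auto simp: a_def sgn_if)
    qed (simp add: a_def)
  qed
  have aZ0: "a c * Z c \<ge> 0" for c using a_abs(3)[of c] by (cases "big c") (auto simp: a_def)
  have pa2: "p * (N c * (a c)\<^sup>2) \<le> a c * Z c" for c
  proof (cases "big c")
    case True
    have "\<bar>a c\<bar> \<le> \<bar>Z c\<bar> / (p * N c)" using a_abs(2)[OF True] by (simp add: r_def)
    then have "\<bar>a c\<bar> * (p * N c) \<le> \<bar>Z c\<bar>" using big_N[OF True] p by (simp add: field_simps)
    then have "\<bar>a c\<bar> * (\<bar>a c\<bar> * (p * N c)) \<le> \<bar>a c\<bar> * \<bar>Z c\<bar>" by (intro mult_left_mono) auto
    moreover have "\<bar>a c\<bar> * (\<bar>a c\<bar> * (p * N c)) = p * (N c * (a c)\<^sup>2)"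
      by (simp add: power2_eq_square mult_ac)
    ultimately show ?thesis using a_abs(3)[OF True] by simp
  qed (simp add: a_def)
  \<comment> \<open>The gain is linear in the noise if the cap 1/2 is active and quadratic
    otherwise. The further factor 1/2 is the loss from rounding.\<close>
  have cases_big: "(\<bar>Z c\<bar> / 4 \<le> a c * Z c) \<or> ((Z c)\<^sup>2 / (2 * (p * N c)) \<le> a c * Z c)" if b: "big c" for c
  proof -
    have "r c / 2 * \<bar>Z c\<bar> \<le> a c * Z c"
      unfolding a_abs(3)[OF b] using a_abs(1)[OF b] by (intro mult_right_mono) auto
    moreover have "r c = 1 / 2 \<or> r c = \<bar>Z c\<bar> / (p * N c)" by (auto simp: r_def min_def)
    moreover have "\<bar>Z c\<bar> / (p * N c) / 2 * \<bar>Z c\<bar> = (Z c)\<^sup>2 / (2 * (p * N c))"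
      by (simp add: power2_eq_square)
    moreover have "1 / 2 / 2 * \<bar>Z c\<bar> = \<bar>Z c\<bar> / 4" by simp
    ultimately show ?thesis by metis
  qed
  \<comment> \<open>Each big cell gains at least 32 \<open>ln n\<close>, four times its price in the
    code length. The threshold constant 128 in \<open>T\<close> is set for this: in the capped case
    a quarter of it is left.\<close>
  have aZ_low: "32 * ln n \<le> a c * Z c" if b: "big c" for c
    using cases_big[OF b]
  proof
    assume "\<bar>Z c\<bar> / 4 \<le> a c * Z c"
    moreover have "\<bar>Z c\<bar> > T * s" using b by (simp add: big_def)
    moreover have "T * s \<ge> T * 1" using s T by (intro mult_left_mono) auto
    ultimately show ?thesis by (simp add: T_def)
  next
    assume A: "(Z c)\<^sup>2 / (2 * (p * N c)) \<le> a c * Z c"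
    have N: "N c > 0" using big_N[OF b] .
    have "(T * s)\<^sup>2 \<le> \<bar>Z c\<bar>\<^sup>2" using b T s by (intro power_mono) (auto simp: big_def)
    moreover have "p * N c \<le> 1 * s\<^sup>2" using p N0 Ncell by (intro mult_mono) auto
    ultimately have "T\<^sup>2 * (p * N c) \<le> T\<^sup>2 * s\<^sup>2" "T\<^sup>2 * s\<^sup>2 \<le> (Z c)\<^sup>2"
      by (auto intro!: mult_left_mono simp: power_mult_distrib)
    then have "T\<^sup>2 * (p * N c) \<le> (Z c)\<^sup>2" by linarith
    then have "T\<^sup>2 / 2 \<le> (Z c)\<^sup>2 / (2 * (p * N c))" using N p by (simp add: field_simps)
    moreover have "T * 1 \<le> T * T" using T ln2 by (intro mult_left_mono) (auto simp: T_def)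
    then have "T \<le> T\<^sup>2" by (simp add: power2_eq_square)
    moreover have "32 * ln n \<le> T / 2" using ln2 by (simp add: T_def)
    ultimately show ?thesis using A by linarith
  qed
  have Y_low: "32 * ln n * support_size n a \<le> Y"
  proof -
    have fin: "finite (l ` U)" using fU by simp
    have "support_size n a \<le> card {c \<in> l ` U. big c}"
      unfolding support_size_def using fin big_U by (intro card_mono) (auto simp: a_def split: if_splits)
    then have "32 * ln n * support_size n a \<le> (\<Sum>c\<in>{c \<in> l ` U. big c}. 32 * ln n)"
      using ln2 by simp
    also have "\<dots> \<le> (\<Sum>c\<in>{c \<in> l ` U. big c}. a c * Z c)" by (intro sum_mono aZ_low) auto
    also have "\<dots> \<le> Y" unfolding Y_def using fin aZ0 by (intro sum_mono2) auto
    finally show ?thesis .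
  qed
  have group: "(\<Sum>(i, j)\<in>U. w (g i, h j) * x i j) = (\<Sum>c\<in>l ` U. w c * Z c)"
    "(\<Sum>(i, j)\<in>U. (w (g i, h j))\<^sup>2) = (\<Sum>c\<in>l ` U. N c * (w c)\<^sup>2)" for w :: "nat \<times> nat \<Rightarrow> real"
    using sum_group_label[OF fU, of w l "\<lambda>u. x (fst u) (snd u)"]
      sum_group_label[OF fU, of "\<lambda>c. (w c)\<^sup>2" l "\<lambda>u. 1"]
    by (simp_all add: Z_def N_def l_def case_prod_unfold mult.commute)
  \<comment> \<open>This bound is self-improving: its quadratic part is at most Y / 2 and its
    support part at most Y / 4, so Y \<le> 4 \<open>K0\<close> although \<open>a\<close> was fitted
    to the noise.\<close>
  have "Y \<le> p / 2 * (\<Sum>c\<in>l ` U. N c * (a c)\<^sup>2) + (K0 + 8 * support_size n a * ln n)"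
  proof -
    have "(\<Sum>(i, j)\<in>U. a (g i, h j) * x i j) \<le> p / 2 * (\<Sum>(i, j)\<in>U. (a (g i, h j))\<^sup>2) + code_length n a"
      using bb g h a_grid unfolding block_bounded_def sum.cartesian_product U_def[symmetric] by blast
    then show ?thesis unfolding group by (simp add: Y_def K0_def code_length_def)
  qed
  moreover have "p * (\<Sum>c\<in>l ` U. N c * (a c)\<^sup>2) \<le> Y"
    unfolding Y_def sum_distrib_left by (intro sum_mono pa2)
  moreover have "8 * support_size n a * ln n \<le> Y / 4" using Y_low by (simp add: mult_ac)
  ultimately have Y: "Y \<le> 4 * K0" by linarith
  have each: "v c * Z c \<le> T * s * \<bar>v c\<bar> + p / 16 * (N c * (v c)\<^sup>2) + 16 * (a c * Z c)"
    if c: "c \<in> l ` U" for c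
  proof -
    have q0: "p / 16 * (N c * (v c)\<^sup>2) \<ge> 0" using p N0 by simp
    have t0: "T * s * \<bar>v c\<bar> \<ge> 0" using T s by simp
    have vZ: "v c * Z c \<le> \<bar>v c\<bar> * \<bar>Z c\<bar>" by (simp flip: abs_mult)
    show ?thesis
    proof (cases "big c")
      case False
      then have "\<bar>v c\<bar> * \<bar>Z c\<bar> \<le> \<bar>v c\<bar> * (T * s)" by (intro mult_left_mono) (auto simp: big_def)
      then show ?thesis using vZ q0 aZ0[of c] by (simp add: mult_ac)
    next
      case True
      from cases_big[OF True] show ?thesis
      proof
        assume "\<bar>Z c\<bar> / 4 \<le> a c * Z c"
        moreover have "\<bar>v c\<bar> * \<bar>Z c\<bar> \<le> 2 * \<bar>Z c\<bar>"
          using v[of c] c by (intro mult_right_mono) (auto simp: l_def U_def)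
        ultimately show ?thesis using vZ q0 t0 aZ0[of c] by linarith
      next
        assume A: "(Z c)\<^sup>2 / (2 * (p * N c)) \<le> a c * Z c"
        define q where "q = p * N c"
        have q: "q > 0" using big_N[OF True] p by (simp add: q_def)
        \<comment> \<open>Completing the square: the coefficient 1/16 on the energy is fixed in
          advance, and the rest, 4 Z^2 / q, is at most 8 times the gain of the cell.\<close>
        have "0 \<le> (q * v c - 8 * Z c)\<^sup>2 / (16 * q)" using q by simp
        also have "\<dots> = q / 16 * (v c)\<^sup>2 + 8 * ((Z c)\<^sup>2 / (2 * q)) - v c * Z c"
          using q by (simp add: power2_eq_square field_simps)
        finally have "v c * Z c \<le> p / 16 * (N c * (v c)\<^sup>2) + 8 * (a c * Z c)"
        proof -
          have "q / 16 * (v c)\<^sup>2 = p / 16 * (N c * (v c)\<^sup>2)" by (simp add: q_def)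
          moreover have "8 * ((Z c)\<^sup>2 / (2 * q)) \<le> 8 * (a c * Z c)"
            unfolding q_def by (intro mult_left_mono A) simp
          ultimately show "0 \<le> q / 16 * (v c)\<^sup>2 + 8 * ((Z c)\<^sup>2 / (2 * q)) - v c * Z c \<Longrightarrow> ?thesis"
            by linarith
        qed
        then show ?thesis using t0 aZ0[of c] by linarith
      qed
    qed
  qed
  have "(\<Sum>(i, j)\<in>U. v (g i, h j) * x i j) = (\<Sum>c\<in>l ` U. v c * Z c)" by (rule group)
  also have "\<dots> \<le> (\<Sum>c\<in>l ` U. T * s * \<bar>v c\<bar> + p / 16 * (N c * (v c)\<^sup>2) + 16 * (a c * Z c))"
    by (intro sum_mono each)
  also have "\<dots> = T * (s * (\<Sum>c\<in>l ` U. \<bar>v c\<bar>)) + p / 16 * (\<Sum>c\<in>l ` U. N c * (v c)\<^sup>2) + 16 * Y"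
    by (simp add: sum.distrib sum_distrib_left Y_def mult_ac)
  also have "\<dots> \<le> T * (s * (\<Sum>c\<in>l ` U. \<bar>v c\<bar>)) + p / 16 * (\<Sum>c\<in>l ` U. N c * (v c)\<^sup>2) + 64 * K0"
    using Y by simp
  finally show ?thesis unfolding group(2)[symmetric] unfolding T_def K0_def U_def l_def .
qed

text \<open>Composing with inverse permutations maps the set of all labellings into itself.
  Data-dependent permutations can thus be inserted without any loss of probability.\<close>

lemma block_bounded_permute:
  assumes bb: "block_bounded n p x" and \<rho>: "\<rho> permutes {1..n}" and \<kappa>: "\<kappa> permutes {1..n}"
  shows "block_bounded n p (\<lambda>i j. x (\<rho> i) (\<kappa> j))"
  unfolding block_bounded_def
proof (intro ballI)
  fix g h a
  assume g: "g \<in> {1..n} \<rightarrow> {..n}" and h: "h \<in> {1..n} \<rightarrow> {..n}" and a: "a \<in> {..n} \<times> {..n} \<rightarrow> grid n"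
  have perm: "(\<Sum>i\<in>{1..n}. \<Sum>j\<in>{1..n}. f i j) =
      (\<Sum>i\<in>{1..n}. \<Sum>j\<in>{1..n}. f (\<rho> i) (\<kappa> j))" for f :: "nat \<Rightarrow> nat \<Rightarrow> real"
    by (subst sum.permute[OF \<rho>], subst sum.permute[OF \<kappa>]) (simp add: o_def)
  have "inv \<rho> i \<in> {1..n}" if "i \<in> {1..n}" for i
    using permutes_in_image[OF permutes_inv[OF \<rho>]] that by blast
  then have g': "g \<circ> inv \<rho> \<in> {1..n} \<rightarrow> {..n}" using g by (auto simp: Pi_iff)
  have "inv \<kappa> i \<in> {1..n}" if "i \<in> {1..n}" for i
    using permutes_in_image[OF permutes_inv[OF \<kappa>]] that by blast
  then have h': "h \<circ> inv \<kappa> \<in> {1..n} \<rightarrow> {..n}" using h by (auto simp: Pi_iff)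
  have "(\<Sum>i\<in>{1..n}. \<Sum>j\<in>{1..n}. a ((g \<circ> inv \<rho>) i, (h \<circ> inv \<kappa>) j) * x i j)
       \<le> p / 2 * (\<Sum>i\<in>{1..n}. \<Sum>j\<in>{1..n}. (a ((g \<circ> inv \<rho>) i, (h \<circ> inv \<kappa>) j))\<^sup>2) + code_length n a"
    using bb g' h' a unfolding block_bounded_def by blast
  then show "(\<Sum>i\<in>{1..n}. \<Sum>j\<in>{1..n}. a (g i, h j) * x (\<rho> i) (\<kappa> j))
       \<le> p / 2 * (\<Sum>i\<in>{1..n}. \<Sum>j\<in>{1..n}. (a (g i, h j))\<^sup>2) + code_length n a"
    by (subst (asm) (1 2) perm) (simp add: permutes_inverses[OF \<rho>] permutes_inverses[OF \<kappa>])
qed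

section \<open>Dyadic cells and the oscillation of isotone matrices\<close>

lemma sum_div_2: "(\<Sum>b<2 * B. f (b div 2)) = 2 * (\<Sum>b<B. f b)" for f :: "nat \<Rightarrow> real"
  by (induction B) (auto simp: field_simps)

definition dyadic :: "nat \<Rightarrow> nat \<times> nat \<Rightarrow> nat \<times> nat" where
  "dyadic k = (\<lambda>(i, j). (i div 2 ^ k, j div 2 ^ k))"

lemma dyadic_Suc: "dyadic (Suc k) u = (\<lambda>(b, c). (b div 2, c div 2)) (dyadic k u)"
  by (cases u) (simp add: dyadic_def div_mult2_eq mult.commute[of 2])

lemma card_dyadic_cell: "card {u \<in> {1..n} \<times> {1..n}. dyadic k u = c} \<le> (2 ^ k)\<^sup>2"
proof -
  obtain b b' where c: "c = (b, b')" by (cases c)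
  have "{u \<in> {1..n} \<times> {1..n}. dyadic k u = c} \<subseteq>
     {b * 2 ^ k..<b * 2 ^ k + 2 ^ k} \<times> {b' * 2 ^ k..<b' * 2 ^ k + 2 ^ k}"
    unfolding c dyadic_def by (auto simp: div_nat_eqI dividend_less_div_times add.commute
      intro: div_times_less_eq_dividend)
  then have "card {u \<in> {1..n} \<times> {1..n}. dyadic k u = c} \<le>
     card ({b * 2 ^ k..<b * 2 ^ k + 2 ^ k} \<times> {b' * 2 ^ k..<b' * 2 ^ k + 2 ^ k})"
    by (intro card_mono) auto
  then show ?thesis by (simp add: card_cartesian_product power2_eq_square)
qed

text \<open>Required for all natural indices, since corners of dyadic blocks may lie outside
  1..n.\<close>

definition isotone :: "matrix \<Rightarrow> bool" where
  "isotone F \<longleftrightarrow> (\<forall>i i' j j'. i \<le> i' \<longrightarrow> j \<le> j' \<longrightarrow> F i j \<le> F i' j') \<and> (\<forall>i j. F i j \<in> {0..1})"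

text \<open>The upper corner is the lower corner of the next diagonal block. It thus bounds all
  entries of the block from above for isotone \<open>F\<close>, and neighbouring increments
  telescope.\<close>

definition osc :: "matrix \<Rightarrow> nat \<Rightarrow> nat \<times> nat \<Rightarrow> real" where
  "osc F S = (\<lambda>(b, c). F (b * S + S) (c * S + S) - F (b * S) (c * S))"

lemma isotoneD: "isotone F \<Longrightarrow> i \<le> i' \<Longrightarrow> j \<le> j' \<Longrightarrow> F i j \<le> F i' j'"
  and isotone_range: "isotone F \<Longrightarrow> F i j \<in> {0..1}"
  by (auto simp: isotone_def)

lemma osc_nonneg: "isotone F \<Longrightarrow> osc F S c \<ge> 0"
  by (cases c) (auto simp: osc_def intro: isotoneD)

text \<open>A diagonal increment is a step in the first index plus a step in the second. Along each
  line of blocks such steps telescope to at most 1, and there are \<open>B\<close> lines in either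
  direction.\<close>

lemma sum_osc_le:
  assumes F: "isotone F"
  shows "(\<Sum>b<B. \<Sum>c<B. osc F S (b, c)) \<le> 2 * real B"
proof -
  have one: "(\<Sum>b<B. G (Suc b) - G b) \<le> 1" if "\<And>b. G b \<in> {0..1::real}" for G
    unfolding sum_lessThan_telescope using that[of B] that[of 0] by simp
  have "(\<Sum>b<B. \<Sum>c<B. osc F S (b, c)) =
    (\<Sum>b<B. \<Sum>c<B. F (Suc b * S) (Suc c * S) - F (b * S) (Suc c * S)) +
    (\<Sum>b<B. \<Sum>c<B. F (b * S) (Suc c * S) - F (b * S) (c * S))"
    by (simp add: osc_def sum.distrib[symmetric] add.commute)
  also have "(\<Sum>b<B. \<Sum>c<B. F (Suc b * S) (Suc c * S) - F (b * S) (Suc c * S)) =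
     (\<Sum>c<B. \<Sum>b<B. F (Suc b * S) (Suc c * S) - F (b * S) (Suc c * S))"
    by (rule sum.swap)
  also have "\<dots> \<le> (\<Sum>c<B. 1)"
    by (intro sum_mono one[of "\<lambda>b. F (b * S) _"] isotone_range[OF F])
  also have "(\<Sum>b<B. \<Sum>c<B. F (b * S) (Suc c * S) - F (b * S) (c * S)) \<le> (\<Sum>b<B. 1)"
    by (intro sum_mono one[of "\<lambda>c. F _ (c * S)"] isotone_range[OF F])
  finally show ?thesis by simp
qed

lemma dyadic_bounds:
  assumes "dyadic k (i, j) = (b, c)"
  shows "b * 2 ^ k \<le> i" "i \<le> b * 2 ^ k + 2 ^ k" "c * 2 ^ k \<le> j" "j \<le> c * 2 ^ k + 2 ^ k"
  using assms unfolding dyadic_def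
  by (auto simp: div_times_less_eq_dividend less_imp_le[OF dividend_less_div_times] add.commute)

text \<open>The fine cell lies inside the coarse one, so both averages lie between the corner values
  of the coarse block.\<close>

lemma label_avg_increment:
  assumes F: "isotone F" and u: "u \<in> {1..n} \<times> {1..n}"
  shows "\<bar>label_avg ({1..n} \<times> {1..n}) (dyadic k) (\<lambda>(i, j). F i j) (dyadic k u) -
     label_avg ({1..n} \<times> {1..n}) (dyadic (Suc k)) (\<lambda>(i, j). F i j) (dyadic (Suc k) u)\<bar>
     \<le> osc F (2 ^ Suc k) (dyadic (Suc k) u)"
proof -
  let ?U = "{1..n} \<times> {1..n}" and ?S = "2 ^ Suc k :: nat"
  obtain b c where bc: "dyadic (Suc k) u = (b, c)" by (cases "dyadic (Suc k) u")
  define lo hi where "lo = F (b * ?S) (c * ?S)" and "hi = F (b * ?S + ?S) (c * ?S + ?S)"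
  have mem: "(\<lambda>(i, j). F i j) u' \<in> {lo..hi}" if "dyadic (Suc k) u' = dyadic (Suc k) u" for u'
  proof -
    obtain i j where u': "u' = (i, j)" by (cases u')
    from that have "dyadic (Suc k) (i, j) = (b, c)" by (simp add: u' bc)
    from dyadic_bounds[OF this] show ?thesis
      by (auto simp: lo_def hi_def u' intro!: isotoneD[OF F])
  qed
  have fin: "finite ?U" by simp
  have "label_avg ?U (dyadic k) (\<lambda>(i, j). F i j) (dyadic k u) \<in> {lo..hi}"
    by (rule label_avg_mem[OF fin u]) (intro mem, simp add: dyadic_Suc)
  moreover have "label_avg ?U (dyadic (Suc k)) (\<lambda>(i, j). F i j) (dyadic (Suc k) u) \<in> {lo..hi}"
    by (rule label_avg_mem[OF fin u]) (rule mem)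
  moreover have "osc F ?S (dyadic (Suc k) u) = hi - lo" by (simp add: bc osc_def lo_def hi_def)
  ultimately show ?thesis by auto
qed

lemma noise_isotone:
  fixes x :: matrix
  assumes n: "n \<ge> 2" and p: "0 < p" "p \<le> 1" and bb: "block_bounded n p x"
    and F: "isotone F" and F': "isotone F'"
  shows "(\<Sum>i\<in>{1..n}. \<Sum>j\<in>{1..n}. x i j * (F i j - F' i j))
    \<le> p / 16 * (\<Sum>i\<in>{1..n}. \<Sum>j\<in>{1..n}. (F i j - F' i j)\<^sup>2) + 11200 * n * (ln n)\<^sup>2"
proof -
  define U where "U = {1..n} \<times> {1..n}"
  define D where "D u = (\<lambda>(i, j). F i j) u - (\<lambda>(i, j). F' i j) u" for u :: "nat \<times> nat"
  define A where "A k = label_avg U (dyadic k) D" for k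
  define half where "half = (\<lambda>(b, c). (b div 2 :: nat, c div 2 :: nat))"
  define v where "v k c = A k c - A (Suc k) (half c)" for k c
  define X where "X = (\<lambda>(i, j). x i j)"
  define K0 where "K0 = 2 * real n * ln (real n + 1) + ln n"
  have fU: "finite U" by (simp add: U_def)
  have ln2: "ln (real n) \<ge> 2 / 3"
    using n ln2_ge_two_thirds ln_mono[of 2 "real n"] by linarith
  \<comment> \<open>Level K + 1 then has a single cell, while K stays below \<open>ln n\<close> / ln
    2.\<close>
  obtain K where K: "2 ^ K \<le> n" "n < 2 ^ Suc K"
    using ex_power_ivl1[of 2 n] n by auto
  have dy: "dyadic (Suc k) u = half (dyadic k u)" for k u by (simp add: dyadic_Suc half_def)
  have A_range: "A k (dyadic k u) \<in> {-1..1}" if "u \<in> U" for k u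
    unfolding A_def
  proof (rule label_avg_mem[OF fU that])
    fix u' show "D u' \<in> {-1..1}"
      using isotone_range[OF F, of "fst u'" "snd u'"] isotone_range[OF F', of "fst u'" "snd u'"]
      by (auto simp: D_def case_prod_unfold)
  qed
  have v_dy: "v k (dyadic k u) = A k (dyadic k u) - A (Suc k) (dyadic (Suc k) u)" for k u
    by (simp add: v_def dy)
  have level: "(\<Sum>u\<in>U. w (dyadic k u) * X u)
     \<le> 128 * ln n * (2 ^ k * (\<Sum>c\<in>dyadic k ` U. \<bar>w c\<bar>)) + p / 16 * (\<Sum>u\<in>U. (w (dyadic k u))\<^sup>2) + 64 * K0"
    if k: "2 ^ k \<le> 2 * n" and w: "\<And>u. u \<in> U \<Longrightarrow> \<bar>w (dyadic k u)\<bar> \<le> 2" for k w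
  proof -
    have g: "(\<lambda>i. i div 2 ^ k) \<in> {1..n} \<rightarrow> {..n}" by (auto intro: order_trans[OF div_le_dividend])
    have "real (2 ^ k) \<le> real (2 * n)" using k by (simp only: of_nat_le_iff)
    then have s: "(2 ^ k :: real) \<le> 2 * real n" by simp
    have cells: "real (card {u \<in> {1..n} \<times> {1..n}. (\<lambda>(i, j). (i div 2 ^ k, j div 2 ^ k)) u = c}) \<le> (2 ^ k)\<^sup>2" for c
    proof -
      have "real (card {u \<in> {1..n} \<times> {1..n}. dyadic k u = c}) \<le> real ((2 ^ k)\<^sup>2)"
        using card_dyadic_cell by (simp only: of_nat_le_iff)
      then show ?thesis by (simp add: dyadic_def)
    qed
    have "(\<Sum>(i, j)\<in>{1..n} \<times> {1..n}. w (i div 2 ^ k, j div 2 ^ k) * x i j)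
      \<le> 128 * ln n * (2 ^ k * (\<Sum>c\<in>(\<lambda>(i, j). (i div 2 ^ k, j div 2 ^ k)) ` ({1..n} \<times> {1..n}). \<bar>w c\<bar>))
      + p / 16 * (\<Sum>(i, j)\<in>{1..n} \<times> {1..n}. (w (i div 2 ^ k, j div 2 ^ k))\<^sup>2)
      + 64 * (2 * real n * ln (real n + 1) + ln n)"
      by (rule block_sum_bound[OF n p bb g g _ s _ cells]) (use w in \<open>auto simp: U_def dyadic_def\<close>)
    then show ?thesis
      by (simp add: U_def X_def K0_def dyadic_def case_prod_unfold)
  qed
  have l1: "2 ^ k * (\<Sum>c\<in>dyadic k ` U. \<bar>v k c\<bar>) \<le> 24 * real n" if k: "k \<le> K" for k
  proof -
    \<comment> \<open>Coarse blocks are numbered from 0 to n div 2^(k + 1), hence the + 1. Each side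
      of a coarse block carries two fine cells, so a sum over fine cells repeats every oscillation
      four times.\<close>
    define B where "B = n div 2 ^ Suc k + 1"
    let ?S = "2 ^ Suc k :: nat"
    have osc: "(\<Sum>c\<in>{..<2 * B} \<times> {..<2 * B}. osc G ?S (half c)) \<le> 8 * real B" if "isotone G" for G
    proof -
      have "(\<Sum>c\<in>{..<2 * B} \<times> {..<2 * B}. osc G ?S (half c)) =
        (\<Sum>b<2 * B. \<Sum>c<2 * B. osc G ?S (b div 2, c div 2))"
        by (simp add: sum.cartesian_product half_def case_prod_unfold)
      also have "\<dots> = 2 * (\<Sum>b<B. 2 * (\<Sum>c<B. osc G ?S (b, c)))"
        by (simp only: sum_div_2[of "\<lambda>c. osc G ?S (_, c)"] sum_div_2[of "\<lambda>b. 2 * (\<Sum>c<B. osc G ?S (b, c))"])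
      also have "\<dots> = 4 * (\<Sum>b<B. \<Sum>c<B. osc G ?S (b, c))" by (simp add: sum_distrib_left[symmetric])
      also have "\<dots> \<le> 4 * (2 * real B)" by (intro mult_left_mono sum_osc_le that) auto
      finally show ?thesis by simp
    qed
    have sub: "dyadic k ` U \<subseteq> {..<2 * B} \<times> {..<2 * B}"
    proof
      fix z assume "z \<in> dyadic k ` U"
      then obtain i j where ij: "(i, j) \<in> U" and z: "z = dyadic k (i, j)" by auto
      have lt: "a div 2 ^ k < 2 * B" if "a \<le> n" for a
      proof -
        have "a div 2 ^ k div 2 = a div ?S" by (simp add: div_mult2_eq mult.commute[of 2])
        also have "\<dots> \<le> n div ?S" using that by (rule div_le_mono)
        finally show ?thesis by (simp add: B_def)
      qed
      show "z \<in> {..<2 * B} \<times> {..<2 * B}"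
        using ij lt[of i] lt[of j] by (auto simp: z dyadic_def U_def)
    qed
    have "\<bar>v k c\<bar> \<le> osc F ?S (half c) + osc F' ?S (half c)" if c: "c \<in> dyadic k ` U" for c
    proof -
      obtain u where u: "u \<in> U" "c = dyadic k u" using c by blast
      have "v k c = (label_avg U (dyadic k) (\<lambda>(i, j). F i j) (dyadic k u) -
          label_avg U (dyadic (Suc k)) (\<lambda>(i, j). F i j) (dyadic (Suc k) u)) -
         (label_avg U (dyadic k) (\<lambda>(i, j). F' i j) (dyadic k u) -
          label_avg U (dyadic (Suc k)) (\<lambda>(i, j). F' i j) (dyadic (Suc k) u))"
        unfolding u v_dy A_def D_def label_avg_diff by simp
      then show ?thesis
        using label_avg_increment[OF F u(1)[unfolded U_def], of k]
          label_avg_increment[OF F' u(1)[unfolded U_def], of k]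
        by (simp add: u(2) dy[symmetric] U_def)
    qed
    then have "(\<Sum>c\<in>dyadic k ` U. \<bar>v k c\<bar>) \<le> (\<Sum>c\<in>dyadic k ` U. osc F ?S (half c) + osc F' ?S (half c))"
      by (rule sum_mono)
    also have "\<dots> \<le> (\<Sum>c\<in>{..<2 * B} \<times> {..<2 * B}. osc F ?S (half c) + osc F' ?S (half c))"
      using sub by (intro sum_mono2) (auto intro!: add_nonneg_nonneg osc_nonneg F F')
    also have "\<dots> \<le> 16 * real B" using osc[OF F] osc[OF F'] by (simp add: sum.distrib)
    finally have "2 ^ k * (\<Sum>c\<in>dyadic k ` U. \<bar>v k c\<bar>) \<le> 2 ^ k * (16 * real B)"
      by (intro mult_left_mono) auto
    also have "\<dots> = real (8 * (?S * B))" by simp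
    \<comment> \<open>Whole blocks fill at most n, and the additional one has side at most 2n
      because k \<le> K. This yields the bound 24 n for every level.\<close>
    also have "8 * (?S * B) \<le> 8 * (3 * n)"
    proof -
      have "?S * (n div ?S) \<le> n" by simp
      moreover have "(2::nat) ^ k \<le> 2 ^ K" using k by simp
      moreover have "?S = 2 * 2 ^ k" by simp
      ultimately have "?S \<le> 2 * n" "?S * (n div ?S) \<le> n" using K(1) by linarith+
      then show ?thesis unfolding B_def distrib_left mult_1_right by linarith
    qed
    finally show ?thesis by simp
  qed
  have v_level: "(\<Sum>u\<in>U. v k (dyadic k u) * X u)
     \<le> 128 * ln n * (24 * n) + p / 16 * (\<Sum>u\<in>U. (v k (dyadic k u))\<^sup>2) + 64 * K0" if k: "k \<le> K" for k
  proof -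
    have "(2::nat) ^ k \<le> 2 ^ K" using k by simp
    then have k': "2 ^ k \<le> 2 * n" using K(1) by linarith
    have w: "\<bar>v k (dyadic k u)\<bar> \<le> 2" if "u \<in> U" for u
      using A_range[OF that, of k] A_range[OF that, of "Suc k"] by (auto simp: v_dy)
    have "128 * ln n * (2 ^ k * (\<Sum>c\<in>dyadic k ` U. \<bar>v k c\<bar>)) \<le> 128 * ln n * (24 * n)"
      using l1[OF k] ln2 by (intro mult_left_mono) auto
    with level[of k "v k", OF k' w] show ?thesis by linarith
  qed
  \<comment> \<open>What the increments leave over is the global mean, whose single cell has side at
    most 2n.\<close>
  have top: "(\<Sum>u\<in>U. A (Suc K) (dyadic (Suc K) u) * X u)
     \<le> 128 * ln n * (2 * n) + p / 16 * (\<Sum>u\<in>U. (A (Suc K) (dyadic (Suc K) u))\<^sup>2) + 64 * K0"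
  proof -
    have k': "2 ^ Suc K \<le> 2 * n" using K(1) by simp
    have "real (2 ^ Suc K) \<le> real (2 * n)" using k' by (simp only: of_nat_le_iff)
    then have s: "(2 ^ Suc K :: real) \<le> 2 * real n" by simp
    have w: "\<bar>A (Suc K) (dyadic (Suc K) u)\<bar> \<le> 1" if "u \<in> U" for u
      using A_range[OF that, of "Suc K"] by auto
    then have w2: "\<bar>A (Suc K) (dyadic (Suc K) u)\<bar> \<le> 2" if "u \<in> U" for u
      using that by fastforce
    have "dyadic (Suc K) u = (0, 0)" if "u \<in> U" for u
      using that K(2) by (auto simp: U_def dyadic_def)
    moreover have "(1, 1) \<in> U" using n by (simp add: U_def)
    ultimately have im: "dyadic (Suc K) ` U = {(0, 0)}" by (force simp: image_iff)
    then obtain u where "u \<in> U" "dyadic (Suc K) u = (0, 0)" by blast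
    then have "(\<Sum>c\<in>dyadic (Suc K) ` U. \<bar>A (Suc K) c\<bar>) \<le> 1" using w[of u] by (simp add: im)
    then have "2 ^ Suc K * (\<Sum>c\<in>dyadic (Suc K) ` U. \<bar>A (Suc K) c\<bar>) \<le> (2 * real n) * 1"
      using s by (intro mult_mono sum_nonneg) auto
    then have "128 * ln n * (2 ^ Suc K * (\<Sum>c\<in>dyadic (Suc K) ` U. \<bar>A (Suc K) c\<bar>)) \<le> 128 * ln n * (2 * n)"
      using ln2 by (intro mult_left_mono) auto
    with level[of "Suc K" "A (Suc K)", OF k' w2] show ?thesis by linarith
  qed
  have "A 0 (dyadic 0 u) = D u" if "u \<in> U" for u
    unfolding A_def by (rule label_avg_inj[OF _ that]) (auto simp: dyadic_def inj_on_def)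
  then have tele: "D u = (\<Sum>k<Suc K. v k (dyadic k u)) + A (Suc K) (dyadic (Suc K) u)" if "u \<in> U" for u
    unfolding v_dy using that sum_lessThan_telescope'[of "\<lambda>k. A k (dyadic k u)" "Suc K"] by simp
  \<comment> \<open>Orthogonality of the levels: the energies conceded at the individual levels add
    up to one squared norm. The triangle inequality would not prevent a factor growing with the
    number of levels.\<close>
  have norms: "(\<Sum>k<Suc K. \<Sum>u\<in>U. (v k (dyadic k u))\<^sup>2) + (\<Sum>u\<in>U. (A (Suc K) (dyadic (Suc K) u))\<^sup>2)
     = (\<Sum>u\<in>U. (D u)\<^sup>2)"
  proof -
    have "(\<Sum>u\<in>U. (v k (dyadic k u))\<^sup>2) =
      (\<Sum>u\<in>U. (A k (dyadic k u))\<^sup>2) - (\<Sum>u\<in>U. (A (Suc k) (dyadic (Suc k) u))\<^sup>2)" for k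
      unfolding v_dy A_def by (rule label_avg_orthogonal[OF fU, of _ half]) (rule dy)
    then have "(\<Sum>k<Suc K. \<Sum>u\<in>U. (v k (dyadic k u))\<^sup>2) =
      (\<Sum>u\<in>U. (A 0 (dyadic 0 u))\<^sup>2) - (\<Sum>u\<in>U. (A (Suc K) (dyadic (Suc K) u))\<^sup>2)"
      using sum_lessThan_telescope'[of "\<lambda>k. \<Sum>u\<in>U. (A k (dyadic k u))\<^sup>2" "Suc K"] by simp
    then show ?thesis using \<open>\<And>u. u \<in> U \<Longrightarrow> A 0 (dyadic 0 u) = D u\<close> by simp
  qed
  have "(\<Sum>u\<in>U. D u * X u) =
     (\<Sum>u\<in>U. (\<Sum>k<Suc K. v k (dyadic k u) * X u) + A (Suc K) (dyadic (Suc K) u) * X u)"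
    by (intro sum.cong refl) (simp only: tele distrib_right sum_distrib_right)
  also have "\<dots> = (\<Sum>k<Suc K. \<Sum>u\<in>U. v k (dyadic k u) * X u) +
     (\<Sum>u\<in>U. A (Suc K) (dyadic (Suc K) u) * X u)"
    unfolding sum.distrib by (intro arg_cong2[where f = "(+)"] sum.swap refl)
  also have "\<dots> \<le> (\<Sum>k<Suc K. 128 * ln n * (24 * n) + p / 16 * (\<Sum>u\<in>U. (v k (dyadic k u))\<^sup>2) + 64 * K0)
     + (128 * ln n * (2 * n) + p / 16 * (\<Sum>u\<in>U. (A (Suc K) (dyadic (Suc K) u))\<^sup>2) + 64 * K0)"
    by (intro add_mono sum_mono v_level top) auto
  also have "\<dots> = p / 16 * (\<Sum>u\<in>U. (D u)\<^sup>2) +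
      (real (Suc K) * (128 * ln n * (24 * n) + 64 * K0) + (128 * ln n * (2 * n) + 64 * K0))"
    by (simp only: norms[symmetric] sum.distrib sum_distrib_left[symmetric] sum_constant card_lessThan)
       (simp add: algebra_simps sum_distrib_left)
  also have "real (Suc K) * (128 * ln n * (24 * n) + 64 * K0) + (128 * ln n * (2 * n) + 64 * K0)
      \<le> 11200 * n * (ln n)\<^sup>2"
  proof -
    have "ln (real n + 1) \<le> ln ((real n)\<^sup>2)"
    proof (intro ln_mono)
      have "2 * real n \<le> real n * real n" using n by (intro mult_right_mono) auto
      then show "real n + 1 \<le> (real n)\<^sup>2" using n unfolding power2_eq_square by linarith
    qed (use n in auto)
    also have "\<dots> = 2 * ln n" using n by (simp add: ln_realpow)
    finally have "2 * real n * ln (real n + 1) \<le> 2 * real n * (2 * ln n)" by (intro mult_left_mono) auto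
    moreover have "1 * ln n \<le> n * ln n" using n ln2 by (intro mult_right_mono) auto
    ultimately have K0: "K0 \<le> 5 * (n * ln n)" by (simp add: K0_def)
    have "K * ln 2 \<le> ln n"
    proof -
      have "real (2 ^ K) \<le> real n" using K(1) by (simp only: of_nat_le_iff)
      then have "ln (2 ^ K) \<le> ln (real n)" using n by (intro ln_mono) auto
      then show ?thesis by (simp add: ln_realpow)
    qed
    moreover have "K * (2 / 3) \<le> K * ln (2::real)" using ln2_ge_two_thirds by (intro mult_left_mono) auto
    ultimately have K: "real (Suc K) \<le> 3 * ln n" using ln2 by simp
    have nl: "0 \<le> n * ln n" using ln2 by simp
    have "real (Suc K) * (128 * ln n * (24 * n) + 64 * K0) \<le> (3 * ln n) * (3392 * (n * ln n))"
      using K K0 ln2 by (intro mult_mono) (auto simp: K0_def)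
    moreover have "128 * ln n * (2 * n) + 64 * K0 \<le> 576 * (n * ln n)"
      using K0 by simp
    moreover have "576 * (n * ln n) \<le> (864 * ln n) * (n * ln n)"
      using nl ln2 by (intro mult_right_mono) auto
    ultimately have "real (Suc K) * (128 * ln n * (24 * n) + 64 * K0) + (128 * ln n * (2 * n) + 64 * K0)
       \<le> (3 * ln n) * (3392 * (n * ln n)) + (864 * ln n) * (n * ln n)" by linarith
    also have "\<dots> = 11040 * (n * (ln n)\<^sup>2)" by (simp add: power2_eq_square algebra_simps)
    also have "\<dots> \<le> 11200 * n * (ln n)\<^sup>2" by simp
    finally show ?thesis .
  qed
  finally show ?thesis
    by (simp add: sum.cartesian_product U_def D_def X_def case_prod_unfold mult.commute)
qed

subsection \<open>Isotone extensions\<close>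

lemma ordered_matrices_row_mono:
  assumes f: "f \<in> ordered_matrices m n" and "i \<in> {1..n}" "j \<in> {1..n}" "k \<in> {1..n}"
    and "i \<noteq> j" "i \<noteq> k" "j < k"
  shows "model_sign m * f i j \<le> model_sign m * f i k"
proof (cases m)
  case Tournament
  have "\<forall>i\<in>{1..n}. \<forall>j\<in>{1..n}. \<forall>k\<in>{1..n}. i \<noteq> k \<and> i \<noteq> j \<and> k < j \<longrightarrow> f i j \<le> f i k"
    using f unfolding Tournament ordered_matrices.simps tournament_matrices_def mem_Collect_eq by blast
  then have "f i k \<le> f i j" using assms by blast
  then show ?thesis by (simp add: Tournament model_sign_def)
next
  case Graph
  have "\<forall>i\<in>{1..n}. \<forall>j\<in>{1..n}. \<forall>k\<in>{1..n}. i \<noteq> k \<and> i \<noteq> j \<and> j < k \<longrightarrow> f i j \<le> f i k"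
    using f unfolding Graph ordered_matrices.simps graph_matrices_def mem_Collect_eq by blast
  then have "f i j \<le> f i k" using assms by blast
  then show ?thesis by (simp add: Graph model_sign_def)
qed

lemma ordered_matrices_half:
  assumes f: "f \<in> ordered_matrices Tournament n" and "i \<in> {1..n}" "j \<in> {1..n}" "i < j"
  shows "f i j \<le> 1 / 2" "1 / 2 \<le> f j i"
proof -
  have "\<forall>i\<in>{1..n}. \<forall>j\<in>{1..n}. i < j \<longrightarrow> f i j \<le> 1 / 2"
    using f unfolding ordered_matrices.simps tournament_matrices_def mem_Collect_eq by blast
  then show "f i j \<le> 1 / 2" using assms by blast
  then show "1 / 2 \<le> f j i"
    using ordered_matricesD(3)[OF f assms(2,3)] assms(4) by (simp add: model_sign_def)
qed

text \<open>No sign appears for columns: the sign in the row monotonicity and the one from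
  transposition cancel.\<close>

lemma ordered_matrices_col_mono:
  assumes f: "f \<in> ordered_matrices m n" and i: "i \<in> {1..n}" and a: "a \<in> {1..n}" and b: "b \<in> {1..n}"
    and "i \<noteq> a" "i \<noteq> b" "a \<le> b"
  shows "f a i \<le> f b i"
proof (cases "a = b")
  case False
  have "model_sign m * f i a \<le> model_sign m * f i b"
    using assms False by (intro ordered_matrices_row_mono[OF f]) auto
  moreover have "f a i - 1 / 2 = model_sign m * (f i a - 1 / 2)" "f b i - 1 / 2 = model_sign m * (f i b - 1 / 2)"
    using ordered_matricesD(3)[OF f i a] ordered_matricesD(3)[OF f i b] assms by auto
  ultimately show ?thesis by (simp add: right_diff_distrib)
qed simp

text \<open>Tournament matrices decrease along rows and increase along columns; reversing the column
  order makes both directions increasing. Being the identity outside 1..n makes it a permutation in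
  the sense of \<open>permutes\<close>.\<close>

definition model_rev :: "model \<Rightarrow> nat \<Rightarrow> nat \<Rightarrow> nat" where
  "model_rev m n j = (if m = Tournament \<and> j \<in> {1..n} then n + 1 - j else j)"

lemma model_rev_permutes: "model_rev m n permutes {1..n}"
  by (rule bij_imp_permutes)
     (auto simp: model_rev_def intro!: bij_betw_byWitness[of _ "model_rev m n"])

text \<open>The diagonal entry is replaced by its left neighbour, which lies between the entries on
  both sides in its row; in the corner, 0 is below everything. Symmetry transfers row monotonicity
  to columns.\<close>

lemma graph_isotone_extension:
  assumes f: "f \<in> ordered_matrices Graph n" and n: "n \<ge> 1"
  obtains F where "isotone F" "\<And>i j. i \<in> {1..n} \<Longrightarrow> j \<in> {1..n} \<Longrightarrow> i \<noteq> j \<Longrightarrow> F i j = f i j"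
proof -
  define G where "G i j = (if i = j then if i = 1 then 0 else f i (i - 1) else f i j)" for i j
  \<comment> \<open>Clamping indices to 1..n extends the matrix monotonically to all
    naturals.\<close>
  define c where "c i = max 1 (min n i)" for i :: nat
  have c: "c i \<in> {1..n}" for i using n by (auto simp: c_def)
  have c_mono: "i \<le> i' \<Longrightarrow> c i \<le> c i'" for i i' by (auto simp: c_def)
  note range = ordered_matricesD(1)[OF f]
  have row: "f i j \<le> f i k" if "i \<in> {1..n}" "j \<in> {1..n}" "k \<in> {1..n}" "i \<noteq> j" "i \<noteq> k" "j \<le> k" for i j k
    using ordered_matrices_row_mono[OF f that(1-5)] that(6) by (cases "j = k") (auto simp: model_sign_def)
  have G_range: "G i j \<in> {0..1}" if "i \<in> {1..n}" "j \<in> {1..n}" for i j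
  proof -
    have "i \<noteq> 1 \<Longrightarrow> i - 1 \<in> {1..n}" using that(1) by auto
    then show ?thesis using range[of i j] range[of i "i - 1"] that by (auto simp: G_def)
  qed
  have G_row: "G i j \<le> G i j'" if i: "i \<in> {1..n}" and j: "j \<in> {1..n}" and j': "j' \<in> {1..n}" and le: "j \<le> j'" for i j j'
  proof -
    consider "j = j'" | "i \<noteq> j" "i \<noteq> j'" | "i = j" "j < j'" | "j < j'" "i = j'" using le by linarith
    then show ?thesis
    proof cases
      case 2 then show ?thesis using row[OF i j j'] le by (simp add: G_def)
    next
      case 3
      then show ?thesis using range[OF i j'] row[of i "i - 1" j'] i j' by (auto simp: G_def)
    next
      case 4
      then show ?thesis using row[of i j "i - 1"] i j by (auto simp: G_def)
    qed simp
  qed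
  have G_sym: "G i j = G j i" if "i \<in> {1..n}" "j \<in> {1..n}" for i j
    using ordered_matricesD(3)[OF f that] by (auto simp: G_def model_sign_def)
  define F where "F i j = G (c i) (c j)" for i j
  have "isotone F"
    unfolding isotone_def F_def
  proof (intro conjI allI impI)
    fix i i' j j' :: nat assume "i \<le> i'" "j \<le> j'"
    then have le: "c i \<le> c i'" "c j \<le> c j'" using c_mono by auto
    have "G (c i) (c j) \<le> G (c i) (c j')" by (rule G_row[OF c c c le(2)])
    also have "\<dots> = G (c j') (c i)" by (rule G_sym[OF c c])
    also have "\<dots> \<le> G (c j') (c i')" by (rule G_row[OF c c c le(1)])
    also have "\<dots> = G (c i') (c j')" by (rule G_sym[OF c c])
    finally show "G (c i) (c j) \<le> G (c i') (c j')" .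
  qed (rule G_range[OF c c])
  moreover have "F i j = f i j" if "i \<in> {1..n}" "j \<in> {1..n}" "i \<noteq> j" for i j
    using that by (auto simp: F_def c_def G_def)
  ultimately show thesis by (rule that)
qed

text \<open>Here 1/2 fits on the diagonal, because rows are at least 1/2 to its left and at most 1/2
  to its right.\<close>

lemma tournament_isotone_extension:
  assumes f: "f \<in> ordered_matrices Tournament n" and n: "n \<ge> 1"
  obtains F where "isotone F"
    "\<And>i j. i \<in> {1..n} \<Longrightarrow> j \<in> {1..n} \<Longrightarrow> i \<noteq> n + 1 - j \<Longrightarrow> F i j = f i (n + 1 - j)"
proof -
  define G where "G i j = (if i = j then 1 / 2 else f i j)" for i j
  define c where "c i = max 1 (min n i)" for i :: nat
  have c: "c i \<in> {1..n}" for i using n by (auto simp: c_def)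
  have c': "n + 1 - c i \<in> {1..n}" for i using n by (auto simp: c_def)
  have c_mono: "i \<le> i' \<Longrightarrow> c i \<le> c i'" for i i' by (auto simp: c_def)
  note range = ordered_matricesD(1)[OF f]
  have G_range: "G i j \<in> {0..1}" if "i \<in> {1..n}" "j \<in> {1..n}" for i j
    using range[of i j] that by (auto simp: G_def)
  have G_row: "G i j' \<le> G i j" if i: "i \<in> {1..n}" and j: "j \<in> {1..n}" and j': "j' \<in> {1..n}" and le: "j \<le> j'" for i j j'
  proof -
    consider "j = j'" | "i \<noteq> j" "i \<noteq> j'" "j < j'" | "i = j" "j < j'" | "j < j'" "i = j'" using le by linarith
    then show ?thesis
    proof cases
      case 2 then show ?thesis using ordered_matrices_row_mono[OF f i j j'] by (simp add: G_def model_sign_def)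
    next
      case 3
      then show ?thesis using ordered_matrices_half[OF f i j'] by (simp add: G_def)
    next
      case 4
      then show ?thesis using ordered_matrices_half[OF f j i] by (simp add: G_def)
    qed simp
  qed
  have G_sym: "G j i = 1 - G i j" if "i \<in> {1..n}" "j \<in> {1..n}" for i j
    using ordered_matricesD(3)[OF f that] by (auto simp: G_def model_sign_def)
  define F where "F i j = G (c i) (n + 1 - c j)" for i j
  have "isotone F"
    unfolding isotone_def F_def
  proof (intro conjI allI impI)
    fix i i' j j' :: nat assume "i \<le> i'" "j \<le> j'"
    then have le: "c i \<le> c i'" "n + 1 - c j' \<le> n + 1 - c j"
      using c_mono by (auto intro: diff_le_mono2)
    have "G (c i) (n + 1 - c j) \<le> G (c i) (n + 1 - c j')" by (rule G_row[OF c c' c' le(2)])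
    also have "\<dots> = 1 - G (n + 1 - c j') (c i)" by (rule G_sym[OF c' c])
    also have "\<dots> \<le> 1 - G (n + 1 - c j') (c i')" using G_row[OF c' c c le(1)] by simp
    also have "\<dots> = G (c i') (n + 1 - c j')" by (rule G_sym[OF c' c, symmetric])
    finally show "G (c i) (n + 1 - c j) \<le> G (c i') (n + 1 - c j')" .
  qed (rule G_range[OF c c'])
  moreover have "F i j = f i (n + 1 - j)" if "i \<in> {1..n}" "j \<in> {1..n}" "i \<noteq> n + 1 - j" for i j
    using that by (auto simp: F_def c_def G_def)
  ultimately show thesis by (rule that)
qed

lemma isotone_extension:
  assumes f: "f \<in> ordered_matrices m n" and n: "n \<ge> 1"
  obtains F where "isotone F"
    "\<And>i j. i \<in> {1..n} \<Longrightarrow> j \<in> {1..n} \<Longrightarrow> i \<noteq> model_rev m n j \<Longrightarrow> F i j = f i (model_rev m n j)"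
proof (cases m)
  case Tournament
  then obtain F where "isotone F"
    "\<And>i j. i \<in> {1..n} \<Longrightarrow> j \<in> {1..n} \<Longrightarrow> i \<noteq> n + 1 - j \<Longrightarrow> F i j = f i (n + 1 - j)"
    using tournament_isotone_extension[of f n] f n by metis
  then show thesis by (intro that[of F]) (simp_all add: Tournament model_rev_def)
next
  case Graph
  then obtain F where "isotone F" "\<And>i j. i \<in> {1..n} \<Longrightarrow> j \<in> {1..n} \<Longrightarrow> i \<noteq> j \<Longrightarrow> F i j = f i j"
    using graph_isotone_extension[of f n] f n by metis
  then show thesis by (intro that[of F]) (simp_all add: Graph model_rev_def)
qed

text \<open>The extensions differ from the matrices only on the diagonal. There the noise is 0, so
  the inner product is unchanged, and each diagonal entry adds at most 1 to the squared norm; this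
  is the extra n.\<close>

lemma noise_ordered:
  fixes z :: matrix
  assumes n: "n \<ge> 2" and p: "0 < p" "p \<le> 1" and bb: "block_bounded n p z"
    and z: "\<And>i. i \<in> {1..n} \<Longrightarrow> z i i = 0" and \<sigma>: "\<sigma> permutes {1..n}"
    and f: "f \<in> ordered_matrices m n" and f': "f' \<in> ordered_matrices m n"
  shows "(\<Sum>i\<in>{1..n}. \<Sum>j\<in>{1..n}. z (\<sigma> i) (\<sigma> j) * (f i j - f' i j))
    \<le> p / 16 * ((\<Sum>i\<in>{1..n}. \<Sum>j\<in>{1..n}. (f i j - f' i j)\<^sup>2) + n) + 11200 * n * (ln n)\<^sup>2"
proof -
  let ?r = "model_rev m n"
  note r = model_rev_permutes[of m n]
  have n1: "n \<ge> 1" using n by simp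
  obtain F where F: "isotone F"
    "\<And>i j. i \<in> {1..n} \<Longrightarrow> j \<in> {1..n} \<Longrightarrow> i \<noteq> ?r j \<Longrightarrow> F i j = f i (?r j)"
    using isotone_extension[OF f n1] by blast
  obtain F' where F': "isotone F'"
    "\<And>i j. i \<in> {1..n} \<Longrightarrow> j \<in> {1..n} \<Longrightarrow> i \<noteq> ?r j \<Longrightarrow> F' i j = f' i (?r j)"
    using isotone_extension[OF f' n1] by blast
  define x where "x i j = z (\<sigma> i) ((\<sigma> \<circ> ?r) j)" for i j
  have "block_bounded n p x"
    unfolding x_def by (rule block_bounded_permute[OF bb \<sigma> permutes_compose[OF r \<sigma>]])
  note main = noise_isotone[OF n p this F(1) F'(1)]
  have reindex: "(\<Sum>i\<in>{1..n}. \<Sum>j\<in>{1..n}. h i j) = (\<Sum>i\<in>{1..n}. \<Sum>j\<in>{1..n}. h i (?r j))"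
    for h :: "nat \<Rightarrow> nat \<Rightarrow> real"
    by (subst sum.permute[OF r]) (simp add: o_def)
  have "(\<Sum>i\<in>{1..n}. \<Sum>j\<in>{1..n}. z (\<sigma> i) (\<sigma> j) * (f i j - f' i j)) =
     (\<Sum>i\<in>{1..n}. \<Sum>j\<in>{1..n}. x i j * (F i j - F' i j))"
  proof (subst reindex, intro sum.cong refl)
    fix i j assume i: "i \<in> {1..n}" and j: "j \<in> {1..n}"
    show "z (\<sigma> i) (\<sigma> (?r j)) * (f i (?r j) - f' i (?r j)) = x i j * (F i j - F' i j)"
    proof (cases "i = ?r j")
      case True
      have "\<sigma> i \<in> {1..n}" using permutes_in_image[OF \<sigma>] i by blast
      then show ?thesis using z[of "\<sigma> i"] by (simp add: x_def True)
    next
      case False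
      then show ?thesis using F(2)[OF i j] F'(2)[OF i j] by (simp add: x_def)
    qed
  qed
  moreover have "(\<Sum>i\<in>{1..n}. \<Sum>j\<in>{1..n}. (F i j - F' i j)\<^sup>2)
     \<le> (\<Sum>i\<in>{1..n}. \<Sum>j\<in>{1..n}. (f i j - f' i j)\<^sup>2) + n"
  proof -
    have "(F i j - F' i j)\<^sup>2 \<le> (f i (?r j) - f' i (?r j))\<^sup>2 + (if i = ?r j then 1 else 0)"
      if i: "i \<in> {1..n}" and j: "j \<in> {1..n}" for i j
    proof (cases "i = ?r j")
      case True
      have "\<bar>F i j - F' i j\<bar> \<le> 1"
        using isotone_range[OF F(1), of i j] isotone_range[OF F'(1), of i j] by auto
      then have "(F i j - F' i j)\<^sup>2 \<le> 1" by (simp add: abs_square_le_1)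
      then show ?thesis using True by (simp add: add_increasing)
    next
      case False
      then show ?thesis using F(2)[OF i j] F'(2)[OF i j] by simp
    qed
    then have "(\<Sum>i\<in>{1..n}. \<Sum>j\<in>{1..n}. (F i j - F' i j)\<^sup>2)
      \<le> (\<Sum>i\<in>{1..n}. \<Sum>j\<in>{1..n}. (f i (?r j) - f' i (?r j))\<^sup>2 + (if i = ?r j then 1 else 0))"
      by (intro sum_mono) auto
    also have "\<dots> = (\<Sum>i\<in>{1..n}. \<Sum>j\<in>{1..n}. (f i (?r j) - f' i (?r j))\<^sup>2)
        + (\<Sum>i\<in>{1..n}. \<Sum>j\<in>{1..n}. if i = ?r j then 1 else 0)"
      by (simp only: sum.distrib)
    also have "(\<Sum>i\<in>{1..n}. \<Sum>j\<in>{1..n}. (f i (?r j) - f' i (?r j))\<^sup>2) =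
      (\<Sum>i\<in>{1..n}. \<Sum>j\<in>{1..n}. (f i j - f' i j)\<^sup>2)" by (rule reindex[symmetric])
    also have "(\<Sum>i\<in>{1..n}. \<Sum>j\<in>{1..n}. if i = ?r j then 1 else 0) = (real n)"
      using reindex[of "\<lambda>i j. if i = j then 1 else 0"] by simp
    finally show ?thesis .
  qed
  then have "p / 16 * (\<Sum>i\<in>{1..n}. \<Sum>j\<in>{1..n}. (F i j - F' i j)\<^sup>2)
     \<le> p / 16 * ((\<Sum>i\<in>{1..n}. \<Sum>j\<in>{1..n}. (f i j - f' i j)\<^sup>2) + n)"
    using p by (intro mult_left_mono) auto
  ultimately show ?thesis using main by linarith
qed

subsection \<open>The ordering error\<close>

text \<open>Sorting is stable in the maximum norm, by pigeonhole. If \<open>u i\<close> exceeded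
  \<open>R i\<close> + M, all indices from i on would be sent by the injective \<open>\<rho>\<close>
  strictly above i, where there are too few places; the other side is symmetric.\<close>

lemma sorted_stable:
  fixes R u :: "nat \<Rightarrow> real"
  assumes R: "\<And>i j. i \<in> {1..n} \<Longrightarrow> j \<in> {1..n} \<Longrightarrow> i \<le> j \<Longrightarrow> R i \<le> R j"
    and u: "\<And>i j. i \<in> {1..n} \<Longrightarrow> j \<in> {1..n} \<Longrightarrow> i \<le> j \<Longrightarrow> u i \<le> u j"
    and \<rho>: "\<rho> permutes {1..n}"
    and close: "\<And>i. i \<in> {1..n} \<Longrightarrow> \<bar>u i - R (\<rho> i)\<bar> \<le> M" and i: "i \<in> {1..n}"
  shows "\<bar>R (\<rho> i) - R i\<bar> \<le> 2 * M"
proof -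
  have \<rho>_in: "\<rho> k \<in> {1..n}" if "k \<in> {1..n}" for k using permutes_in_image[OF \<rho>] that by blast
  have inj: "inj_on \<rho> A" for A using permutes_inj[OF \<rho>] by (rule inj_on_subset) simp
  have up: "u i \<le> R i + M"
  proof (rule ccontr)
    assume neg: "\<not> u i \<le> R i + M"
    have "\<rho> ` {i..n} \<subseteq> {Suc i..n}"
    proof
      fix k assume "k \<in> \<rho> ` {i..n}"
      then obtain k' where k': "k' \<in> {i..n}" "k = \<rho> k'" by blast
      then have kn: "k' \<in> {1..n}" using i by auto
      have "R i < R (\<rho> k')"
        using neg u[OF i kn] close[OF kn] k' by auto
      then have "\<not> \<rho> k' \<le> i" using R[OF \<rho>_in[OF kn] i] by linarith
      then show "k \<in> {Suc i..n}" using \<rho>_in[OF kn] k' by auto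
    qed
    then have "card (\<rho> ` {i..n}) \<le> card {Suc i..n}" by (intro card_mono) auto
    then show False using i by (simp add: card_image[OF inj] Suc_diff_le)
  qed
  have lo: "R i - M \<le> u i"
  proof (rule ccontr)
    assume neg: "\<not> R i - M \<le> u i"
    have "\<rho> ` {1..i} \<subseteq> {1..<i}"
    proof
      fix k assume "k \<in> \<rho> ` {1..i}"
      then obtain k' where k': "k' \<in> {1..i}" "k = \<rho> k'" by blast
      then have kn: "k' \<in> {1..n}" using i by auto
      have "R (\<rho> k') < R i"
        using neg u[OF kn i] close[OF kn] k' by auto
      then have "\<not> i \<le> \<rho> k'" using R[OF i \<rho>_in[OF kn]] by linarith
      then show "k \<in> {1..<i}" using \<rho>_in[OF kn] k' by auto
    qed
    then have "card (\<rho> ` {1..i}) \<le> card {1..<i}" by (intro card_mono) auto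
    then show False using i by (auto simp: card_image[OF inj])
  qed
  show ?thesis using up lo close[OF i] by linarith
qed

text \<open>Columns \<open>a\<close> and \<open>b\<close> are split off because the zero diagonal
  spoils monotonicity there; what remains of them is \<open>f a b\<close> \<le>
  \<open>f b a\<close>.\<close>

lemma row_sum_mono:
  assumes f: "f \<in> ordered_matrices m n" and a: "a \<in> {1..n}" and b: "b \<in> {1..n}" and ab: "a \<le> b"
  shows "row_sum n f a \<le> row_sum n f b"
proof (cases "a = b")
  case False
  have split: "row_sum n f c = f c a + f c b + (\<Sum>j\<in>{1..n} - {a, b}. f c j)" for c
  proof -
    have "row_sum n f c = f c a + (\<Sum>j\<in>{1..n} - {a}. f c j)"
      unfolding row_sum_def using a by (intro sum.remove) auto
    also have "(\<Sum>j\<in>{1..n} - {a}. f c j) = f c b + (\<Sum>j\<in>{1..n} - {a} - {b}. f c j)"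
      using b False by (intro sum.remove) auto
    also have "{1..n} - {a} - {b} = {1..n} - {a, b}" by auto
    finally show ?thesis by simp
  qed
  have "(\<Sum>j\<in>{1..n} - {a, b}. f a j) \<le> (\<Sum>j\<in>{1..n} - {a, b}. f b j)"
    using a b ab by (intro sum_mono ordered_matrices_col_mono[OF f]) auto
  moreover have "f a b \<le> f b a"
  proof (cases m)
    case Tournament
    then show ?thesis using ordered_matrices_half[of f n a b] f a b ab False by simp
  next
    case Graph
    then show ?thesis using ordered_matricesD(3)[OF f a b] False by (simp add: model_sign_def)
  qed
  moreover have "f a a = 0" "f b b = 0" using ordered_matricesD(2)[OF f] a b by blast+
  ultimately show ?thesis by (simp add: split)
qed simp

text \<open>For a fixed pair of columns the Hoelder modulus is the same in every row. Comparing two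
  rows cancels it, and with it the exponent and the permutation from the Hoelder class, which may
  differ from \<open>\<tau>\<close>.\<close>

lemma holder_ratio:
  assumes \<theta>: "permute \<theta>0 \<tau> \<in> holder_class m n \<alpha> L L'" and \<tau>: "\<tau> permutes {1..n}" and L: "L > 0" "L' > 0"
    and i: "i \<in> {1..n}" "i \<noteq> a" "i \<noteq> b" and i': "i' \<in> {1..n}" "i' \<noteq> a" "i' \<noteq> b"
    and ab: "a \<in> {1..n}" "b \<in> {1..n}"
  shows "\<bar>\<theta>0 i a - \<theta>0 i b\<bar> \<le> L / L' * \<bar>\<theta>0 i' a - \<theta>0 i' b\<bar>"
proof -
  obtain \<pi> where \<pi>: "\<pi> permutes {1..n}"
    and H: "\<forall>i\<in>{1..n}. \<forall>j\<in>{1..n}. \<forall>k\<in>{1..n}. i \<noteq> j \<and> i \<noteq> k \<longrightarrow>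
        L' * (\<bar>real j - real k\<bar> powr \<alpha> / real n powr \<alpha>)
          \<le> \<bar>permute (permute \<theta>0 \<tau>) \<pi> i j - permute (permute \<theta>0 \<tau>) \<pi> i k\<bar> \<and>
        \<bar>permute (permute \<theta>0 \<tau>) \<pi> i j - permute (permute \<theta>0 \<tau>) \<pi> i k\<bar>
          \<le> L * (\<bar>real j - real k\<bar> powr \<alpha> / real n powr \<alpha>)"
    using \<theta> unfolding holder_class_def by blast
  define \<kappa> where "\<kappa> = inv (\<tau> \<circ> \<pi>)"
  have p: "\<tau> \<circ> \<pi> permutes {1..n}" by (rule permutes_compose[OF \<pi> \<tau>])
  have \<kappa>_in: "\<kappa> c \<in> {1..n}" if "c \<in> {1..n}" for c
    using permutes_in_image[OF permutes_inv[OF p]] that by (simp add: \<kappa>_def)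
  have inv: "\<tau> (\<pi> (\<kappa> c)) = c" for c using permutes_inverses(1)[OF p, of c] by (simp add: \<kappa>_def)
  have ne: "\<kappa> c \<noteq> \<kappa> d" if "c \<noteq> d" for c d using inv that by metis
  define d where "d = \<bar>real (\<kappa> a) - real (\<kappa> b)\<bar> powr \<alpha> / real n powr \<alpha>"
  have H': "L' * d \<le> \<bar>\<theta>0 k a - \<theta>0 k b\<bar> \<and> \<bar>\<theta>0 k a - \<theta>0 k b\<bar> \<le> L * d"
    if "k \<in> {1..n}" "k \<noteq> a" "k \<noteq> b" for k
    using H[rule_format, OF \<kappa>_in[OF that(1)] \<kappa>_in[OF ab(1)] \<kappa>_in[OF ab(2)]] ne[OF that(2)] ne[OF that(3)]
    by (simp add: permute_def inv d_def)
  have "\<bar>\<theta>0 i a - \<theta>0 i b\<bar> \<le> L / L' * (L' * d)" using H'[OF i] L by simp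
  also have "\<dots> \<le> L / L' * \<bar>\<theta>0 i' a - \<theta>0 i' b\<bar>"
    using H'[OF i'] L by (intro mult_left_mono) auto
  finally show ?thesis .
qed

lemma ordered_matrices_row_col_diff:
  assumes f: "f \<in> ordered_matrices m n" and i: "i \<in> {1..n}" "a \<in> {1..n}" "b \<in> {1..n}" "i \<noteq> a" "i \<noteq> b"
  shows "\<bar>f a i - f b i\<bar> = \<bar>f i a - f i b\<bar>"
proof -
  have "f a i - 1 / 2 = model_sign m * (f i a - 1 / 2)" "f b i - 1 / 2 = model_sign m * (f i b - 1 / 2)"
    using ordered_matricesD(3)[OF f i(1,2)] ordered_matricesD(3)[OF f i(1,3)] i by auto
  then have "f a i - f b i = model_sign m * (f i a - f i b)" by (simp add: right_diff_distrib)
  then show ?thesis by (simp add: abs_mult)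
qed

text \<open>By the ratio bound every difference is at most L / L' times the mean difference, so the
  l2 norm is controlled by the l1 norm over sqrt (n - 2). All differences have one sign, so the l1
  norm is the difference of the row sums up to the entries at \<open>a\<close> and \<open>b\<close>,
  which cost the + 1.\<close>

lemma row_distance_le:
  assumes f: "f \<in> ordered_matrices m n" and \<theta>: "permute f \<tau> \<in> holder_class m n \<alpha> L L'"
    and \<tau>: "\<tau> permutes {1..n}" and L: "L > 0" "L' > 0" and n: "n \<ge> 3"
    and a: "a \<in> {1..n}" and b: "b \<in> {1..n}"
  shows "(\<Sum>i\<in>{1..n} - {a, b}. (f a i - f b i)\<^sup>2)
    \<le> (L / L')\<^sup>2 * ((\<bar>row_sum n f a - row_sum n f b\<bar> + 1)\<^sup>2 / (n - 2))"
proof (cases "a = b")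
  case True
  then show ?thesis by simp
next
  case False
  define S where "S = {1..n} - {a, b}"
  define x where "x i = f a i - f b i" for i
  define G where "G = L / L'"
  have G: "G > 0" using L by (simp add: G_def)
  have card: "real (card S) = n - 2"
    using a b False n by (simp add: S_def card_Diff_subset of_nat_diff)
  have ratio: "\<bar>x i\<bar> \<le> G * \<bar>x i'\<bar>" if "i \<in> S" "i' \<in> S" for i i'
    using holder_ratio[OF \<theta> \<tau> L, of i a b i'] that a b
      ordered_matrices_row_col_diff[OF f, of i a b] ordered_matrices_row_col_diff[OF f, of i' a b]
    by (simp add: S_def x_def G_def)
  define s where "s = (\<Sum>i\<in>S. \<bar>x i\<bar>)"
  have s0: "s \<ge> 0" by (simp add: s_def sum_nonneg)
  have each: "\<bar>x i\<bar> * (n - 2) \<le> G * s" if "i \<in> S" for i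
  proof -
    have "\<bar>x i\<bar> * (n - 2) = (\<Sum>i'\<in>S. \<bar>x i\<bar>)" using card by simp
    also have "\<dots> \<le> (\<Sum>i'\<in>S. G * \<bar>x i'\<bar>)" by (intro sum_mono ratio that)
    finally show ?thesis by (simp add: s_def sum_distrib_left)
  qed
  have n2: "real n - 2 > 0" using n by simp
  have "(x i)\<^sup>2 \<le> G\<^sup>2 * (s\<^sup>2 / (n - 2)\<^sup>2)" if "i \<in> S" for i
  proof -
    have "\<bar>x i\<bar> \<le> G * s / (n - 2)" using each[OF that] n2 n by (simp add: field_simps of_nat_diff)
    then have "\<bar>x i\<bar>\<^sup>2 \<le> (G * s / (n - 2))\<^sup>2" by (intro power_mono) auto
    then show ?thesis by (simp add: power_mult_distrib power_divide)
  qed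
  then have "(\<Sum>i\<in>S. (x i)\<^sup>2) \<le> (\<Sum>i\<in>S. G\<^sup>2 * (s\<^sup>2 / (n - 2)\<^sup>2))" by (rule sum_mono)
  also have "\<dots> = G\<^sup>2 * (s\<^sup>2 / (n - 2))" using card n2 n by (simp add: power2_eq_square of_nat_diff)
  also have "\<dots> \<le> G\<^sup>2 * ((\<bar>row_sum n f a - row_sum n f b\<bar> + 1)\<^sup>2 / (n - 2))"
  proof -
    have "s = \<bar>\<Sum>i\<in>S. x i\<bar>"
    proof (cases "a \<le> b")
      case True
      have "x i \<le> 0" if "i \<in> S" for i
        using ordered_matrices_col_mono[OF f, of i a b] that a b True by (simp add: S_def x_def)
      then have "s = (\<Sum>i\<in>S. - x i)" unfolding s_def by (intro sum.cong) auto
      moreover have "(\<Sum>i\<in>S. x i) \<le> 0" by (rule sum_nonpos) fact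
      ultimately show ?thesis by (simp add: sum_negf)
    next
      case False
      have "x i \<ge> 0" if "i \<in> S" for i
        using ordered_matrices_col_mono[OF f, of i b a] that a b False by (simp add: S_def x_def)
      then show ?thesis by (simp add: s_def sum_nonneg)
    qed
    moreover have "row_sum n f a - row_sum n f b = (\<Sum>i\<in>S. x i) + (f a b - f b a)"
    proof -
      have split: "row_sum n f c = f c a + f c b + (\<Sum>j\<in>S. f c j)" for c
      proof -
        have "row_sum n f c = f c a + (\<Sum>j\<in>{1..n} - {a}. f c j)"
          unfolding row_sum_def using a by (intro sum.remove) auto
        also have "(\<Sum>j\<in>{1..n} - {a}. f c j) = f c b + (\<Sum>j\<in>{1..n} - {a} - {b}. f c j)"
          using b False by (intro sum.remove) auto
        also have "{1..n} - {a} - {b} = S" by (auto simp: S_def)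
        finally show ?thesis by simp
      qed
      have "f a a = 0" "f b b = 0" using ordered_matricesD(2)[OF f] a b by blast+
      then show ?thesis by (simp add: split x_def sum_subtractf)
    qed
    moreover have "\<bar>f a b - f b a\<bar> \<le> 1"
      using ordered_matricesD(1)[OF f a b] ordered_matricesD(1)[OF f b a] by auto
    ultimately have "s \<le> \<bar>row_sum n f a - row_sum n f b\<bar> + 1" by linarith
    then show ?thesis using s0 n2 by (intro mult_left_mono divide_right_mono power_mono) auto
  qed
  finally show ?thesis by (simp add: S_def x_def G_def)
qed

lemma sum_le_off_two:
  fixes h :: "nat \<Rightarrow> real"
  assumes "\<And>i. i \<in> {1..n} \<Longrightarrow> h i \<le> 1" and "\<And>i. i \<in> {1..n} \<Longrightarrow> h i \<ge> 0"
  shows "(\<Sum>i\<in>{1..n}. h i) \<le> (\<Sum>i\<in>{1..n} - {a, b}. h i) + 2"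
proof -
  have "(\<Sum>i\<in>{1..n}. h i) = (\<Sum>i\<in>{1..n} - {a, b}. h i) + (\<Sum>i\<in>{1..n} \<inter> {a, b}. h i)"
    by (rule sum.Int_Diff[of _ _ "{a, b}", THEN trans]) (auto simp: add.commute)
  also have "(\<Sum>i\<in>{1..n} \<inter> {a, b}. h i) \<le> (\<Sum>i\<in>{1..n} \<inter> {a, b}. 1)"
    by (intro sum_mono assms) auto
  also have "\<dots> \<le> real (card {a, b})" using card_mono[of "{a, b}" "{1..n} \<inter> {a, b}"] by simp
  also have "\<dots> \<le> 2" by (simp add: card_insert_if)
  finally show ?thesis by simp
qed

text \<open>Rows and columns are permuted one after the other, and the column step equals a row step
  by the model symmetry. The 2 in each row covers the two columns that the Hoelder condition leaves
  out.\<close>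

lemma permutation_bias:
  assumes f: "f \<in> ordered_matrices m n" and \<rho>: "\<rho> permutes {1..n}"
  shows "(\<Sum>i\<in>{1..n}. \<Sum>j\<in>{1..n}. (f (\<rho> i) (\<rho> j) - f i j)\<^sup>2)
    \<le> 4 * (\<Sum>i\<in>{1..n}. (\<Sum>j\<in>{1..n} - {\<rho> i, i}. (f (\<rho> i) j - f i j)\<^sup>2) + 2)"
proof -
  let ?d = "\<lambda>i. (\<Sum>j\<in>{1..n} - {\<rho> i, i}. (f (\<rho> i) j - f i j)\<^sup>2) + 2"
  have \<rho>_in: "\<rho> k \<in> {1..n}" if "k \<in> {1..n}" for k using permutes_in_image[OF \<rho>] that by blast
  have le1: "(f a b - f c d)\<^sup>2 \<le> 1" if "a \<in> {1..n}" "b \<in> {1..n}" "c \<in> {1..n}" "d \<in> {1..n}" for a b c d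
  proof -
    have "\<bar>f a b - f c d\<bar> \<le> 1"
      using ordered_matricesD(1)[OF f that(1,2)] ordered_matricesD(1)[OF f that(3,4)] by auto
    then show ?thesis by (simp add: abs_square_le_1)
  qed
  have row: "(\<Sum>j\<in>{1..n}. (f (\<rho> i) (\<rho> j) - f i (\<rho> j))\<^sup>2) \<le> ?d i" if i: "i \<in> {1..n}" for i
  proof -
    have "(\<Sum>j\<in>{1..n}. (f (\<rho> i) (\<rho> j) - f i (\<rho> j))\<^sup>2) = (\<Sum>j\<in>{1..n}. (f (\<rho> i) j - f i j)\<^sup>2)"
      by (subst (2) sum.permute[OF \<rho>]) (simp add: o_def)
    also have "\<dots> \<le> ?d i" using i \<rho>_in by (intro sum_le_off_two le1) auto
    finally show ?thesis .
  qed
  have col: "(\<Sum>i\<in>{1..n}. (f i (\<rho> j) - f i j)\<^sup>2) \<le> ?d j" if j: "j \<in> {1..n}" for j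
  proof -
    have "(\<Sum>i\<in>{1..n}. (f i (\<rho> j) - f i j)\<^sup>2) \<le> (\<Sum>i\<in>{1..n} - {\<rho> j, j}. (f i (\<rho> j) - f i j)\<^sup>2) + 2"
      using j \<rho>_in by (intro sum_le_off_two le1) auto
    also have "(\<Sum>i\<in>{1..n} - {\<rho> j, j}. (f i (\<rho> j) - f i j)\<^sup>2) = (\<Sum>i\<in>{1..n} - {\<rho> j, j}. (f (\<rho> j) i - f j i)\<^sup>2)"
    proof (intro sum.cong refl)
      fix i assume i: "i \<in> {1..n} - {\<rho> j, j}"
      then have "\<bar>f (\<rho> j) i - f j i\<bar> = \<bar>f i (\<rho> j) - f i j\<bar>"
        using \<rho>_in[OF j] j by (intro ordered_matrices_row_col_diff[OF f]) auto
      then show "(f i (\<rho> j) - f i j)\<^sup>2 = (f (\<rho> j) i - f j i)\<^sup>2" by (metis power2_abs)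
    qed
    finally show ?thesis .
  qed
  have "(\<Sum>i\<in>{1..n}. \<Sum>j\<in>{1..n}. (f (\<rho> i) (\<rho> j) - f i j)\<^sup>2)
    \<le> (\<Sum>i\<in>{1..n}. \<Sum>j\<in>{1..n}. 2 * (f (\<rho> i) (\<rho> j) - f i (\<rho> j))\<^sup>2 + 2 * (f i (\<rho> j) - f i j)\<^sup>2)"
  proof (intro sum_mono)
    fix i j
    have "(a - c)\<^sup>2 \<le> 2 * (a - b)\<^sup>2 + 2 * (b - c)\<^sup>2" for a b c :: real
      using zero_le_power2[of "(a - b) - (b - c)"] by (simp add: power2_eq_square algebra_simps)
    then show "(f (\<rho> i) (\<rho> j) - f i j)\<^sup>2 \<le> 2 * (f (\<rho> i) (\<rho> j) - f i (\<rho> j))\<^sup>2 + 2 * (f i (\<rho> j) - f i j)\<^sup>2" .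
  qed
  also have "\<dots> = 2 * (\<Sum>i\<in>{1..n}. \<Sum>j\<in>{1..n}. (f (\<rho> i) (\<rho> j) - f i (\<rho> j))\<^sup>2)
     + 2 * (\<Sum>i\<in>{1..n}. \<Sum>j\<in>{1..n}. (f i (\<rho> j) - f i j)\<^sup>2)"
    by (simp only: sum.distrib sum_distrib_left)
  also have "(\<Sum>i\<in>{1..n}. \<Sum>j\<in>{1..n}. (f i (\<rho> j) - f i j)\<^sup>2) =
      (\<Sum>j\<in>{1..n}. \<Sum>i\<in>{1..n}. (f i (\<rho> j) - f i j)\<^sup>2)" by (rule sum.swap)
  also have "2 * (\<Sum>i\<in>{1..n}. \<Sum>j\<in>{1..n}. (f (\<rho> i) (\<rho> j) - f i (\<rho> j))\<^sup>2)
     + 2 * (\<Sum>j\<in>{1..n}. \<Sum>i\<in>{1..n}. (f i (\<rho> j) - f i j)\<^sup>2) \<le> 2 * (\<Sum>i\<in>{1..n}. ?d i) + 2 * (\<Sum>i\<in>{1..n}. ?d i)"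
    by (intro add_mono mult_left_mono sum_mono row col) auto
  finally show ?thesis by simp
qed

lemma sorting_bias:
  assumes f: "f \<in> ordered_matrices m n" and \<theta>: "permute f \<tau> \<in> holder_class m n \<alpha> L L'"
    and \<tau>: "\<tau> permutes {1..n}" and L: "L > 0" "L' > 0" and n: "n \<ge> 3"
    and p: "0 < p" "p \<le> 1"
    and rows: "\<And>i. i \<in> {1..n} \<Longrightarrow>
      \<bar>\<Sum>j\<in>{1..n}. noise m n (permute f \<tau>) p X B i j\<bar> \<le> 4 * sqrt (n * p * ln n)"
    and \<sigma>: "\<sigma> \<in> sorting_perms n (data_matrix m n X B)"
  shows "(\<Sum>i\<in>{1..n}. \<Sum>j\<in>{1..n}. (f (\<tau> (\<sigma> i)) (\<tau> (\<sigma> j)) - f i j)\<^sup>2)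
    \<le> 972 * ((L / L')\<^sup>2 * (n * ln n / p)) + 8 * n"
proof -
  let ?\<theta> = "permute f \<tau>" and ?y = "data_matrix m n X B" and ?R = "row_sum n f"
  define \<rho> where "\<rho> = \<tau> \<circ> \<sigma>"
  have \<sigma>p: "\<sigma> permutes {1..n}"
    and \<sigma>s: "\<And>i j. i \<in> {1..n} \<Longrightarrow> j \<in> {1..n} \<Longrightarrow> i \<le> j \<Longrightarrow> row_sum n ?y (\<sigma> i) \<le> row_sum n ?y (\<sigma> j)"
    using \<sigma> by (auto simp: sorting_perms_def)
  have \<rho>: "\<rho> permutes {1..n}" unfolding \<rho>_def by (rule permutes_compose[OF \<sigma>p \<tau>])
  have \<sigma>_in: "\<sigma> k \<in> {1..n}" if "k \<in> {1..n}" for k using permutes_in_image[OF \<sigma>p] that by blast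
  have \<rho>_in: "\<rho> k \<in> {1..n}" if "k \<in> {1..n}" for k using permutes_in_image[OF \<rho>] that by blast
  have ln1: "ln (real n) \<ge> 1"
    using n e_less_272 by (subst ln_ge_iff) (auto intro: order_trans[of _ 3])
  define q where "q = sqrt (n * ln n / p)"
  have q2: "q\<^sup>2 = n * ln n / p" using ln1 p by (simp add: q_def)
  have q1: "1 \<le> q"
  proof -
    have "p * 1 \<le> 1 * (n * ln n)" using p ln1 n mult_mono[of 1 "real n" 1 "ln n"] by (intro mult_mono) auto
    then show ?thesis using p by (simp add: q_def field_simps)
  qed
  define jn where "jn = (\<Sum>j\<in>{1..n}. J_matrix n 1 j)"
  \<comment> \<open>An increasing affine function of the observed row sums, hence sorted along
    \<open>\<sigma>\<close>, and an unbiased estimate of the true row sums.\<close>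
  define u where "u i = (row_sum n ?y (\<sigma> i) - jn / 2) / p + jn / 2" for i
  have jn: "(\<Sum>j\<in>{1..n}. J_matrix n i j) = jn" if i: "i \<in> {1..n}" for i
  proof -
    have "(\<Sum>j\<in>{1..n}. J_matrix n k j) = (\<Sum>j\<in>{1..n} - {k}. 1) + 0" if "k \<in> {1..n}" for k
      using that by (subst sum.remove[of _ k]) (auto simp: J_matrix_def)
    then show ?thesis using i n by (simp add: jn_def)
  qed
  have close: "\<bar>u i - ?R (\<rho> i)\<bar> \<le> 4 * q" if i: "i \<in> {1..n}" for i
  proof -
    let ?S = "\<Sum>j\<in>{1..n}. noise m n ?\<theta> p X B (\<sigma> i) j"
    have R: "(\<Sum>j\<in>{1..n}. ?\<theta> (\<sigma> i) j) = ?R (\<rho> i)"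
      unfolding row_sum_def by (subst (2) sum.permute[OF \<tau>]) (simp add: permute_def \<rho>_def o_def)
    have S: "?S = row_sum n ?y (\<sigma> i) - jn / 2 - p * (?R (\<rho> i) - jn / 2)"
      unfolding noise_def sum_subtractf sum_distrib_left[symmetric] sum_divide_distrib[symmetric]
        jn[OF \<sigma>_in[OF i]] R by (simp add: row_sum_def)
    have "u i - ?R (\<rho> i) = ?S / p" unfolding S u_def using p by (simp add: field_simps)
    moreover have "\<bar>?S\<bar> / p \<le> 4 * sqrt (n * p * ln n) / p"
      using rows[OF \<sigma>_in[OF i]] p by (intro divide_right_mono) auto
    moreover have "sqrt (n * p * ln n) / p = q"
    proof -
      have "sqrt (n * p * ln n) / p = sqrt (n * p * ln n / p\<^sup>2)" using p by (simp add: real_sqrt_divide)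
      also have "n * p * ln n / p\<^sup>2 = n * ln n / p" using p by (simp add: power2_eq_square field_simps)
      finally show ?thesis by (simp add: q_def)
    qed
    ultimately show ?thesis using p by (simp add: abs_divide)
  qed
  have u_mono: "u i \<le> u j" if "i \<in> {1..n}" "j \<in> {1..n}" "i \<le> j" for i j
    using \<sigma>s[OF that] p by (simp add: u_def divide_right_mono)
  have stab: "\<bar>?R (\<rho> i) - ?R i\<bar> \<le> 8 * q" if "i \<in> {1..n}" for i
    using sorted_stable[where R = "row_sum n f", OF row_sum_mono[OF f] u_mono \<rho> close that] by simp
  have row: "(\<Sum>j\<in>{1..n} - {\<rho> i, i}. (f (\<rho> i) j - f i j)\<^sup>2) \<le> (L / L')\<^sup>2 * (243 * (ln n / p))"
    if i: "i \<in> {1..n}" for i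
  proof -
    have "(\<Sum>j\<in>{1..n} - {\<rho> i, i}. (f (\<rho> i) j - f i j)\<^sup>2)
       \<le> (L / L')\<^sup>2 * ((\<bar>?R (\<rho> i) - ?R i\<bar> + 1)\<^sup>2 / (n - 2))"
      by (rule row_distance_le[OF f \<theta> \<tau> L n \<rho>_in[OF i] i])
    \<comment> \<open>The displacement is at most 8 q and 1 \<le> q absorbs the + 1. With n / (n -
      2) \<le> 3 this gives 81 * 3 = 243, and 972 after the factor 4 from the permutation
      bias.\<close>
    also have "\<dots> \<le> (L / L')\<^sup>2 * ((9 * q)\<^sup>2 / (n - 2))"
      using stab[OF i] q1 by (intro mult_left_mono divide_right_mono power_mono) auto
    also have "(9 * q)\<^sup>2 / (n - 2) = 81 * (ln n / p) * (n / (n - 2))"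
      by (simp add: power_mult_distrib q2)
    also have "(L / L')\<^sup>2 * (81 * (ln n / p) * (n / (n - 2))) \<le> (L / L')\<^sup>2 * (81 * (ln n / p) * 3)"
    proof (intro mult_left_mono)
      show "real n / real (n - 2) \<le> 3" using n by (simp add: field_simps of_nat_diff)
    qed (use ln1 p in auto)
    finally show ?thesis by simp
  qed
  have "(\<Sum>i\<in>{1..n}. \<Sum>j\<in>{1..n}. (f (\<rho> i) (\<rho> j) - f i j)\<^sup>2)
    \<le> 4 * (\<Sum>i\<in>{1..n}. (\<Sum>j\<in>{1..n} - {\<rho> i, i}. (f (\<rho> i) j - f i j)\<^sup>2) + 2)"
    by (rule permutation_bias[OF f \<rho>])
  also have "\<dots> \<le> 4 * (\<Sum>i\<in>{1..n}. (L / L')\<^sup>2 * (243 * (ln n / p)) + 2)"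
    by (intro mult_left_mono sum_mono add_mono row) auto
  also have "\<dots> = 972 * ((L / L')\<^sup>2 * (n * ln n / p)) + 8 * n" by (simp add: algebra_simps)
  finally show ?thesis by (simp add: \<rho>_def)
qed

subsection \<open>The projection and the risk\<close>

lemma closed_ordered_matrices: "closed (ordered_matrices m n)"
proof -
  have cont: "continuous_on UNIV (\<lambda>\<theta>::matrix. \<theta> i j)" for i j
    by (rule continuous_on_product_then_coordinatewise) (rule continuous_on_product_coordinates)
  have imp: "closed {\<theta>::matrix. Q \<longrightarrow> R \<theta>}" if "Q \<Longrightarrow> closed {\<theta>. R \<theta>}" for Q R
    using that by (cases Q) auto
  note intros = closed_Collect_conj closed_Collect_all imp closed_Collect_le closed_Collect_eq
    continuous_intros cont
  show ?thesis
  proof (cases m)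
    case Tournament
    show ?thesis unfolding Tournament ordered_matrices.simps tournament_matrices_def matrices_def
        Ball_def atLeastAtMost_iff mem_Collect_eq by (intro intros)
  next
    case Graph
    show ?thesis unfolding Graph ordered_matrices.simps graph_matrices_def matrices_def
        Ball_def atLeastAtMost_iff mem_Collect_eq by (intro intros)
  qed
qed

lemma compact_PiE_UNIV:
  fixes C :: "'i \<Rightarrow> 'b :: topological_space set"
  assumes "\<And>i. compact (C i)"
  shows "compact (PiE UNIV C)"
proof -
  have "compactin (product_topology (\<lambda>i. euclidean) UNIV) (PiE UNIV C)"
    using assms by (subst compactin_PiE) (auto simp: compactin_euclidean_iff)
  then show ?thesis by (simp add: euclidean_product_topology compactin_euclidean_iff)
qed

text \<open>Matrices are functions on all pairs of naturals, so this is Tychonoff for the cube of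
  functions into \<open>{0..1}\<close>; entries outside the index range are 0 and stay in the
  cube.\<close>

lemma compact_ordered_matrices: "compact (ordered_matrices m n)"
proof -
  let ?C = "PiE UNIV (\<lambda>_::nat. PiE UNIV (\<lambda>_::nat. {0..1::real}))"
  have "compact ?C" by (intro compact_PiE_UNIV compact_Icc)
  moreover have "ordered_matrices m n \<subseteq> ?C"
  proof
    fix \<theta> assume \<theta>: "\<theta> \<in> ordered_matrices m n"
    have "\<theta> i j \<in> {0..1}" for i j
      using ordered_matricesD(1)[OF \<theta>, of i j] ordered_matrices_outside[OF \<theta>, of i j]
      by (cases "i \<in> {1..n} \<and> j \<in> {1..n}") auto
    then show "\<theta> \<in> ?C" by (auto simp: PiE_def)
  qed
  ultimately show ?thesis
    using compact_Int_closed[OF _ closed_ordered_matrices[of m n], of ?C] by (simp add: Int_absorb1)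
qed

text \<open>\<open>arg_min_on\<close> is a mere choice until a minimiser is known to exist;
  compactness and continuity provide one.\<close>

lemma Proj_minimizes:
  assumes \<theta>: "\<theta> \<in> ordered_matrices m n"
  shows "Proj m n A \<in> ordered_matrices m n"
    and "(\<Sum>i\<in>{1..n}. \<Sum>j\<in>{1..n}. (A i j - Proj m n A i j)\<^sup>2) \<le>
      (\<Sum>i\<in>{1..n}. \<Sum>j\<in>{1..n}. (A i j - \<theta> i j)\<^sup>2)"
proof -
  let ?f = "\<lambda>\<theta>. frob_norm n (\<lambda>i j. A i j - \<theta> i j)"
  have cont: "continuous_on S (\<lambda>\<theta>::matrix. \<theta> i j)" for S i j
    by (rule continuous_on_subset[OF continuous_on_product_then_coordinatewise])
       (rule continuous_on_product_coordinates, simp)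
  have "continuous_on (ordered_matrices m n) ?f"
    unfolding frob_norm_def by (intro continuous_intros cont)
  then obtain f where "f \<in> ordered_matrices m n" "\<forall>y\<in>ordered_matrices m n. ?f f \<le> ?f y"
    using continuous_attains_inf[OF compact_ordered_matrices[of m n], of ?f] \<theta> by blast
  then have "is_arg_min ?f (\<lambda>\<theta>. \<theta> \<in> ordered_matrices m n) f"
    by (auto simp: is_arg_min_linorder)
  then have am: "is_arg_min ?f (\<lambda>\<theta>. \<theta> \<in> ordered_matrices m n) (Proj m n A)"
    unfolding Proj_def arg_min_on_def arg_min_def
    by (rule someI[of "is_arg_min ?f (\<lambda>\<theta>. \<theta> \<in> ordered_matrices m n)"])
  then show "Proj m n A \<in> ordered_matrices m n" by (simp add: is_arg_min_linorder)
  have "?f (Proj m n A) \<le> ?f \<theta>" using am \<theta> by (simp add: is_arg_min_linorder)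
  then show "(\<Sum>i\<in>{1..n}. \<Sum>j\<in>{1..n}. (A i j - Proj m n A i j)\<^sup>2) \<le>
      (\<Sum>i\<in>{1..n}. \<Sum>j\<in>{1..n}. (A i j - \<theta> i j)\<^sup>2)"
    by (simp add: frob_norm_def)
qed

section \<open>Sorting permutations and the crude error\<close>

lemma finite_sorting_perms: "finite (sorting_perms n y)"
  by (rule finite_subset[OF _ finite_permutations[of "{1..n}"]]) (auto simp: sorting_perms_def)

text \<open>Together with finiteness this gives \<open>pmf_of_set\<close> its intended meaning, so
  that every drawn permutation does sort the row sums.\<close>

lemma sorting_perms_nonempty: "sorting_perms n y \<noteq> {}"
proof -
  define xs where "xs = sort_key (row_sum n y) [1..<Suc n]"
  define \<sigma> where "\<sigma> i = (if i \<in> {1..n} then xs ! (i - 1) else i)" for i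
  have xs: "length xs = n" "set xs = {1..n}" "distinct xs" by (auto simp: xs_def)
  have "bij_betw (\<lambda>i. i - 1) {1..n} {..<n}"
    by (rule bij_betw_byWitness[of _ Suc]) auto
  then have "bij_betw ((!) xs \<circ> (\<lambda>i. i - 1)) {1..n} {1..n}"
    by (rule bij_betw_trans) (use bij_betw_nth[OF xs(3)] xs in auto)
  then have "bij_betw \<sigma> {1..n} {1..n}"
    by (subst bij_betw_cong[of _ _ "(!) xs \<circ> (\<lambda>i. i - 1)"]) (auto simp: \<sigma>_def)
  then have "\<sigma> permutes {1..n}" by (rule bij_imp_permutes) (auto simp: \<sigma>_def)
  moreover have "row_sum n y (\<sigma> i) \<le> row_sum n y (\<sigma> j)" if "i \<in> {1..n}" "j \<in> {1..n}" "i \<le> j" for i j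
  proof -
    have "sorted (map (row_sum n y) xs)" by (simp add: xs_def)
    then have "map (row_sum n y) xs ! (i - 1) \<le> map (row_sum n y) xs ! (j - 1)"
      using that xs(1) by (intro sorted_nth_mono) auto
    then show ?thesis using that xs(1) by (auto simp: \<sigma>_def)
  qed
  ultimately show ?thesis by (auto simp: sorting_perms_def)
qed

lemma sum_permute2:
  fixes h :: "nat \<Rightarrow> nat \<Rightarrow> real"
  assumes \<sigma>: "\<sigma> permutes {1..n}"
  shows "(\<Sum>i\<in>{1..n}. \<Sum>j\<in>{1..n}. h (\<sigma> i) (\<sigma> j)) = (\<Sum>i\<in>{1..n}. \<Sum>j\<in>{1..n}. h i j)"
  by (subst (3) sum.permute[OF \<sigma>], subst (4) sum.permute[OF \<sigma>]) (simp add: o_def)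

lemma estimator_error_crude:
  assumes \<theta>: "\<theta> \<in> param_space m n" and \<sigma>: "\<sigma> permutes {1..n}"
  shows "(frob_norm n (\<lambda>i j. estimator m n y ph \<sigma> i j - \<theta> i j))\<^sup>2 \<le> (real n)\<^sup>2"
proof -
  obtain f0 where f0: "f0 \<in> ordered_matrices m n" using \<theta> by (auto simp: param_space_def)
  have "(estimator m n y ph \<sigma> i j - \<theta> i j)\<^sup>2 \<le> 1" if ij: "i \<in> {1..n}" "j \<in> {1..n}" for i j
  proof -
    have "inv \<sigma> k \<in> {1..n}" if "k \<in> {1..n}" for k
      using permutes_in_image[OF permutes_inv[OF \<sigma>]] that by blast
    then have "estimator m n y ph \<sigma> i j \<in> {0..1}"
      using ij ordered_matricesD(1)[OF Proj_minimizes(1)[OF f0]]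
      by (auto simp: estimator_def permute_def J_matrix_def)
    then have "\<bar>estimator m n y ph \<sigma> i j - \<theta> i j\<bar> \<le> 1"
      using param_spaceD(1)[OF \<theta> ij] by auto
    then show ?thesis by (simp add: abs_square_le_1)
  qed
  then have "(\<Sum>i\<in>{1..n}. \<Sum>j\<in>{1..n}. (estimator m n y ph \<sigma> i j - \<theta> i j)\<^sup>2) \<le> (\<Sum>i\<in>{1..n}. \<Sum>j\<in>{1..n}. 1)"
    by (intro sum_mono) auto
  then show ?thesis by (simp add: frob_norm_def sum_nonneg power2_eq_square)
qed

section \<open>The good event and the risk\<close>

definition good_data :: "model \<Rightarrow> nat \<Rightarrow> matrix \<Rightarrow> real \<Rightarrow> (nat \<times> nat \<Rightarrow> bool) \<Rightarrow> (nat \<times> nat \<Rightarrow> bool) \<Rightarrow> bool"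
  where "good_data m n \<theta> p X B \<longleftrightarrow>
    \<bar>real (card {e \<in> upper_pairs n. B e}) - p * real (n choose 2)\<bar> \<le> 2 * sqrt (p * real (n choose 2) * ln n) \<and>
    (\<forall>i\<in>{1..n}. \<bar>\<Sum>j\<in>{1..n}. noise m n \<theta> p X B i j\<bar> \<le> 4 * sqrt (n * p * ln n)) \<and>
    block_bounded n p (noise m n \<theta> p X B)"

lemma prob_not_good_data:
  assumes \<theta>: "\<theta> \<in> param_space m n" and p: "p \<in> {0..1}" and n: "n \<ge> 2" and np: "p \<ge> 2 * ln n / n"
  shows "measure_pmf.prob (data_pmf n \<theta> p) {(X, B). \<not> good_data m n \<theta> p X B} \<le> 7 / n"
proof -
  let ?P = "measure_pmf.prob (data_pmf n \<theta> p)"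
  let ?A = "{(X, B). \<not> \<bar>real (card {e \<in> upper_pairs n. B e}) - p * real (n choose 2)\<bar>
     \<le> 2 * sqrt (p * real (n choose 2) * ln n)}"
  let ?B = "{(X, B). \<not> (\<forall>i\<in>{1..n}. \<bar>\<Sum>j\<in>{1..n}. noise m n \<theta> p X B i j\<bar> \<le> 4 * sqrt (n * p * ln n))}"
  let ?C = "{(X, B). \<not> block_bounded n p (noise m n \<theta> p X B)}"
  have "{(X, B). \<not> good_data m n \<theta> p X B} = ?A \<union> (?B \<union> ?C)" unfolding good_data_def by blast
  then have "?P {(X, B). \<not> good_data m n \<theta> p X B} \<le> ?P ?A + ?P (?B \<union> ?C)"
    by (simp only:) (rule measure_Un_le; simp)
  also have "?P (?B \<union> ?C) \<le> ?P ?B + ?P ?C" by (rule measure_Un_le) simp_all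
  also have "?P ?A + (?P ?B + ?P ?C) \<le> 2 / n + (2 / n + 3 / n)"
    by (intro add_mono prob_observed_count[OF \<theta> p n np] prob_row_noise[OF \<theta> p n np]
        prob_not_block_bounded[OF \<theta> p n np])
  finally show ?thesis by (simp add: add_divide_distrib[symmetric])
qed

text \<open>For n \<ge> 17 at least 16 \<open>ln n\<close> observations are expected, which makes
  the deviation 2 sqrt (p N \<open>ln n\<close>) at most half of the mean p N.\<close>

lemma p_hat_close:
  assumes p: "0 < p" "p \<le> 1" and n: "n \<ge> 17" and np: "p \<ge> 2 * ln n / n"
    and cnt: "\<bar>real (card {e \<in> upper_pairs n. B e}) - p * real (n choose 2)\<bar> \<le> 2 * sqrt (p * real (n choose 2) * ln n)"
  shows "p / 2 \<le> p_hat n B" "p_hat n B \<ge> 1 / n" "(p / p_hat n B - 1)\<^sup>2 * (real n)\<^sup>2 \<le> 64 * ln n / p"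
proof -
  define N where "N = real (n choose 2)"
  have N: "N = n * (real n - 1) / 2" using n by (simp add: N_def choose_two real_of_nat_div of_nat_diff)
  have l: "ln (real n) \<ge> 1"
    using n e_less_272 by (subst ln_ge_iff) (auto intro: order_trans[of _ 3])
  have npl: "n * p \<ge> 2 * ln n" using np n by (simp add: field_simps)
  have N0: "N > 0" using n by (simp add: N)
  have nN: "(real n)\<^sup>2 \<le> 4 * N" using n by (simp add: N power2_eq_square)
  have pN: "p * N \<ge> 16 * ln n"
  proof -
    have "(n * p) * (real n - 1) \<ge> (2 * ln n) * 16" using l n p by (intro mult_mono[OF npl]) auto
    moreover have "p * N = (n * p) * (real n - 1) / 2" by (simp add: N)
    ultimately show ?thesis by linarith
  qed
  define d where "d = p_hat n B - p"
  have d: "d * N = real (card {e \<in> upper_pairs n. B e}) - p * N"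
    using N0 by (simp add: d_def p_hat_def N_def[symmetric] left_diff_distrib)
  have "\<bar>d * N\<bar>\<^sup>2 \<le> (2 * sqrt (p * N * ln n))\<^sup>2"
    using cnt unfolding N_def[symmetric] d[symmetric] by (intro power_mono) auto
  then have dN: "(d * N)\<^sup>2 \<le> 4 * (p * N * ln n)" using p N0 l by (simp add: power_mult_distrib)
  also have "4 * (p * N * ln n) = p * N * (4 * ln n)" by simp
  also have "\<dots> \<le> p * N * (p * N / 4)" using pN p N0 by (intro mult_left_mono) auto
  also have "\<dots> = (p / 2 * N)\<^sup>2" by (simp add: power2_eq_square)
  finally have "\<bar>d * N\<bar> \<le> p / 2 * N" using p N0 by (simp add: abs_le_square_iff[symmetric])
  then have "\<bar>d\<bar> \<le> p / 2" using N0 by (simp add: abs_mult)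
  then show ph: "p / 2 \<le> p_hat n B" unfolding d_def by linarith
  have "1 / n \<le> ln n / n" using l by (intro divide_right_mono) auto
  also have "\<dots> \<le> p / 2" using np by (simp add: mult.commute)
  finally have "1 / n \<le> p / 2" .
  then show "p_hat n B \<ge> 1 / n" using ph by linarith
  have ph0: "p_hat n B > 0" using ph p by linarith
  have "d\<^sup>2 * N \<le> 4 * (p * ln n)"
    using dN N0 by (simp add: power_mult_distrib power2_eq_square)
  moreover have "d\<^sup>2 * (real n)\<^sup>2 \<le> d\<^sup>2 * (4 * N)" by (intro mult_left_mono nN) simp
  ultimately have dn: "d\<^sup>2 * (real n)\<^sup>2 \<le> 16 * (p * ln n)" by linarith
  have "p / p_hat n B - 1 = - d / p_hat n B" using ph0 by (simp add: d_def field_simps)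
  then have "(p / p_hat n B - 1)\<^sup>2 = d\<^sup>2 / (p_hat n B)\<^sup>2" by (simp add: power_divide)
  also have "\<dots> \<le> d\<^sup>2 / (p / 2)\<^sup>2" using ph p ph0 by (intro divide_left_mono power_mono mult_pos_pos) auto
  finally have "(p / p_hat n B - 1)\<^sup>2 * (real n)\<^sup>2 \<le> d\<^sup>2 / (p / 2)\<^sup>2 * (real n)\<^sup>2" by (intro mult_right_mono) auto
  also have "\<dots> = (d\<^sup>2 * (real n)\<^sup>2) * 4 / p\<^sup>2" by (simp add: power_divide)
  also have "\<dots> \<le> (16 * (p * ln n)) * 4 / p\<^sup>2" using dn by (intro divide_right_mono mult_right_mono) auto
  also have "\<dots> = 64 * ln n / p" using p by (simp add: power2_eq_square)
  finally show "(p / p_hat n B - 1)\<^sup>2 * (real n)\<^sup>2 \<le> 64 * ln n / p" .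
qed

lemma estimator_error_good:
  assumes f0: "f0 \<in> ordered_matrices m n" and \<tau>: "\<tau> permutes {1..n}"
    and \<theta>: "permute f0 \<tau> \<in> holder_class m n \<alpha> L L'" and L: "L > 0" "L' > 0"
    and n: "n \<ge> 17" and p: "p \<in> {0..1}" and np: "p \<ge> 2 * ln n / n"
    and good: "good_data m n (permute f0 \<tau>) p X B"
    and \<sigma>: "\<sigma> \<in> sorting_perms n (data_matrix m n X B)"
  shows "(frob_norm n (\<lambda>i j. estimator m n (data_matrix m n X B) (p_hat n B) \<sigma> i j - permute f0 \<tau> i j))\<^sup>2
    \<le> 180000 * ((L / L')\<^sup>2 * (n * ln n / p) + n * (ln n)\<^sup>2 / p)"
proof -
  let ?\<theta> = "permute f0 \<tau>" and ?y = "data_matrix m n X B" and ?ph = "p_hat n B"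
  let ?z = "noise m n ?\<theta> p X B"
  have \<theta>': "?\<theta> \<in> param_space m n" using \<theta> by (simp add: holder_class_def)
  have l: "ln (real n) \<ge> 1"
    using n e_less_272 by (subst ln_ge_iff) (auto intro: order_trans[of _ 3])
  have "2 * ln n / n > 0" using l n by simp
  then have p0: "0 < p" "p \<le> 1" using np p by auto
  have \<sigma>p: "\<sigma> permutes {1..n}" using \<sigma> by (simp add: sorting_perms_def)
  have \<sigma>_in: "\<sigma> k \<in> {1..n}" if "k \<in> {1..n}" for k using permutes_in_image[OF \<sigma>p] that by blast
  note ph = p_hat_close[OF p0 n np good[unfolded good_data_def, THEN conjunct1]]
  have ph0: "?ph > 0" using ph(1) p0 by linarith
  define A where "A = permute (\<lambda>i j. (?y i j - J_matrix n i j / 2) / ?ph + J_matrix n i j / 2) \<sigma>"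
  define f where "f = Proj m n A"
  define b where "b i j = f0 (\<tau> (\<sigma> i)) (\<tau> (\<sigma> j)) - f0 i j" for i j
  define \<Delta> where "\<Delta> i j = f i j - f0 i j" for i j
  define w where "w i j = ?\<theta> (\<sigma> i) (\<sigma> j) - J_matrix n (\<sigma> i) (\<sigma> j) / 2" for i j
  define t where "t = p / ?ph - 1"
  define D where "D = (\<Sum>i\<in>{1..n}. \<Sum>j\<in>{1..n}. (\<Delta> i j)\<^sup>2)"
  define bb where "bb = (\<Sum>i\<in>{1..n}. \<Sum>j\<in>{1..n}. (b i j)\<^sup>2)"
  define Z where "Z = (\<Sum>i\<in>{1..n}. \<Sum>j\<in>{1..n}. ?z (\<sigma> i) (\<sigma> j) * \<Delta> i j)"
  have f: "f \<in> ordered_matrices m n" unfolding f_def by (rule Proj_minimizes(1)[OF f0])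
  have est: "estimator m n ?y ?ph \<sigma> = permute f (inv \<sigma>)"
    using ph(2) by (simp add: estimator_def f_def A_def)
  \<comment> \<open>Three sources of error: the wrong ordering, the noise, and the use of
    \<open>p_hat\<close> in place of p.\<close>
  have A_eq: "A i j - f0 i j = b i j + ?z (\<sigma> i) (\<sigma> j) / ?ph + t * w i j" for i j
    using ph0 by (simp add: A_def permute_def b_def noise_def t_def w_def field_simps)
  have w_bound: "(w i j)\<^sup>2 \<le> 1 / 4" if ij: "i \<in> {1..n}" "j \<in> {1..n}" for i j
  proof -
    have "\<bar>w i j\<bar> \<le> 1 / 2"
    proof (cases "\<sigma> i = \<sigma> j")
      case True
      then show ?thesis using param_spaceD(2)[OF \<theta>' \<sigma>_in \<sigma>_in, OF ij] by (simp add: w_def J_matrix_def)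
    next
      case False
      then have "J_matrix n (\<sigma> i) (\<sigma> j) = 1" using \<sigma>_in[OF ij(1)] \<sigma>_in[OF ij(2)] by (simp add: J_matrix_def)
      moreover have "0 \<le> ?\<theta> (\<sigma> i) (\<sigma> j)" "?\<theta> (\<sigma> i) (\<sigma> j) \<le> 1"
        using param_spaceD(1)[OF \<theta>' \<sigma>_in \<sigma>_in, OF ij] by auto
      ultimately show ?thesis unfolding w_def by linarith
    qed
    then have "\<bar>w i j\<bar>\<^sup>2 \<le> (1 / 2)\<^sup>2" by (intro power_mono) auto
    then show ?thesis by (simp add: power_divide)
  qed
  \<comment> \<open>The basic inequality: the projection is at least as close to \<open>A\<close> as
    the true ordered matrix \<open>f0\<close> is.\<close>
  have "D \<le> (\<Sum>i\<in>{1..n}. \<Sum>j\<in>{1..n}. 2 * ((A i j - f0 i j) * \<Delta> i j))"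
  proof -
    have "(\<Sum>i\<in>{1..n}. \<Sum>j\<in>{1..n}. (A i j - f i j)\<^sup>2) \<le> (\<Sum>i\<in>{1..n}. \<Sum>j\<in>{1..n}. (A i j - f0 i j)\<^sup>2)"
      unfolding f_def by (rule Proj_minimizes(2)[OF f0])
    also have "(\<Sum>i\<in>{1..n}. \<Sum>j\<in>{1..n}. (A i j - f i j)\<^sup>2) =
      (\<Sum>i\<in>{1..n}. \<Sum>j\<in>{1..n}. (A i j - f0 i j)\<^sup>2 - 2 * ((A i j - f0 i j) * \<Delta> i j) + (\<Delta> i j)\<^sup>2)"
      by (intro sum.cong refl) (simp add: \<Delta>_def power2_eq_square algebra_simps)
    finally show ?thesis by (simp only: sum.distrib sum_subtractf D_def)
  qed
  also have "\<dots> \<le> (\<Sum>i\<in>{1..n}. \<Sum>j\<in>{1..n}. 8 * (b i j)\<^sup>2 + (\<Delta> i j)\<^sup>2 / 4 + 2 * t\<^sup>2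
      + 2 / ?ph * (?z (\<sigma> i) (\<sigma> j) * \<Delta> i j))"
  proof (intro sum_mono)
    fix i j assume ij: "i \<in> {1..n}" "j \<in> {1..n}"
    \<comment> \<open>Applied to the bias and to the \<open>p_hat\<close> error, this spends D / 8
      each; the noise term spends another D / 4, so half of D remains on the left.\<close>
    have "2 * (x * \<Delta> i j) \<le> 8 * x\<^sup>2 + (\<Delta> i j)\<^sup>2 / 8" for x
      using zero_le_power2[of "8 * x - \<Delta> i j"] by (simp add: power2_eq_square algebra_simps)
    note this[of "b i j"] this[of "t * w i j"]
    moreover have "(t * w i j)\<^sup>2 \<le> t\<^sup>2 * (1 / 4)"
      unfolding power_mult_distrib by (intro mult_left_mono w_bound ij) auto
    moreover have "2 * ((A i j - f0 i j) * \<Delta> i j) = 2 * (b i j * \<Delta> i j) + 2 * (t * w i j * \<Delta> i j)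
        + 2 / ?ph * (?z (\<sigma> i) (\<sigma> j) * \<Delta> i j)"
      unfolding A_eq by (simp add: algebra_simps)
    ultimately show "2 * ((A i j - f0 i j) * \<Delta> i j) \<le> 8 * (b i j)\<^sup>2 + (\<Delta> i j)\<^sup>2 / 4 + 2 * t\<^sup>2
      + 2 / ?ph * (?z (\<sigma> i) (\<sigma> j) * \<Delta> i j)" by linarith
  qed
  also have "\<dots> = 8 * bb + D / 4 + 2 * (t\<^sup>2 * (real n)\<^sup>2) + 2 / ?ph * Z"
    by (simp only: sum.distrib sum_distrib_left[symmetric] sum_divide_distrib[symmetric] bb_def D_def Z_def)
       (simp add: power2_eq_square)
  finally have D1: "D \<le> 8 * bb + D / 4 + 2 * (t\<^sup>2 * (real n)\<^sup>2) + 2 / ?ph * Z" .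
  have D0: "D \<ge> 0" by (simp add: D_def sum_nonneg)
  define V where "V = p / 16 * (D + n) + 11200 * n * (ln n)\<^sup>2"
  have V0: "V \<ge> 0" using D0 p0 by (simp add: V_def)
  have zd: "?z i i = 0" if "i \<in> {1..n}" for i by (rule noise_diag[OF \<theta>' p that])
  have n2: "2 \<le> n" using n by simp
  have "Z \<le> V"
    unfolding Z_def \<Delta>_def V_def D_def
    using noise_ordered[OF n2 p0 good[unfolded good_data_def, THEN conjunct2, THEN conjunct2] zd \<sigma>p f f0] by simp
  then have "2 / ?ph * Z \<le> 2 / ?ph * V" using ph0 by (intro mult_left_mono) auto
  \<comment> \<open>Replacing \<open>p_hat\<close> by p / 2 gives the factor 4 / p, which cancels
    the p in p / 16 and leaves D / 4.\<close>
  also have "\<dots> \<le> 2 / (p / 2) * V"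
    using ph(1) ph0 p0 V0 by (intro mult_right_mono divide_left_mono mult_pos_pos) auto
  also have "\<dots> = D / 4 + n / 4 + 44800 * (n * (ln n)\<^sup>2 / p)"
    using p0 by (simp add: V_def field_simps)
  finally have D2: "D \<le> 16 * bb + 4 * (t\<^sup>2 * (real n)\<^sup>2) + n / 2 + 89600 * (n * (ln n)\<^sup>2 / p)"
    using D1 by linarith
  have t: "t\<^sup>2 * (real n)\<^sup>2 \<le> 64 * (ln n / p)" using ph(3) by (simp add: t_def)
  have n3: "3 \<le> n" using n by simp
  have b: "bb \<le> 972 * ((L / L')\<^sup>2 * (n * ln n / p)) + 8 * n"
    unfolding bb_def b_def
    by (rule sorting_bias[OF f0 \<theta> \<tau> L n3 p0 _ \<sigma>]) (use good in \<open>simp add: good_data_def\<close>)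
  have "(frob_norm n (\<lambda>i j. estimator m n ?y ?ph \<sigma> i j - ?\<theta> i j))\<^sup>2 =
     (\<Sum>i\<in>{1..n}. \<Sum>j\<in>{1..n}. (f (inv \<sigma> i) (inv \<sigma> j) - ?\<theta> i j)\<^sup>2)"
    by (simp add: est frob_norm_def sum_nonneg permute_def)
  also have "\<dots> = (\<Sum>i\<in>{1..n}. \<Sum>j\<in>{1..n}. (f (inv \<sigma> (\<sigma> i)) (inv \<sigma> (\<sigma> j)) - ?\<theta> (\<sigma> i) (\<sigma> j))\<^sup>2)"
    by (rule sum_permute2[OF \<sigma>p, symmetric])
  also have "\<dots> = (\<Sum>i\<in>{1..n}. \<Sum>j\<in>{1..n}. (\<Delta> i j - b i j)\<^sup>2)"
    by (simp add: permutes_inverses[OF \<sigma>p] \<Delta>_def b_def permute_def)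
  also have "\<dots> \<le> (\<Sum>i\<in>{1..n}. \<Sum>j\<in>{1..n}. 2 * (\<Delta> i j)\<^sup>2 + 2 * (b i j)\<^sup>2)"
  proof (intro sum_mono)
    fix i j
    show "(\<Delta> i j - b i j)\<^sup>2 \<le> 2 * (\<Delta> i j)\<^sup>2 + 2 * (b i j)\<^sup>2"
      using zero_le_power2[of "\<Delta> i j + b i j"] by (simp add: power2_eq_square algebra_simps)
  qed
  also have "\<dots> = 2 * D + 2 * bb" by (simp only: sum.distrib sum_distrib_left[symmetric] D_def bb_def)
  finally have main: "(frob_norm n (\<lambda>i j. estimator m n ?y ?ph \<sigma> i j - ?\<theta> i j))\<^sup>2 \<le> 2 * D + 2 * bb" .
  have "1 \<le> (ln n)\<^sup>2" using l by simp
  have "real n * 1 \<le> n * ((ln n)\<^sup>2 / p)"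
    using p0 \<open>1 \<le> (ln n)\<^sup>2\<close> by (intro mult_left_mono) (auto simp: field_simps)
  then have e1: "real n \<le> n * (ln n)\<^sup>2 / p" by simp
  have "1 * ln n \<le> n * ln n * ln n" using l n mult_mono[of 1 "real n" 1 "ln n"] by (intro mult_right_mono) auto
  then have e2: "ln n / p \<le> n * (ln n)\<^sup>2 / p" using p0 by (intro divide_right_mono) (auto simp: power2_eq_square mult_ac)
  \<comment> \<open>The projection noise contributes 2 * 89600 to the coefficient of
    \<open>v\<close>; the remaining lower-order terms add less than 800, which gives 180000.\<close>
  define u v where "u = (L / L')\<^sup>2 * (n * ln n / p)" and "v = n * (ln n)\<^sup>2 / p"
  have "u \<ge> 0" using l p0 by (simp add: u_def)
  then show ?thesis
    using main D2 t b e1 e2 unfolding u_def[symmetric] v_def[symmetric] of_nat_mult by (simp add: distrib_left)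
qed

text \<open>The tie-breaking permutation is drawn jointly with the data, the bounds hold for every
  sorting permutation, and the bad event depends on the data alone, so only the data marginal enters
  its probability.\<close>

lemma expectation_estimator_le:
  assumes h0: "D \<ge> 0"
    and good: "\<And>X B \<sigma>. \<not> bad X B \<Longrightarrow> \<sigma> \<in> sorting_perms n (data_matrix m n X B) \<Longrightarrow>
      h (estimator m n (data_matrix m n X B) (p_hat n B) \<sigma>) \<le> D"
    and crude: "\<And>X B \<sigma>. \<sigma> \<in> sorting_perms n (data_matrix m n X B) \<Longrightarrow>
      h (estimator m n (data_matrix m n X B) (p_hat n B) \<sigma>) \<le> H"
    and H: "H \<ge> 0"
  shows "measure_pmf.expectation (estimator_pmf m n \<theta> p) h
    \<le> D + H * measure_pmf.prob (data_pmf n \<theta> p) {(X, B). bad X B}"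
proof -
  define S where "S = (\<lambda>(X, B). sorting_perms n (data_matrix m n X B))"
  define K where "K = bind_pmf (data_pmf n \<theta> p) (\<lambda>z. map_pmf (\<lambda>\<sigma>. (z, \<sigma>)) (pmf_of_set (S z)))"
  define est where "est = (\<lambda>((X, B), \<sigma>). estimator m n (data_matrix m n X B) (p_hat n B) \<sigma>)"
  have set_S: "set_pmf (pmf_of_set (S z)) = S z" "finite (S z)" for z
    by (cases z; simp add: S_def sorting_perms_nonempty finite_sorting_perms)+
  have "estimator_pmf m n \<theta> p = map_pmf est K"
    by (simp add: estimator_pmf_def K_def est_def data_pmf_def pair_pmf_def S_def map_pmf_def Let_def
        bind_assoc_pmf bind_return_pmf)
  then have "measure_pmf.expectation (estimator_pmf m n \<theta> p) h = measure_pmf.expectation K (\<lambda>k. h (est k))"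
    by simp
  also have "\<dots> \<le> measure_pmf.expectation K (\<lambda>k. D + H * indicat_real {(X, B). bad X B} (fst k))"
  proof (rule integral_mono_AE)
    have fin: "finite (set_pmf K)"
      by (auto simp: K_def set_S finite_set_data_pmf)
    show "integrable (measure_pmf K) (\<lambda>k. h (est k))"
      "integrable (measure_pmf K) (\<lambda>k. D + H * indicat_real {(X, B). bad X B} (fst k))"
      by (rule integrable_measure_pmf_finite[OF fin])+
    show "AE k in measure_pmf K. h (est k) \<le> D + H * indicat_real {(X, B). bad X B} (fst k)"
    proof (rule AE_pmfI)
      fix k assume "k \<in> set_pmf K"
      then obtain X B \<sigma> where k: "k = ((X, B), \<sigma>)" "\<sigma> \<in> sorting_perms n (data_matrix m n X B)"
        by (auto simp: K_def set_S) (auto simp: S_def)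
      show "h (est k) \<le> D + H * indicat_real {(X, B). bad X B} (fst k)"
        using good[of X B \<sigma>] crude[of \<sigma> X B] k h0 by (cases "bad X B") (auto simp: est_def)
    qed
  qed
  also have "\<dots> = measure_pmf.expectation (map_pmf fst K) (\<lambda>z. D + H * indicat_real {(X, B). bad X B} z)"
    by simp
  also have "map_pmf fst K = data_pmf n \<theta> p"
    by (simp add: K_def map_bind_pmf map_pmf_comp bind_return_pmf')
  also have "measure_pmf.expectation (data_pmf n \<theta> p) (\<lambda>z. D + H * indicat_real {(X, B). bad X B} z) =
     D + H * measure_pmf.prob (data_pmf n \<theta> p) {(X, B). bad X B}"
    by (simp add: measure_pmf.emeasure_eq_measure)
  finally show ?thesis .
qed

lemma risk_bound:
  assumes L: "L > 0" "L' > 0" and n: "n \<ge> 2" and p: "p \<in> {0..1}" and np: "p \<ge> 2 * ln (real n) / real n"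
    and \<theta>: "\<theta> \<in> holder_class m n \<alpha> L L'"
  shows "1 / (real n)\<^sup>2 * measure_pmf.expectation (estimator_pmf m n \<theta> p)
                 (\<lambda>\<theta>hat. (frob_norm n (\<lambda>i j. \<theta>hat i j - \<theta> i j))\<^sup>2)
     \<le> 200000 * ((L / L')\<^sup>2 * (ln (real n) / (real n * p)) + (ln (real n))\<^sup>2 / (real n * p))"
proof -
  let ?h = "\<lambda>\<theta>hat. (frob_norm n (\<lambda>i j. \<theta>hat i j - \<theta> i j))\<^sup>2"
  let ?E = "measure_pmf.expectation (estimator_pmf m n \<theta> p) ?h"
  have \<theta>': "\<theta> \<in> param_space m n" using \<theta> by (simp add: holder_class_def)
  then obtain f0 \<tau> where f0: "f0 \<in> ordered_matrices m n" "\<tau> permutes {1..n}" "\<theta> = permute f0 \<tau>"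
    by (auto simp: param_space_def)
  have ln2: "ln (real n) \<ge> 2 / 3"
    using n ln2_ge_two_thirds ln_mono[of 2 "real n"] by linarith
  have "2 * ln (real n) / real n > 0" using ln2 n by simp
  then have p0: "0 < p" "p \<le> 1" using np p by auto
  have crude: "?h (estimator m n (data_matrix m n X B) (p_hat n B) \<sigma>) \<le> (real n)\<^sup>2"
    if "\<sigma> \<in> sorting_perms n (data_matrix m n X B)" for X B \<sigma>
    using that by (intro estimator_error_crude[OF \<theta>']) (simp add: sorting_perms_def)
  define a where "a = (L / L')\<^sup>2 * (ln n / (n * p))"
  define b where "b = (ln n)\<^sup>2 / (n * p)"
  have a0: "a \<ge> 0" using ln2 p0 by (simp add: a_def)
  have b0: "b \<ge> 0" using p0 by (simp add: b_def)
  have b_low: "b * (n * p) \<ge> 4 / 9"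
  proof -
    have "(2 / 3)\<^sup>2 \<le> (ln (real n))\<^sup>2" using ln2 by (intro power_mono) auto
    then show ?thesis using n p0 by (simp add: b_def power2_eq_square)
  qed
  have b_low': "4 / 9 \<le> b * n"
  proof -
    have "real n * p \<le> n * 1" using p0 by (simp add: mult_left_le)
    then have "b * (n * p) \<le> b * (n * 1)" using b0 by (intro mult_left_mono) auto
    then show ?thesis using b_low by simp
  qed
  have "1 / (real n)\<^sup>2 * ?E \<le> 200000 * (a + b)"
  \<comment> \<open>For smaller n the trivial risk bound 1 suffices, since b n \<ge> 4/9 keeps the
    second term of the rate away from 0. The same inequality absorbs the failure probability 7 / n
    when n is large.\<close>
  proof (cases "n \<ge> 17")
    case False
    have "?E \<le> 0 + (real n)\<^sup>2 * measure_pmf.prob (data_pmf n \<theta> p) {(X, B). True}"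
      by (rule expectation_estimator_le) (use crude in auto)
    also have "\<dots> \<le> (real n)\<^sup>2" by (simp add: mult_left_le)
    finally have "1 / (real n)\<^sup>2 * ?E \<le> 1" using n by (simp add: field_simps)
    also have "1 \<le> 200000 * b"
    proof -
      have "b * n \<le> b * 17" using False b0 by (intro mult_left_mono) auto
      then show ?thesis using b_low' by linarith
    qed
    finally show ?thesis using a0 by simp
  next
    case True
    define D where "D = 180000 * ((L / L')\<^sup>2 * (n * ln n / p) + n * (ln n)\<^sup>2 / p)"
    have D0: "D \<ge> 0" using ln2 p0 by (simp add: D_def)
    have "?E \<le> D + (real n)\<^sup>2 * measure_pmf.prob (data_pmf n \<theta> p) {(X, B). \<not> good_data m n \<theta> p X B}"
    proof (rule expectation_estimator_le[OF D0])
      fix X B \<sigma> assume "\<not> \<not> good_data m n \<theta> p X B" "\<sigma> \<in> sorting_perms n (data_matrix m n X B)"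
      then show "?h (estimator m n (data_matrix m n X B) (p_hat n B) \<sigma>) \<le> D"
        unfolding D_def f0(3)
        using estimator_error_good[OF f0(1,2) \<theta>[unfolded f0(3)] L True p np] by blast
    qed (use crude in auto)
    also have "\<dots> \<le> D + (real n)\<^sup>2 * (7 / n)"
      by (intro add_left_mono mult_left_mono prob_not_good_data[OF \<theta>' p n np]) auto
    finally have "1 / (real n)\<^sup>2 * ?E \<le> 1 / (real n)\<^sup>2 * (D + (real n)\<^sup>2 * (7 / n))"
      by (intro mult_left_mono) auto
    also have "\<dots> = 180000 * (a + b) + 7 / n"
      using n p0 by (simp add: D_def a_def b_def power2_eq_square field_simps)
    finally have E: "1 / (real n)\<^sup>2 * ?E \<le> 180000 * (a + b) + 7 / n" .
    define c where "c = 7 / real n"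
    have "c \<le> 63 / 4 * b" using b_low' n by (simp add: c_def field_simps)
    then have "180000 * (a + b) + c \<le> 200000 * (a + b)" using a0 b0 by simp
    with E show ?thesis unfolding c_def by (rule order_trans)
  qed
  then show ?thesis by (simp add: a_def b_def)
qed

theorem corollary2p5:
  shows "\<exists>C::real. \<forall>(m::model) (\<alpha>::real) (L::real) (L'::real) (n::nat) (p::real).
    \<alpha> > 0 \<and> L > 0 \<and> L' > 0 \<and> n \<ge> 2 \<and> p \<in> {0..1} \<and> p \<ge> 2 * ln (real n) / real n \<longrightarrow>
    (SUP \<theta>\<in>holder_class m n \<alpha> L L'.
        ereal (1 / (real n)\<^sup>2 * measure_pmf.expectation (estimator_pmf m n \<theta> p)
                 (\<lambda>\<theta>hat. (frob_norm n (\<lambda>i j. \<theta>hat i j - \<theta> i j))\<^sup>2)))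
      \<le> ereal (C * ((L / L')\<^sup>2 * (ln (real n) / (real n * p)) + (ln (real n))\<^sup>2 / (real n * p)))"
  by (intro exI[of _ 200000] allI impI SUP_least) (simp only: ereal_less_eq, elim conjE, rule risk_bound)

end
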